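(* Let $f_1=h_1+\overline{g_1}$ and $f_2=h_2+\overline{g_2}$ be locally univalent and sense-preserving harmonic mappings in $\mathbb{D}$ such that, for some real numbers $\mu_1$, $\mu_2$ and $\nu$, the functions $h_1+e^{-2i\mu_1}g_1$ and $h_2+e^{-2i\mu_2}g_2$ belong to $\mathcal{K}$ and $$\big((h_1+e^{-2i\mu_1}g_1)*(h_2+e^{-2i\mu_2}g_2)\big)(z)=\int_0^z \frac{d\xi}{1-2\xi e^{i(\mu_1+\mu_2)}\cos\nu+\xi^2e^{2i(\mu_1+\mu_2)}},\quad z\in\mathbb{D}.$$ Then the convolution $f_1*f_2$ is univalent and convex in the direction of $-(\mu_1+\mu_2)$, provided that $f_1*f_2$ is locally univalent and sense-preserving in $\mathbb{D}$.
   Context: $\mathbb{D}=\{z\in\mathbb{C}:|z|<1\}$. Every complex-valued harmonic function on $\mathbb{D}$ is written $f=h+\overline{g}$ with $h,g$ analytic in $\mathbb{D}$, and is assumed normalized: $h(0)=h'(0)-1=g(0)=0$. Such $f$ is locally univalent and sense-preserving iff $|g'|<|h'|$ on $\mathbb{D}$. $\mathcal{K}$ is the class of analytic univalent functions $\psi$ on $\mathbb{D}$ with $\psi(0)=\psi'(0)-1=0$ and $\psi(\mathbb{D})$ convex. For analytic $\phi_1(z)=\sum_{n\ge0} a_nz^n$, $\phi_2(z)=\sum_{n\ge0} b_nz^n$ the convolution is $(\phi_1*\phi_2)(z)=\sum_{n\ge0} a_nb_nz^n$. For harmonic $f_1=h_1+\overline{g_1}$, $f_2=h_2+\overline{g_2}$,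 $f_1*f_2:=h_1*h_2+\overline{g_1*g_2}$. For real $\gamma$, a domain is convex in the direction of $\gamma$ if every line parallel to the line joining the origin to $e^{i\gamma}$ has connected (possibly empty) intersection with it. A function on $\mathbb{D}$ is convex in the direction of $\gamma$ if it maps $\mathbb{D}$ onto a domain convex in the direction of $\gamma$. *)

theory Defs
  imports "HOL-Complex_Analysis.Complex_Analysis"
begin

abbreviation unit_disc :: "complex set" where
  "unit_disc \<equiv> ball 0 1"

text \<open>A harmonic function on the disc is represented by its analytic part \<open>h\<close> and its
  co-analytic part \<open>g\<close>.  On the disc, the normalization \<open>g 0 = 0\<close> makes the two parts unique.\<close>

definition harmonic_map :: "(complex \<Rightarrow> complex) \<Rightarrow> (complex \<Rightarrow> complex) \<Rightarrow> complex \<Rightarrow> complex" where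
  "harmonic_map h g z = h z + cnj (g z)"

definition normalized_harmonic :: "(complex \<Rightarrow> complex) \<Rightarrow> (complex \<Rightarrow> complex) \<Rightarrow> bool" where
  "normalized_harmonic h g \<longleftrightarrow>
     h holomorphic_on unit_disc \<and> g holomorphic_on unit_disc \<and>
     h 0 = 0 \<and> deriv h 0 = 1 \<and> g 0 = 0"

definition locally_univalent_on :: "complex set \<Rightarrow> (complex \<Rightarrow> complex) \<Rightarrow> bool" where
  "locally_univalent_on S f \<longleftrightarrow> (\<forall>z\<in>S. \<exists>U. open U \<and> z \<in> U \<and> inj_on f (U \<inter> S))"

text \<open>With \<open>f = u + \<i> v\<close> and \<open>L\<close> the real derivative of \<open>f\<close>, we have
  \<open>L 1 = u\<^sub>x + \<i> v\<^sub>x\<close> and \<open>L \<i> = u\<^sub>y + \<i> v\<^sub>y\<close>.\<close>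

definition jacobian :: "(complex \<Rightarrow> complex) \<Rightarrow> complex \<Rightarrow> real" where
  "jacobian f z =
     (let L = frechet_derivative f (at z) in Re (L 1) * Im (L \<i>) - Re (L \<i>) * Im (L 1))"

definition sense_preserving_on :: "complex set \<Rightarrow> (complex \<Rightarrow> complex) \<Rightarrow> bool" where
  "sense_preserving_on S f \<longleftrightarrow> (\<forall>z\<in>S. f differentiable (at z) \<and> jacobian f z > 0)"

definition convex_univalent :: "(complex \<Rightarrow> complex) set" where
  "convex_univalent = {\<psi>. \<psi> holomorphic_on unit_disc \<and> inj_on \<psi> unit_disc \<and>
     \<psi> 0 = 0 \<and> deriv \<psi> 0 = 1 \<and> convex (\<psi> ` unit_disc)}"

definition convolution :: "(complex \<Rightarrow> complex) \<Rightarrow> (complex \<Rightarrow> complex) \<Rightarrow> complex \<Rightarrow> complex"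
    (infixl "\<star>" 70) where
  "(\<phi>\<^sub>1 \<star> \<phi>\<^sub>2) z = (\<Sum>n. fps_nth (fps_expansion \<phi>\<^sub>1 0) n * fps_nth (fps_expansion \<phi>\<^sub>2 0) n * z ^ n)"

definition harmonic_convolution ::
  "(complex \<Rightarrow> complex) \<Rightarrow> (complex \<Rightarrow> complex) \<Rightarrow> (complex \<Rightarrow> complex) \<Rightarrow> (complex \<Rightarrow> complex) \<Rightarrow>
     complex \<Rightarrow> complex" where
  "harmonic_convolution h\<^sub>1 g\<^sub>1 h\<^sub>2 g\<^sub>2 = harmonic_map (h\<^sub>1 \<star> h\<^sub>2) (g\<^sub>1 \<star> g\<^sub>2)"

text \<open>The set \<open>{w + t * cis \<gamma> | t. True}\<close> is the line through \<open>w\<close> parallel to the line joining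
  the origin to \<open>cis \<gamma>\<close>, which is the point \<open>exp (\<i> * \<gamma>)\<close>.\<close>

definition convex_in_direction :: "real \<Rightarrow> complex set \<Rightarrow> bool" where
  "convex_in_direction \<gamma> S \<longleftrightarrow>
     (\<forall>w. connected (S \<inter> {w + of_real t * cis \<gamma> | t :: real. True}))"

definition map_convex_in_direction :: "real \<Rightarrow> (complex \<Rightarrow> complex) \<Rightarrow> bool" where
  "map_convex_in_direction \<gamma> f \<longleftrightarrow>
     open (f ` unit_disc) \<and> connected (f ` unit_disc) \<and> convex_in_direction \<gamma> (f ` unit_disc)"

lemma jacobian_harmonic_map:
  assumes "h field_differentiable (at z)" "g field_differentiable (at z)"
  shows "harmonic_map h g differentiable (at z)"
    and "jacobian (harmonic_map h g) z = (norm (deriv h z))\<^sup>2 - (norm (deriv g z))\<^sup>2"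
proof -
  have h: "(h has_derivative (\<lambda>w. deriv h z * w)) (at z)"
    and g: "(g has_derivative (\<lambda>w. deriv g z * w)) (at z)"
    using assms by (simp_all add: field_differentiable_derivI has_field_derivative_imp_has_derivative)
  have d: "(harmonic_map h g has_derivative (\<lambda>w. deriv h z * w + cnj (deriv g z * w))) (at z)"
    unfolding harmonic_map_def by (intro has_derivative_add h has_derivative_cnj g)
  then show "harmonic_map h g differentiable (at z)"
    by (rule differentiableI)
  show "jacobian (harmonic_map h g) z = (norm (deriv h z))\<^sup>2 - (norm (deriv g z))\<^sup>2"
    unfolding jacobian_def frechet_derivative_at[OF d, symmetric] Let_def
    unfolding cmod_power2 by (simp add: power2_eq_square algebra_simps)
qed

lemma sense_preserving_harmonic_map_iff:
  assumes "h holomorphic_on unit_disc" "g holomorphic_on unit_disc"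
  shows "sense_preserving_on unit_disc (harmonic_map h g) \<longleftrightarrow>
         (\<forall>z\<in>unit_disc. norm (deriv g z) < norm (deriv h z))"
proof -
  have fd: "h field_differentiable (at z)" "g field_differentiable (at z)" if "z \<in> unit_disc" for z
    using that assms[THEN holomorphic_on_imp_differentiable_at, OF open_ball] by auto
  have "(0 < (norm a)\<^sup>2 - (norm b)\<^sup>2) \<longleftrightarrow> norm b < norm a" for a b :: complex
    by (auto intro: power2_less_imp_less power_strict_mono)
  then show ?thesis
    unfolding sense_preserving_on_def
    using jacobian_harmonic_map[OF fd] by simp
qed

lemma locally_univalent_harmonic_map:
  assumes "h holomorphic_on unit_disc" "g holomorphic_on unit_disc"
    and less: "\<And>z. z \<in> unit_disc \<Longrightarrow> norm (deriv g z) < norm (deriv h z)"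
  shows "locally_univalent_on unit_disc (harmonic_map h g)"
  unfolding locally_univalent_on_def
proof
  fix z assume z: "z \<in> unit_disc"
  define a b e where "a = deriv h z" and "b = deriv g z" and "e = (norm a - norm b) / 3"
  have e: "e > 0" using less[OF z] by (simp add: a_def b_def e_def)
  have c: "isCont (deriv h) z" "isCont (deriv g) z"
    using holomorphic_on_imp_continuous_on[OF holomorphic_deriv[OF assms(1) open_ball]]
      holomorphic_on_imp_continuous_on[OF holomorphic_deriv[OF assms(2) open_ball]] z
    by (auto simp: continuous_on_eq_continuous_at)
  obtain r1 where r1: "r1 > 0" "\<And>w. dist w z < r1 \<Longrightarrow> dist (deriv h w) a < e"
    using c(1) e unfolding continuous_at_eps_delta a_def by blast
  obtain r2 where r2: "r2 > 0" "\<And>w. dist w z < r2 \<Longrightarrow> dist (deriv g w) b < e"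
    using c(2) e unfolding continuous_at_eps_delta b_def by blast
  obtain r3 where r3: "r3 > 0" "ball z r3 \<subseteq> unit_disc"
    using z open_ball open_contains_ball by blast
  define U where "U = ball z (min r1 (min r2 r3))"
  have Usub: "U \<subseteq> unit_disc" using r3 by (auto simp: U_def)
  have bound: "norm ((F v - c * v) - (F w - c * w)) \<le> e * norm (v - w)"
    if F: "F holomorphic_on unit_disc" and c: "\<And>x. x \<in> U \<Longrightarrow> dist (deriv F x) c < e"
      and vw: "v \<in> U" "w \<in> U" for F c v w
  proof (rule field_differentiable_bound[where S = U and f' = "\<lambda>x. deriv F x - c"])
    show "convex U" by (simp add: U_def)
    show "((\<lambda>x. F x - c * x) has_field_derivative deriv F x - c) (at x within U)" if "x \<in> U" for x
    proof -
      have "(F has_field_derivative deriv F x) (at x within U)"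
        using holomorphic_derivI[OF F open_ball] Usub that by blast
      from DERIV_diff[OF this DERIV_cmult[OF DERIV_ident, of c]] show ?thesis by simp
    qed
    show "norm (deriv F x - c) \<le> e" if "x \<in> U" for x
      using c[OF that] by (simp add: dist_norm)
  qed (use vw in auto)
  have "inj_on (harmonic_map h g) U"
  proof (rule inj_onI, rule ccontr)
    fix v w assume v: "v \<in> U" and w: "w \<in> U" and eq: "harmonic_map h g v = harmonic_map h g w"
      and ne: "v \<noteq> w"
    have H: "norm ((h v - a * v) - (h w - a * w)) \<le> e * norm (v - w)"
      using v w r1 by (intro bound assms) (auto simp: U_def dist_commute)
    have G: "norm ((g v - b * v) - (g w - b * w)) \<le> e * norm (v - w)"
      using v w r2 by (intro bound assms) (auto simp: U_def dist_commute)
    have hg: "norm (h v - h w) = norm (g v - g w)"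
    proof -
      have "h v - h w = - cnj (g v - g w)"
        using eq by (simp add: harmonic_map_def algebra_simps)
      then show ?thesis by (simp only: norm_minus_cancel complex_mod_cnj)
    qed
    have "norm a * norm (v - w) = norm ((h v - h w) - ((h v - a * v) - (h w - a * w)))"
      by (simp add: norm_mult [symmetric] algebra_simps)
    also have "\<dots> \<le> norm (h v - h w) + e * norm (v - w)"
      by (rule order_trans[OF norm_triangle_ineq4 add_left_mono[OF H]])
    also have "norm (h v - h w) = norm (b * (v - w) + ((g v - b * v) - (g w - b * w)))"
      unfolding hg by (simp add: algebra_simps)
    also have "\<dots> \<le> norm b * norm (v - w) + e * norm (v - w)"
      unfolding norm_mult[symmetric, of b] by (rule order_trans[OF norm_triangle_ineq add_left_mono[OF G]])
    finally have "(norm a - norm b - 2 * e) * norm (v - w) \<le> 0"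
      by (simp add: algebra_simps)
    moreover have "norm a - norm b - 2 * e = e" by (simp add: e_def field_simps)
    ultimately show False
      using e ne by (simp add: mult_le_0_iff)
  qed
  then show "\<exists>U. open U \<and> z \<in> U \<and> inj_on (harmonic_map h g) (U \<inter> unit_disc)"
    using r1(1) r2(1) r3(1) by (intro exI[of _ U]) (auto simp: U_def inj_on_def)
qed

lemma locally_univalent_sense_preserving_iff:
  assumes "h holomorphic_on unit_disc" "g holomorphic_on unit_disc"
  shows "locally_univalent_on unit_disc (harmonic_map h g) \<and>
           sense_preserving_on unit_disc (harmonic_map h g) \<longleftrightarrow>
         (\<forall>z\<in>unit_disc. norm (deriv g z) < norm (deriv h z))"
  using sense_preserving_harmonic_map_iff[OF assms] locally_univalent_harmonic_map[OF assms] by blast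

end

theory Submission
  imports Defs
begin

text \<open>
  Write \<open>e\<^sub>j = cis (- 2 * \<mu>\<^sub>j)\<close>, \<open>\<phi>\<^sub>j = h\<^sub>j + e\<^sub>j g\<^sub>j\<close> and \<open>k\<^sub>j = h\<^sub>j - e\<^sub>j g\<^sub>j\<close>, and let \<open>H\<close>, \<open>G\<close>
  be the two parts of the convolution.  The mixed terms cancel in
  \<open>k\<^sub>1 \<star> \<phi>\<^sub>2 + k\<^sub>2 \<star> \<phi>\<^sub>1 = 2 (H - e\<^sub>1 e\<^sub>2 G)\<close>, and \<open>f\<^sub>j\<close> preserves the sense exactly when
  \<open>k\<^sub>j' / \<phi>\<^sub>j'\<close> has positive real part.  Two theorems then give the result.

  The first is the theorem of Ruscheweyh and Sheil-Small that convolution with a convex function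
  \<open>\<phi>\<close> preserves such positivity: for convex \<open>\<phi>\<^sub>1\<close>, with \<open>\<psi> z = z \<phi>\<^sub>1' z\<close>, the quotient
  \<open>(\<phi> \<star> (\<psi> p)) / (\<phi> \<star> \<psi>)\<close> has positive real part if \<open>p\<close> has
  (\<open>convolution_positivity\<close>).  By the Schwarz integral formula \<open>p\<close> is, up to an imaginary
  constant, an average of the kernels \<open>(t + z) / (t - z)\<close> with \<open>|t| = 1\<close>, so it is enough that the
  quotient formed with one such kernel is never imaginary.  If it were equal to \<open>\<i> \<alpha>\<close>, then
  \<open>\<phi>(\<zeta>/z) - \<phi>(\<zeta>/t)\<close>, multiplied by \<open>(t + z) / (t - z) - \<i> \<alpha>\<close>, which is imaginary on the unit circle,
  would be orthogonal there to \<open>\<psi>\<close> and to its conjugate, hence to every \<open>Re (m \<psi>)\<close>.  But for a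
  suitable \<open>m\<close> the function \<open>Re (m \<psi>)\<close> is the derivative of a linear functional along the convex
  curve \<open>\<phi>\<^sub>1\<close> whose maximum lies at the zero \<open>s\<close> of \<open>(t + z) / (t - z) - \<i> \<alpha>\<close>.  It changes sign at
  \<open>s\<close> and at the minimum \<open>z1\<close> only; the kernel changes sign at \<open>t\<close> and \<open>s\<close> only; and the side of
  \<open>\<phi>(\<zeta>/z)\<close> relative to the chord of the convex curve through \<open>\<phi>(\<zeta>/t)\<close> and \<open>\<phi>(\<zeta>/z1)\<close>
  (the tangent, if \<open>z1 = t\<close>) changes at \<open>t\<close>
  and \<open>z1\<close> only.  The product of the three has one sign, so its integral cannot vanish
  (\<open>kernel_pairing_not_imaginary\<close>).  Behind all this is the fact that convex functions map circles
  about the origin to strictly convex curves and preserve the orientation; it follows from the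
  Schwarz lemma.

  The second is the shear construction of Clunie and Sheil-Small together with the criterion of
  Royster and Ziegler (\<open>shear_criterion\<close>).  The primitive of
  \<open>1 / (1 - 2 z cos \<nu> + z\<^sup>2)\<close> maps the disc onto a vertical strip or half-plane; on that domain, after
  a rotation, the hypothesis says that \<open>V = h - g\<close> satisfies \<open>Re V' > 0\<close>.  Then \<open>Im V\<close>, which is
  the imaginary part of the harmonic map, increases along vertical lines, and its level sets are
  graphs over sets of abscissae.  These sets are intervals: far up or down a vertical line on which
  \<open>Im V\<close> stays bounded, \<open>Re V'\<close> tends to zero along a sequence, and by the Schwarz-Pick lemma \<open>Im V\<close>
  is then almost affine in the horizontal direction (\<open>level_between_one_side\<close>).  So every level set
  is a connected curve, its image is connected and lies on a horizontal line, and local univalence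
  makes the map injective on it.
\<close>

section \<open>Circles under convex univalent functions\<close>

text \<open>Twice the signed area of the triangle \<open>a b c\<close>: positive when \<open>a\<close>, \<open>b\<close>, \<open>c\<close> are in
  counterclockwise order.\<close>
definition orientation :: "complex \<Rightarrow> complex \<Rightarrow> complex \<Rightarrow> real" where
  "orientation a b c = Im (cnj (b - a) * (c - a))"

lemma convex_univalentD:
  assumes "\<phi> \<in> convex_univalent"
  shows "\<phi> holomorphic_on unit_disc" "inj_on \<phi> unit_disc" "\<phi> 0 = 0" "deriv \<phi> 0 = 1"
    "convex (\<phi> ` unit_disc)" "continuous_on unit_disc \<phi>"
  using assms holomorphic_on_imp_continuous_on unfolding convex_univalent_def by auto

lemma convex_univalent_deriv_nonzero:
  assumes "\<phi> \<in> convex_univalent" "z \<in> unit_disc"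
  shows "deriv \<phi> z \<noteq> 0"
  using holomorphic_injective_imp_regular[OF convex_univalentD(1) open_ball convex_univalentD(2)] assms
  by blast

lemma norm_convex_combination_less:
  fixes a b :: complex
  assumes "a \<noteq> b" "norm a = norm b" "0 < t" "t < 1"
  shows "norm ((1 - of_real t) * a + of_real t * b) < norm a"
proof -
  have "(norm ((1 - of_real t) * a + of_real t * b))\<^sup>2 =
      (1 - t) * (norm a)\<^sup>2 + t * (norm b)\<^sup>2 - t * (1 - t) * (norm (a - b))\<^sup>2"
    unfolding cmod_power2 by (simp add: power2_eq_square algebra_simps)
  also have "\<dots> = (norm a)\<^sup>2 - t * (1 - t) * (norm (a - b))\<^sup>2"
    using assms by (simp add: algebra_simps)
  also have "\<dots> < (norm a)\<^sup>2"
    using assms by simp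
  finally show ?thesis by (rule power2_less_imp_less) simp
qed

text \<open>The map \<open>G\<close> with \<open>\<phi> (G z) = (1 - t) \<phi> (z a') + t \<phi> (z b')\<close> is well defined because the
  range is convex, fixes \<open>0\<close>, and has \<open>|G' 0| < 1\<close> because \<open>a' \<noteq> b'\<close>.  So it is not a rotation, and
  the Schwarz lemma is strict.  This is the only place where convexity of the range enters: it makes
  \<open>\<phi>\<close> map circles to strictly convex curves.\<close>
lemma convex_univalent_strict_chord:
  assumes \<phi>: "\<phi> \<in> convex_univalent" and ab: "a \<noteq> b" "norm a = norm b" "norm a < 1"
    and t: "0 < t" "t < 1"
  obtains c where "norm c < norm a" "(1 - of_real t) * \<phi> a + of_real t * \<phi> b = \<phi> c"
proof -
  note K = convex_univalentD[OF \<phi>]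
  define r where "r = norm a"
  have r: "0 < r" "r < 1" using ab by (auto simp: r_def)
  obtain g where g: "g holomorphic_on (\<phi> ` unit_disc)" "\<And>z. z \<in> unit_disc \<Longrightarrow> g (\<phi> z) = z"
    using holomorphic_has_inverse[OF K(1) open_ball K(2)] by metis
  define a' b' where "a' = a / of_real r" and "b' = b / of_real r"
  have n1: "norm a' = 1" "norm b' = 1" "a' \<noteq> b'"
    using r ab by (auto simp: a'_def b'_def r_def norm_divide)
  define F where "F z = (1 - of_real t) * \<phi> (z * a') + of_real t * \<phi> (z * b')" for z
  have inD: "z * a' \<in> unit_disc" "z * b' \<in> unit_disc" if "z \<in> unit_disc" for z
    using that n1 by (auto simp: norm_mult)
  have Fin: "F z \<in> \<phi> ` unit_disc" if "z \<in> unit_disc" for z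
  proof -
    have "(1 - t) *\<^sub>R \<phi> (z * a') + t *\<^sub>R \<phi> (z * b') \<in> \<phi> ` unit_disc"
      by (rule convexD[OF K(5)]) (use inD[OF that] t in auto)
    then show ?thesis by (simp add: F_def scaleR_conv_of_real)
  qed
  have Fder: "(F has_field_derivative
      ((1 - of_real t) * (deriv \<phi> (z * a') * a') + of_real t * (deriv \<phi> (z * b') * b'))) (at z)"
    if "z \<in> unit_disc" for z
  proof -
    have d: "((\<lambda>z. \<phi> (z * c)) has_field_derivative (deriv \<phi> (z * c) * c)) (at z)"
      if "z * c \<in> unit_disc" for c
      by (rule DERIV_chain2[where g="\<lambda>z. z * c", OF holomorphic_derivI[OF K(1) open_ball that]])
        (auto intro!: derivative_eq_intros)
    show ?thesis unfolding F_def
      by (intro DERIV_add DERIV_cmult d inD[OF that])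
  qed
  have Fhol: "F holomorphic_on unit_disc"
    by (meson Fder holomorphic_on_open open_ball)
  define G where "G = g \<circ> F"
  have Ghol: "G holomorphic_on unit_disc"
    unfolding G_def by (rule holomorphic_on_compose_gen[OF Fhol g(1)]) (use Fin in auto)
  have GF: "\<phi> (G z) = F z" "G z \<in> unit_disc" if "z \<in> unit_disc" for z
    using Fin[OF that] g(2) by (auto simp: G_def)
  have G0: "G 0 = 0"
    using g(2)[of 0] K(3) by (simp add: G_def F_def)
  have G1: "norm (G z) < 1" if "norm z < 1" for z
    using GF(2)[of z] that by simp
  have dG: "deriv G 0 = (1 - of_real t) * a' + of_real t * b'"
  proof -
    have "(G has_field_derivative deriv G 0) (at 0)"
      using holomorphic_derivI[OF Ghol open_ball] by simp
    then have "((\<lambda>z. \<phi> (G z)) has_field_derivative deriv \<phi> (G 0) * deriv G 0) (at 0)"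
      by (rule DERIV_chain2[rotated])
        (use holomorphic_derivI[OF K(1) open_ball, of 0] G0 in simp)
    moreover have "((\<lambda>z. \<phi> (G z)) has_field_derivative
        ((1 - of_real t) * (deriv \<phi> 0 * a') + of_real t * (deriv \<phi> 0 * b'))) (at 0)"
      by (rule has_field_derivative_transform_within_open[OF _ open_ball[of 0 1]])
        (use Fder[of 0] GF(1) in auto)
    ultimately show ?thesis
      using DERIV_unique G0 K(4) by fastforce
  qed
  have lt: "norm (deriv G 0) < 1"
    unfolding dG using norm_convex_combination_less[OF n1(3) _ t] n1 by simp
  have r1: "norm (of_real r :: complex) < 1" using r by simp
  have "norm (G (of_real r)) \<noteq> norm (of_real r :: complex)"
  proof
    assume eq: "norm (G (of_real r)) = norm (of_real r :: complex)"
    obtain \<alpha> where \<alpha>: "\<And>z. norm z < 1 \<Longrightarrow> G z = \<alpha> * z" "norm \<alpha> = 1"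
      using Schwarz_Lemma(3)[OF Ghol G0 G1 r1] eq r r1
      by (metis less_irrefl norm_eq_zero norm_of_real abs_of_pos)
    have "(G has_field_derivative \<alpha>) (at 0)"
      by (rule has_field_derivative_transform_within_open[where S="unit_disc" and f="\<lambda>z. \<alpha> * z"])
        (auto simp: \<alpha>(1) intro!: derivative_eq_intros)
    then have "deriv G 0 = \<alpha>" by (rule DERIV_imp_deriv)
    with \<alpha>(2) lt show False by simp
  qed
  moreover have "norm (G (of_real r)) \<le> norm (of_real r :: complex)"
    by (rule Schwarz_Lemma(1)[OF Ghol G0 G1 r1])
  ultimately have "norm (G (of_real r)) < r" using r by simp
  moreover have "\<phi> (G (of_real r)) = (1 - of_real t) * \<phi> a + of_real t * \<phi> b"
    using GF(1)[of "of_real r"] r by (simp add: F_def a'_def b'_def)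
  ultimately show thesis using that[of "G (of_real r)"] r_def by metis
qed

lemma orientation_zero_collinear:
  assumes "orientation p q s = 0" "p \<noteq> q"
  obtains x :: real where "s = (1 - of_real x) * p + of_real x * q"
proof -
  define x where "x = Re (cnj (q - p) * (s - p)) / (norm (q - p))\<^sup>2"
  have nz: "cnj (q - p) \<noteq> 0" "(norm (q - p))\<^sup>2 \<noteq> 0" using assms(2) by auto
  have "cnj (q - p) * (s - p) = of_real (x * (norm (q - p))\<^sup>2)"
    using assms(1) nz(2) by (simp add: x_def orientation_def complex_eq_iff)
  also have "\<dots> = of_real x * (cnj (q - p) * (q - p))"
    by (simp only: of_real_mult complex_norm_square) (simp add: mult.commute)
  finally have "cnj (q - p) * (s - p) = cnj (q - p) * (of_real x * (q - p))"
    by (simp add: mult_ac)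
  then have "s - p = of_real x * (q - p)" using nz(1) mult_left_cancel by blast
  then show thesis by (intro that[of x]) (simp add: algebra_simps)
qed

text \<open>Of three collinear points one lies between the other two, and it would be the image of a point
  inside the circle by \<open>convex_univalent_strict_chord\<close>.\<close>
lemma convex_univalent_not_collinear:
  assumes \<phi>: "\<phi> \<in> convex_univalent" and abc: "a \<noteq> b" "b \<noteq> c" "a \<noteq> c"
    and n: "norm a = r" "norm b = r" "norm c = r" "r < 1"
  shows "orientation (\<phi> a) (\<phi> b) (\<phi> c) \<noteq> 0"
proof
  assume 0: "orientation (\<phi> a) (\<phi> b) (\<phi> c) = 0"
  note K = convex_univalentD[OF \<phi>]
  have ne: "\<phi> u \<noteq> \<phi> v" if "u \<noteq> v" "norm u < 1" "norm v < 1" for u v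
    using K(2) that by (auto simp: inj_on_def)
  have between: False
    if uvw: "u \<noteq> v" "norm u = r" "norm v = r" "norm w = r"
      and t: "0 < t" "t < 1" "\<phi> w = (1 - of_real t) * \<phi> u + of_real t * \<phi> v" for u v w t
  proof -
    obtain d where d: "norm d < norm u" "(1 - of_real t) * \<phi> u + of_real t * \<phi> v = \<phi> d"
      using convex_univalent_strict_chord[OF \<phi> uvw(1) _ _ t(1,2)] uvw n by metis
    then have "\<phi> w = \<phi> d" "w \<noteq> d" "norm d < 1" "norm w < 1" using uvw n t(3) by auto
    then show False using ne by blast
  qed
  obtain x where x: "\<phi> c = (1 - of_real x) * \<phi> a + of_real x * \<phi> b"
    using orientation_zero_collinear[OF 0 ne] abc n by metis
  have "x \<noteq> 0" "x \<noteq> 1" using x ne[of c a] ne[of c b] abc n by auto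
  then consider "0 < x" "x < 1" | "x < 0" | "x > 1" by linarith
  then show False
  proof cases
    case 1
    then show False using between[OF abc(1) n(1-3)] x by blast
  next
    case 2
    \<comment> \<open>\<open>\<phi> a\<close> lies between \<open>\<phi> c\<close> and \<open>\<phi> b\<close>\<close>
    define y where "y = - x / (1 - x)"
    have y: "0 < y" "y < 1" using 2 by (auto simp: y_def field_simps)
    have "1 - y = 1 / (1 - x)" using 2 by (simp add: y_def field_simps)
    moreover have "complex_of_real (1 - x) \<noteq> 0" using 2 by (simp del: of_real_diff)
    ultimately have "(1 - of_real y) * \<phi> c + of_real y * \<phi> b = \<phi> a"
      unfolding x of_real_1[symmetric, where ?'a=complex] of_real_diff[symmetric]
      by (simp add: y_def field_simps del: of_real_diff)
    then show False using between[of c b a y] y abc n by metis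
  next
    case 3
    define y where "y = 1 / x"
    have y: "0 < y" "y < 1" using 3 by (auto simp: y_def field_simps)
    have "(1 - of_real y) * \<phi> a + of_real y * \<phi> c = \<phi> b"
      using 3 unfolding x y_def by (simp add: field_simps)
    then show False using between[of a c b y] y abc n by metis
  qed
qed

text \<open>The orientation of the image triangle never vanishes while the circle shrinks, so its sign is
  that of the limit.  Dividing by the squared radius makes the limit the orientation of \<open>a b c\<close>
  itself, because \<open>\<phi>' 0 = 1\<close>.\<close>
lemma convex_univalent_orientation_preserving:
  fixes a b c :: complex
  assumes \<phi>: "\<phi> \<in> convex_univalent" and abc: "a \<noteq> b" "b \<noteq> c" "a \<noteq> c"
    and n: "norm a = 1" "norm b = 1" "norm c = 1" and r: "0 < r" "r < (1 :: real)"
  shows "orientation (\<phi> (r * a)) (\<phi> (r * b)) (\<phi> (r * c)) * orientation a b c > 0"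
proof -
  note K = convex_univalentD[OF \<phi>]
  obtain q where q: "q holomorphic_on ball 0 1" "\<And>z. norm z < 1 \<Longrightarrow> \<phi> z = z * q z" "deriv \<phi> 0 = q 0"
    using Schwarz3[OF K(1,3)] by metis
  define G where "G s = orientation (a * q (of_real s * a)) (b * q (of_real s * b)) (c * q (of_real s * c))"
    for s :: real
  have eq: "orientation (\<phi> (s * a)) (\<phi> (s * b)) (\<phi> (s * c)) = s\<^sup>2 * G s" if "0 \<le> s" "s < 1" for s
    using that n by (simp add: q(2) norm_mult G_def orientation_def power2_eq_square algebra_simps)
  have cq: "continuous_on {0..r} (\<lambda>s. q (of_real s * d))" if "norm d = 1" for d
    by (rule continuous_on_compose2[OF holomorphic_on_imp_continuous_on[OF q(1)]])
      (use that r in \<open>auto intro!: continuous_intros simp: norm_mult\<close>)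
  have cG: "continuous_on {0..r} G"
    unfolding G_def orientation_def by (intro continuous_intros cq n)
  have ne: "a \<noteq> 0" "b \<noteq> 0" "c \<noteq> 0" using n by auto
  have Gnz: "G s \<noteq> 0" if "s \<in> {0<..r}" for s
  proof -
    have "orientation (\<phi> (s * a)) (\<phi> (s * b)) (\<phi> (s * c)) \<noteq> 0"
      using that r abc n by (intro convex_univalent_not_collinear[OF \<phi>, where r=s]) (auto simp: norm_mult)
    then show ?thesis using eq[of s] that r by auto
  qed
  have G0: "G 0 = orientation a b c" using q(3) K(4) by (simp add: G_def)
  have or: "orientation a b c \<noteq> 0"
  proof
    assume "orientation a b c = 0"
    then obtain x where x: "c = (1 - of_real x) * a + of_real x * b"
      using orientation_zero_collinear abc(1) by blast
    have "(norm c)\<^sup>2 = (1 - x) * (norm a)\<^sup>2 + x * (norm b)\<^sup>2 - x * (1 - x) * (norm (a - b))\<^sup>2"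
      unfolding x cmod_power2 by (simp add: power2_eq_square algebra_simps)
    then have "x = 0 \<or> x = 1" using n abc(1) by simp
    then show False using x abc by auto
  qed
  have nz: "G s \<noteq> 0" if "s \<in> {0..r}" for s
    using Gnz[of s] G0 or that by (cases "s = 0") auto
  have "G r * G 0 > 0"
  proof (rule ccontr)
    assume "\<not> G r * G 0 > 0"
    then have "G r \<le> 0 \<and> 0 \<le> G 0 \<or> G 0 \<le> 0 \<and> 0 \<le> G r"
      by (smt (verit) mult_pos_pos mult_neg_neg)
    then have "\<exists>s\<ge>0. s \<le> r \<and> G s = 0"
      using IVT'[of G 0 0 r] IVT2'[of G r 0 0] cG r by auto
    then show False using nz by auto
  qed
  then show ?thesis using eq[of r] r G0 by (auto simp: zero_less_mult_iff mult_less_0_iff)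
qed

text \<open>The preimage of the segment from \<open>\<phi> b\<close> to \<open>\<phi> a\<close> starts at \<open>b\<close> and stays in the disc of
  radius \<open>|b|\<close>, so its initial velocity \<open>(\<phi> a - \<phi> b) / \<phi>' b\<close> does not point outwards.  The inequality
  says that the image of the circle lies on one side of its tangent at \<open>\<phi> b\<close>.\<close>
lemma convex_univalent_supporting_line:
  assumes \<phi>: "\<phi> \<in> convex_univalent" and ab: "norm a = norm b" "norm a < 1"
  shows "Re (cnj (b * deriv \<phi> b) * (\<phi> a - \<phi> b)) \<le> 0"
proof (cases "a = b")
  case False
  note K = convex_univalentD[OF \<phi>]
  obtain g where g: "g holomorphic_on (\<phi> ` unit_disc)" "\<And>z. z \<in> unit_disc \<Longrightarrow> g (\<phi> z) = z"
      "\<And>z. z \<in> unit_disc \<Longrightarrow> deriv \<phi> z * deriv g (\<phi> z) = 1"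
    using holomorphic_has_inverse[OF K(1) open_ball K(2)] by metis
  have op: "open (\<phi> ` unit_disc)" by (rule open_mapping_thm3[OF K(1) open_ball K(2)])
  have b: "b \<in> unit_disc" using ab by simp
  define w where "w t = \<phi> b + of_real t * (\<phi> a - \<phi> b)" for t :: real
  have "(g has_field_derivative deriv g (\<phi> b)) (at (w 0))"
    using holomorphic_derivI[OF g(1) op] b by (simp add: w_def)
  moreover have "(w has_vector_derivative (\<phi> a - \<phi> b)) (at 0)"
    unfolding w_def by (auto intro!: derivative_eq_intros)
  ultimately have "(g \<circ> w has_vector_derivative (\<phi> a - \<phi> b) * deriv g (\<phi> b)) (at 0)"
    using field_vector_diff_chain_at[of w "\<phi> a - \<phi> b" 0 g "deriv g (\<phi> b)"] by simp
  then have "((\<lambda>t. cnj b * (g \<circ> w) t) has_vector_derivative cnj b * ((\<phi> a - \<phi> b) * deriv g (\<phi> b))) (at 0)"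
    by (rule has_vector_derivative_mult_right)
  from has_field_derivative_Re[OF this]
  have der: "((\<lambda>t. Re (cnj b * g (w t))) has_real_derivative
      Re (cnj b * ((\<phi> a - \<phi> b) * deriv g (\<phi> b)))) (at 0)"
    by (simp add: o_def)
  have le: "Re (cnj b * g (w t)) \<le> Re (cnj b * g (w 0))" if t: "0 < t" "t < 1" for t
  proof -
    obtain c where c: "norm c < norm b" "(1 - of_real t) * \<phi> b + of_real t * \<phi> a = \<phi> c"
      using convex_univalent_strict_chord[OF \<phi> False[symmetric] _ _ t] ab by metis
    have "w t = \<phi> c" using c(2) by (simp add: w_def algebra_simps)
    then have "g (w t) = c" using g(2)[of c] c(1) ab by simp
    have "Re (cnj b * c) \<le> norm b * norm c"
      using complex_Re_le_cmod[of "cnj b * c"] by (simp add: norm_mult)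
    also have "\<dots> \<le> norm b * norm b" using c(1) by (intro mult_left_mono) auto
    also have "\<dots> = Re (cnj b * b)"
      by (metis Re_complex_of_real complex_norm_square mult.commute power2_eq_square)
    finally show ?thesis using \<open>g (w t) = c\<close> g(2)[OF b] by (simp add: w_def)
  qed
  have "Re (cnj b * ((\<phi> a - \<phi> b) * deriv g (\<phi> b))) \<le> 0"
  proof (rule ccontr)
    assume "\<not> ?thesis"
    then obtain d where d: "d > 0" "\<And>h. 0 < h \<Longrightarrow> h < d \<Longrightarrow> Re (cnj b * g (w 0)) < Re (cnj b * g (w (0 + h)))"
      using DERIV_pos_inc_right[OF der] by auto
    define h where "h = min (d / 2) (1 / 2)"
    have "0 < h" "h < d" "h < 1" using d(1) by (auto simp: h_def)
    then show False using d(2)[of h] le[of h] by simp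
  qed
  moreover have "cnj (b * deriv \<phi> b) * (\<phi> a - \<phi> b) =
      of_real ((norm (deriv \<phi> b))\<^sup>2) * (cnj b * ((\<phi> a - \<phi> b) * deriv g (\<phi> b)))"
  proof -
    have "of_real ((norm (deriv \<phi> b))\<^sup>2) * deriv g (\<phi> b) = cnj (deriv \<phi> b) * (deriv \<phi> b * deriv g (\<phi> b))"
      by (simp only: complex_norm_square mult_ac)
    then have "cnj (deriv \<phi> b) = of_real ((norm (deriv \<phi> b))\<^sup>2) * deriv g (\<phi> b)"
      using g(3)[OF b] by simp
    then show ?thesis by (simp add: mult_ac)
  qed
  moreover have "Re (of_real x * X) = x * Re X" for x X by simp
  ultimately show ?thesis by (metis mult_nonneg_nonpos zero_le_power2)
qed auto

text \<open>A linear functional is monotone along a convex curve between its minimum and its maximum.  With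
  the tangent \<open>T\<close> at \<open>z\<close> and the chords \<open>P\<close>, \<open>Q\<close> from there to the images of \<open>z1\<close> and \<open>z2\<close>, the linear
  dependence \<open>(P \<times> Q) T + (Q \<times> T) P + (T \<times> P) Q = 0\<close> of three plane vectors determines the sign
  of the functional at \<open>T\<close>, since the signs of the other two terms are known.\<close>
lemma convex_univalent_monotone_arc:
  assumes \<phi>: "\<phi> \<in> convex_univalent" and ne: "z1 \<noteq> z" "z \<noteq> z2" "z1 \<noteq> z2"
    and n: "norm z1 = 1" "norm z2 = 1" "norm z = 1" and r: "0 < r" "r < (1 :: real)"
    and le: "Re (m * \<phi> (r * z1)) \<le> Re (m * \<phi> (r * z))" "Re (m * \<phi> (r * z)) \<le> Re (m * \<phi> (r * z2))"
  shows "orientation z1 z z2 * Re (m * (\<i> * (r * z * deriv \<phi> (r * z)))) \<ge> 0"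
proof -
  define T P Q where "T = \<i> * (r * z * deriv \<phi> (r * z))"
    and "P = \<phi> (r * z1) - \<phi> (r * z)" and "Q = \<phi> (r * z2) - \<phi> (r * z)"
  have TP: "Im (cnj T * P) \<ge> 0" "Im (cnj T * Q) \<ge> 0"
  proof -
    have rot: "Im (cnj (\<i> * E) * X) = - Re (cnj E * X)" for E X by simp
    show "Im (cnj T * P) \<ge> 0" "Im (cnj T * Q) \<ge> 0"
      unfolding T_def P_def Q_def rot
      using convex_univalent_supporting_line[OF \<phi>, of "r * z1" "r * z"]
        convex_univalent_supporting_line[OF \<phi>, of "r * z2" "r * z"] n r
      by (simp_all add: norm_mult del: complex_cnj_mult complex_cnj_diff times_complex.sel)
  qed
  have PQ: "Im (cnj P * Q) * orientation z z1 z2 > 0"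
    using convex_univalent_orientation_preserving[OF \<phi>, of z z1 z2 r] ne n r
    by (auto simp: P_def Q_def orientation_def)
  have or: "orientation z z1 z2 = - orientation z1 z z2"
    by (simp add: orientation_def algebra_simps)
  have "Im (cnj P * Q) * Re (m * T) - Im (cnj T * Q) * Re (m * P) + Im (cnj T * P) * Re (m * Q) = 0"
    by (simp add: algebra_simps)
  moreover have "Re (m * P) \<le> 0" "Re (m * Q) \<ge> 0"
    using le by (simp_all add: P_def Q_def right_diff_distrib del: times_complex.sel)
  then have "Im (cnj T * Q) * Re (m * P) \<le> 0" "Im (cnj T * P) * Re (m * Q) \<ge> 0"
    using TP mult_nonneg_nonpos mult_nonneg_nonneg by blast+
  ultimately have "Im (cnj P * Q) * Re (m * T) \<le> 0" by linarith
  moreover have "x * u > 0 \<Longrightarrow> x * v \<le> 0 \<Longrightarrow> - u * v \<ge> 0" for x u v :: real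
    by (auto simp: mult_le_0_iff zero_less_mult_iff)
  ultimately have "orientation z1 z z2 * Re (m * T) \<ge> 0"
    using PQ or by (metis minus_minus)
  then show ?thesis by (simp add: T_def)
qed

lemma cnj_on_circle:
  assumes "norm z = 1"
  shows "cnj z = 1 / z"
proof -
  have "z \<noteq> 0" using assms by auto
  then show ?thesis using assms by (auto simp: field_simps complex_norm_square[symmetric])
qed

lemma orientation_on_circle:
  fixes a b c :: complex
  assumes "norm a = 1" "norm b = 1" "norm c = 1"
  shows "of_real (orientation a b c) = (\<i> / 2) * ((a - b) * (b - c) * (c - a)) / (a * b * c)"
proof -
  have nz: "a \<noteq> 0" "b \<noteq> 0" "c \<noteq> 0" using assms by auto
  have cn: "cnj a = 1 / a" "cnj b = 1 / b" "cnj c = 1 / c"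
    using assms cnj_on_circle by auto
  have "complex_of_real (Im X) = (X - cnj X) / (2 * \<i>)" for X
    by (simp add: complex_eq_iff)
  then have "of_real (orientation a b c) = (cnj (b - a) * (c - a) - cnj (cnj (b - a) * (c - a))) / (2 * \<i>)"
    unfolding orientation_def .
  also have "\<dots> = (\<i> / 2) * ((a - b) * (b - c) * (c - a)) / (a * b * c)"
    using nz by (simp add: cn field_simps)
  finally show ?thesis .
qed

lemma diff_square_on_circle:
  fixes a b :: complex
  assumes "norm a = 1" "norm b = 1"
  shows "(a - b)\<^sup>2 = - of_real ((norm (a - b))\<^sup>2) * (a * b)"
proof -
  have nz: "a \<noteq> 0" "b \<noteq> 0" using assms by auto
  have cn: "cnj a = 1 / a" "cnj b = 1 / b"
    using assms cnj_on_circle by auto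
  have "of_real ((norm (a - b))\<^sup>2) = (a - b) * cnj (a - b)" by (rule complex_norm_square)
  then show ?thesis using nz by (simp add: cn field_simps power2_eq_square)
qed

text \<open>A point of the circle other than the vertices of an inscribed triangle is separated from the
  triangle by exactly one edge.  The identity in the proof avoids the distinction of cases: every
  squared difference on the circle is a negative multiple of the product of its two points.\<close>
lemma orientation_product_on_circle:
  fixes a b c z :: complex
  assumes n: "norm a = 1" "norm b = 1" "norm c = 1" "norm z = 1"
    and ne: "a \<noteq> b" "b \<noteq> c" "a \<noteq> c" "z \<noteq> a" "z \<noteq> b" "z \<noteq> c"
  shows "orientation a b z * orientation b c z * orientation c a z * orientation a b c < 0"
proof -
  let ?N = "\<lambda>x y. (norm (x - y :: complex))\<^sup>2"
  have nz: "a \<noteq> 0" "b \<noteq> 0" "c \<noteq> 0" "z \<noteq> 0" using n by auto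
  have expand: "x * (u * - v2 * v1) * (x * (v * - v3 * v2)) * (x * (w * - v1 * v3)) * (x * (u * v * w)) =
      - (x ^ 4) * (u\<^sup>2 * v\<^sup>2 * w\<^sup>2 * v1\<^sup>2 * v2\<^sup>2 * v3\<^sup>2)" for x u v w v1 v2 v3 :: complex
    by (simp add: power2_eq_square power4_eq_xxxx)
  have "complex_of_real (orientation a b z * orientation b c z * orientation c a z * orientation a b c) =
      ((\<i> / 2) * ((a - b) * - (z - b) * (z - a))) * ((\<i> / 2) * ((b - c) * - (z - c) * (z - b))) *
      ((\<i> / 2) * ((c - a) * - (z - a) * (z - c))) * ((\<i> / 2) * ((a - b) * (b - c) * (c - a))) /
      ((a * b * z) * (b * c * z) * (c * a * z) * (a * b * c))"
    unfolding of_real_mult using n by (simp add: orientation_on_circle)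
  also have "\<dots> = - ((a - b)\<^sup>2 * (b - c)\<^sup>2 * (c - a)\<^sup>2 * (z - a)\<^sup>2 * (z - b)\<^sup>2 * (z - c)\<^sup>2) / (16 * (a * b * c * z)^3)"
    unfolding expand by (simp add: power_mult_distrib power4_eq_xxxx power3_eq_cube mult_ac)
  also have "\<dots> = of_real (- (?N a b * ?N b c * ?N c a * ?N z a * ?N z b * ?N z c) / 16)"
    unfolding diff_square_on_circle[OF n(1,2)] diff_square_on_circle[OF n(2,3)] diff_square_on_circle[OF n(3,1)]
      diff_square_on_circle[OF n(4,1)] diff_square_on_circle[OF n(4,2)] diff_square_on_circle[OF n(4,3)]
    using nz by (simp add: field_simps power3_eq_cube)
  finally have "orientation a b z * orientation b c z * orientation c a z * orientation a b c =
      - (?N a b * ?N b c * ?N c a * ?N z a * ?N z b * ?N z c) / 16"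
    using of_real_eq_iff by blast
  moreover have "?N a b * ?N b c * ?N c a * ?N z a * ?N z b * ?N z c > 0"
    using ne by simp
  ultimately show ?thesis by linarith
qed

section \<open>Means over the unit circle\<close>

definition circle_mean :: "(complex \<Rightarrow> complex) \<Rightarrow> complex" where
  "circle_mean f = integral {0..2 * pi} (\<lambda>\<theta>. f (cis \<theta>)) / of_real (2 * pi)"

lemma continuous_on_circle_param:
  assumes "continuous_on (sphere 0 1) f"
  shows "continuous_on S (\<lambda>\<theta>. f (cis \<theta>))"
  by (rule continuous_on_compose2[OF assms]) (auto intro!: continuous_intros)

lemma circle_integrable:
  fixes f :: "complex \<Rightarrow> 'a :: banach"
  assumes "continuous_on (sphere 0 1) f"
  shows "(\<lambda>\<theta>. f (cis \<theta>)) integrable_on {0..2 * pi}"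
  by (intro integrable_continuous_interval continuous_on_circle_param assms)

lemma circle_mean_cong:
  assumes "\<And>z. norm z = 1 \<Longrightarrow> f z = g z"
  shows "circle_mean f = circle_mean g"
  unfolding circle_mean_def using assms by simp

lemma circle_mean_add:
  assumes "continuous_on (sphere 0 1) f" "continuous_on (sphere 0 1) g"
  shows "circle_mean (\<lambda>z. f z + g z) = circle_mean f + circle_mean g"
  unfolding circle_mean_def
  by (subst Henstock_Kurzweil_Integration.integral_add[OF circle_integrable circle_integrable])
    (use assms in \<open>auto simp: add_divide_distrib\<close>)

lemma circle_mean_cmult: "circle_mean (\<lambda>z. c * f z) = c * circle_mean f"
  unfolding circle_mean_def by simp

lemma circle_mean_diff:
  assumes "continuous_on (sphere 0 1) f" "continuous_on (sphere 0 1) g"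
  shows "circle_mean (\<lambda>z. f z - g z) = circle_mean f - circle_mean g"
  using circle_mean_add[OF assms(1), of "\<lambda>z. (-1) * g z"] circle_mean_cmult[of "-1" g] assms
  by (simp add: continuous_intros)

lemma circle_mean_cnj: "circle_mean (\<lambda>z. cnj (f z)) = cnj (circle_mean f)"
  unfolding circle_mean_def by (simp add: integral_cnj)

lemma Re_circle_mean:
  assumes "continuous_on (sphere 0 1) f"
  shows "Re (circle_mean f) = integral {0..2 * pi} (\<lambda>\<theta>. Re (f (cis \<theta>))) / (2 * pi)"
  using integral_linear[OF circle_integrable[OF assms] bounded_linear_Re]
  unfolding circle_mean_def by (simp add: o_def Re_divide_of_real del: of_real_mult)

text \<open>Cauchy's formula for the Taylor coefficients.\<close>
lemma circle_mean_coefficient: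
  assumes f: "f holomorphic_on ball 0 R" and R: "R > 1"
  shows "circle_mean (\<lambda>z. f z / z ^ n) = fps_nth (fps_expansion f 0) n"
proof -
  have h: "f holomorphic_on cball 0 1" by (rule holomorphic_on_subset[OF f]) (use R in auto)
  have "((\<lambda>u. f u / (u - 0) ^ Suc n) has_contour_integral
      (2 * pi * \<i>) / fact n * (deriv ^^ n) f 0) (circlepath 0 1)"
    by (rule Cauchy_has_contour_integral_higher_derivative_circlepath)
      (use h in \<open>auto intro: holomorphic_on_imp_continuous_on holomorphic_on_subset\<close>)
  then have "((\<lambda>t. f (cis t) / cis t ^ Suc n * \<i> * cis t) has_integral
      (2 * pi * \<i>) / fact n * (deriv ^^ n) f 0) {0..2 * pi}"
    unfolding circlepath_def by (subst (asm) has_contour_integral_part_circlepath_iff) auto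
  from has_integral_mult_right[OF this, of "- \<i>"]
  have "((\<lambda>t. f (cis t) / cis t ^ n) has_integral 2 * pi * ((deriv ^^ n) f 0 / fact n)) {0..2 * pi}"
    by (simp add: field_simps)
  then show ?thesis
    unfolding circle_mean_def fps_expansion_def by (simp add: integral_unique)
qed

lemma circle_mean_holomorphic:
  assumes "f holomorphic_on ball 0 R" "R > 1"
  shows "circle_mean f = f 0"
  using circle_mean_coefficient[OF assms, of 0] by (simp add: fps_expansion_def)

lemma circle_mean_swap:
  assumes "continuous_on (sphere 0 1 \<times> sphere 0 1) (\<lambda>(z, s). f z s)"
  shows "circle_mean (\<lambda>z. circle_mean (f z)) = circle_mean (\<lambda>s. circle_mean (\<lambda>z. f z s))"
proof -
  have c: "continuous_on (cbox (0, 0) (2 * pi, 2 * pi)) (\<lambda>(x, y). f (cis x) (cis y))"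
  proof -
    have "continuous_on (cbox (0, 0) (2 * pi, 2 * pi)) (\<lambda>p. (cis (fst p), cis (snd p)))"
      by (intro continuous_intros)
    from continuous_on_compose2[OF assms this] show ?thesis
      by (simp add: case_prod_unfold image_subset_iff)
  qed
  from integral_swap_continuous[OF c] show ?thesis
    unfolding circle_mean_def by (simp add: cbox_interval)
qed

lemma circle_mean_continuous_on_param:
  assumes "continuous_on (U \<times> sphere 0 1) (\<lambda>(t, z). f t z)"
  shows "continuous_on U (\<lambda>t. circle_mean (f t))"
proof -
  have "continuous_on (U \<times> cbox 0 (2 * pi)) (\<lambda>(t, \<theta>). f t (cis \<theta>))"
  proof -
    have "continuous_on (U \<times> cbox 0 (2 * pi)) (\<lambda>p. (fst p, cis (snd p)))"
      by (intro continuous_intros)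
    from continuous_on_compose2[OF assms this] show ?thesis
      by (simp add: case_prod_unfold image_subset_iff)
  qed
  from integral_continuous_on_param[OF this] show ?thesis
    unfolding circle_mean_def by (auto intro!: continuous_intros simp: cbox_interval)
qed

definition divided_difference :: "(complex \<Rightarrow> complex) \<Rightarrow> complex \<Rightarrow> complex \<Rightarrow> complex" where
  "divided_difference \<phi> u v = (if u = v then deriv \<phi> v else (\<phi> u - \<phi> v) / (u - v))"

lemma divided_difference_mult: "divided_difference \<phi> u v * (u - v) = \<phi> u - \<phi> v"
  by (simp add: divided_difference_def)

lemma holomorphic_divided_difference:
  assumes "\<phi> holomorphic_on S" "open S"
  shows "(\<lambda>u. divided_difference \<phi> u v) holomorphic_on S"
  unfolding divided_difference_def by (rule pole_lemma_open[OF assms])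

lemma divided_difference_integral:
  assumes \<phi>: "\<phi> holomorphic_on S" "open S" "convex S" and uv: "u \<in> S" "v \<in> S"
  shows "divided_difference \<phi> u v = integral (cbox 0 1) (\<lambda>s. deriv \<phi> (v + of_real s * (u - v)))"
proof (cases "u = v")
  case True
  then show ?thesis by (simp add: divided_difference_def)
next
  case False
  have inS: "v + of_real s * (u - v) \<in> S" if "s \<in> {0..1}" for s :: real
    using convexD_alt[OF \<phi>(3) uv(2,1), of s] that by (simp add: scaleR_conv_of_real algebra_simps)
  have "((\<lambda>s. deriv \<phi> (v + of_real s * (u - v)) * (u - v)) has_integral
      \<phi> (v + of_real 1 * (u - v)) - \<phi> (v + of_real 0 * (u - v))) {0..1}"
  proof (rule fundamental_theorem_of_calculus)
    fix s :: real assume s: "s \<in> {0..1}"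
    have "((\<lambda>s. v + of_real s * (u - v)) has_vector_derivative (u - v)) (at s within {0..1})"
      by (auto intro!: derivative_eq_intros)
    from field_vector_diff_chain_within[OF this has_field_derivative_at_within[OF holomorphic_derivI[OF \<phi>(1,2) inS[OF s]]]]
    show "((\<lambda>s. \<phi> (v + of_real s * (u - v))) has_vector_derivative
        deriv \<phi> (v + of_real s * (u - v)) * (u - v)) (at s within {0..1})"
      by (simp add: o_def mult.commute)
  qed simp
  from has_integral_mult_left[OF this, of "1 / (u - v)"] False
  have "((\<lambda>s. deriv \<phi> (v + of_real s * (u - v))) has_integral (\<phi> u - \<phi> v) / (u - v)) (cbox 0 1)"
    by (simp add: cbox_interval)
  then show ?thesis using False by (simp add: divided_difference_def integral_unique)
qed

text \<open>Joint continuity at the diagonal is seen from the representation as a mean of the derivative over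
  the segment from \<open>v\<close> to \<open>u\<close>.\<close>
lemma continuous_on_divided_difference:
  assumes \<phi>: "\<phi> holomorphic_on S" "open S" "convex S"
  shows "continuous_on (S \<times> S) (\<lambda>(u, v). divided_difference \<phi> u v)"
proof -
  have d: "continuous_on S (deriv \<phi>)"
    using holomorphic_deriv[OF \<phi>(1,2)] by (rule holomorphic_on_imp_continuous_on)
  have "continuous_on ((S \<times> S) \<times> cbox 0 1) (\<lambda>(p, s). deriv \<phi> (snd p + of_real s * (fst p - snd p)))"
    unfolding case_prod_unfold
  proof (rule continuous_on_compose2[OF d])
    show "(\<lambda>x. snd (fst x) + of_real (snd x) * (fst (fst x) - snd (fst x))) ` ((S \<times> S) \<times> cbox 0 1) \<subseteq> S"
    proof clarsimp
      fix u v s assume "u \<in> S" "v \<in> S" "(0::real) \<le> s" "s \<le> 1"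
      then show "v + of_real s * (u - v) \<in> S"
        using convexD_alt[OF \<phi>(3), of v u s] by (simp add: scaleR_conv_of_real algebra_simps)
    qed
  qed (intro continuous_intros)
  from integral_continuous_on_param[OF this]
  show ?thesis
    by (rule continuous_on_eq) (use divided_difference_integral[OF \<phi>] in auto)
qed

text \<open>Since \<open>2 Re F = F + cnj F\<close>, two means are needed.  On the circle \<open>(s + w) / (s - w)\<close> is the conjugate of
  the function \<open>k\<close> in the proof, which is holomorphic on the closed disc; this gives the mean against
  \<open>cnj F\<close>.  For the mean against \<open>F\<close> the pole at \<open>w\<close> is removed by a divided difference.\<close>
lemma Schwarz_integral_formula:
  assumes F: "F holomorphic_on ball 0 R" and R: "R > 1" and w: "norm w < 1"
  shows "F w = \<i> * of_real (Im (F 0)) + circle_mean (\<lambda>s. of_real (Re (F s)) * ((s + w) / (s - w)))"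
proof -
  define k where "k s = (1 + cnj w * s) / (1 - cnj w * s)" for s
  have nz: "1 - cnj w * s \<noteq> 0" if "norm s < min R (1 / norm w)" for s
  proof
    assume "1 - cnj w * s = 0"
    then have "norm w * norm s = 1" by (metis complex_mod_cnj eq_iff_diff_eq_0 norm_mult norm_one)
    moreover from this have "norm w > 0" by (cases "w = 0") auto
    ultimately show False using that by (auto simp: field_simps)
  qed
  obtain R' where R': "1 < R'" "R' \<le> R" "\<And>s. norm s < R' \<Longrightarrow> 1 - cnj w * s \<noteq> 0"
  proof (cases "w = 0")
    case True
    then show ?thesis using that[of R] R by auto
  next
    case False
    then have "1 / norm w > 1" using w by simp
    then show ?thesis using that[of "min R (1 / norm w)"] nz R by auto
  qed
  have hk: "k holomorphic_on ball 0 R'"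
    unfolding k_def using R'(3) by (intro holomorphic_intros) auto
  have FR: "F holomorphic_on ball 0 R'" by (rule holomorphic_on_subset[OF F]) (use R' in auto)
  have sw: "s - w \<noteq> 0" if "norm s = 1" for s using that w by auto
  have ck: "cnj (k s) = (s + w) / (s - w)" if "norm s = 1" for s
  proof -
    have "s \<noteq> 0" using that by auto
    moreover have "cnj (k s) = (1 + w * (1 / s)) / (1 - w * (1 / s))"
      by (simp add: k_def cnj_on_circle[OF that])
    moreover have "1 + w * (1 / s) = (s + w) / s" "1 - w * (1 / s) = (s - w) / s"
      using \<open>s \<noteq> 0\<close> by (auto simp: field_simps)
    ultimately show ?thesis by simp
  qed
  have cF: "continuous_on (sphere 0 1) F"
    by (rule holomorphic_on_imp_continuous_on[OF holomorphic_on_subset[OF F]]) (use R in auto)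
  have ckern: "continuous_on (sphere 0 1) (\<lambda>s. (s + w) / (s - w))"
    using sw by (intro continuous_intros) auto
  have m1: "circle_mean (\<lambda>s. (s + w) / (s - w)) = 1"
  proof -
    have "circle_mean (\<lambda>s. (s + w) / (s - w)) = cnj (circle_mean k)"
      unfolding circle_mean_cnj[symmetric] by (rule circle_mean_cong) (simp add: ck)
    then show ?thesis using circle_mean_holomorphic[OF hk R'(1)] by (simp add: k_def)
  qed
  have m2: "circle_mean (\<lambda>s. cnj (F s) * ((s + w) / (s - w))) = cnj (F 0)"
  proof -
    have "circle_mean (\<lambda>s. cnj (F s) * ((s + w) / (s - w))) = cnj (circle_mean (\<lambda>s. F s * k s))"
      unfolding circle_mean_cnj[symmetric] by (rule circle_mean_cong) (simp add: ck)
    also have "circle_mean (\<lambda>s. F s * k s) = F 0 * k 0"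
      by (rule circle_mean_holomorphic[OF _ R'(1)]) (intro holomorphic_intros FR hk)
    finally show ?thesis by (simp add: k_def)
  qed
  have m3: "circle_mean (\<lambda>s. F s * ((s + w) / (s - w))) = 2 * F w - F 0"
  proof -
    have hd: "(\<lambda>s. divided_difference F s w * (s + w)) holomorphic_on ball 0 R"
      by (intro holomorphic_intros holomorphic_divided_difference[OF F open_ball])
    have "circle_mean (\<lambda>s. F s * ((s + w) / (s - w))) =
        circle_mean (\<lambda>s. divided_difference F s w * (s + w) + F w * ((s + w) / (s - w)))"
    proof (rule circle_mean_cong)
      fix s :: complex assume "norm s = 1"
      then have "s \<noteq> w" using w by auto
      then show "F s * ((s + w) / (s - w)) = divided_difference F s w * (s + w) + F w * ((s + w) / (s - w))"
        by (simp add: divided_difference_def divide_simps) (simp add: algebra_simps)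
    qed
    also have "\<dots> = circle_mean (\<lambda>s. divided_difference F s w * (s + w)) + F w * 1"
      unfolding m1[symmetric] circle_mean_cmult[symmetric]
    proof (rule circle_mean_add)
      show "continuous_on (sphere 0 1) (\<lambda>s. divided_difference F s w * (s + w))"
        by (rule holomorphic_on_imp_continuous_on[OF holomorphic_on_subset[OF hd]]) (use R in auto)
    qed (intro continuous_intros ckern)
    also have "circle_mean (\<lambda>s. divided_difference F s w * (s + w)) = divided_difference F 0 w * (0 + w)"
      by (rule circle_mean_holomorphic[OF hd R])
    also have "\<dots> = F w - F 0"
      using divided_difference_mult[of F 0 w] by (simp add: algebra_simps minus_equation_iff)
    finally show ?thesis by simp
  qed
  have "circle_mean (\<lambda>s. of_real (Re (F s)) * ((s + w) / (s - w))) =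
      circle_mean (\<lambda>s. (1/2) * (F s * ((s + w) / (s - w)) + cnj (F s) * ((s + w) / (s - w))))"
  proof (rule circle_mean_cong)
    fix s :: complex
    have "of_real (Re (F s)) = (1/2) * (F s + cnj (F s))" by (simp add: complex_eq_iff)
    then show "of_real (Re (F s)) * ((s + w) / (s - w)) =
      (1/2) * (F s * ((s + w) / (s - w)) + cnj (F s) * ((s + w) / (s - w)))"
      by (simp only: mult.assoc distrib_right)
  qed
  also have "\<dots> = (1/2) * (2 * F w - F 0 + cnj (F 0))"
    unfolding circle_mean_cmult
      circle_mean_add[OF continuous_on_mult[OF cF ckern] continuous_on_mult[OF continuous_on_cnj[OF cF] ckern]]
      m2 m3 by simp
  also have "\<dots> = F w - \<i> * of_real (Im (F 0))"
    by (simp add: complex_eq_iff)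
  finally show ?thesis by simp
qed

text \<open>Expand \<open>\<phi> (\<zeta> / z)\<close> in powers of \<open>1 / z\<close>: the mean of \<open>\<omega> (r z) / z\<^sup>n\<close> picks the \<open>n\<close>-th coefficient of
  \<open>\<omega>\<close>, and the series converges uniformly on the circle.\<close>
lemma convolution_circle_mean:
  assumes \<phi>: "\<phi> holomorphic_on unit_disc" and \<omega>: "\<omega> holomorphic_on unit_disc"
    and \<zeta>: "norm \<zeta> < 1" and r: "0 < r" "r < (1::real)"
  shows "(\<phi> \<star> \<omega>) (of_real r * \<zeta>) = circle_mean (\<lambda>z. \<phi> (\<zeta> / z) * \<omega> (of_real r * z))"
proof -
  define a b where "a n = fps_nth (fps_expansion \<phi> 0) n" and "b n = fps_nth (fps_expansion \<omega> 0) n" for n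
  define k where "k z = \<omega> (of_real r * z)" for z
  have hk: "k holomorphic_on ball 0 (1 / r)"
    unfolding k_def
    by (rule holomorphic_on_compose_gen[OF _ \<omega>, of "\<lambda>z. of_real r * z", unfolded o_def])
      (use r in \<open>auto intro!: holomorphic_intros simp: norm_mult field_simps\<close>)
  have r1: "1 / r > 1" using r by simp
  have bk: "fps_nth (fps_expansion k 0) n = b n * of_real r ^ n" for n
  proof -
    have "(deriv ^^ n) k 0 = of_real r ^ n * (deriv ^^ n) \<omega> (of_real r * 0)"
      unfolding k_def
      by (rule higher_deriv_compose_linear[OF \<omega> open_ball[of 0 "1/r"] open_ball])
        (use r in \<open>auto simp: norm_mult field_simps\<close>)
    then show ?thesis by (simp add: fps_expansion_def b_def)
  qed
  have \<phi>': "\<phi> holomorphic_on eball 0 (ereal 1)" using \<phi> by simp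
  have sums: "(\<lambda>n. a n * w ^ n) sums \<phi> w" if "norm w < 1" for w
    using holomorphic_power_series[OF \<phi>, of w] that by (simp add: a_def fps_expansion_def)
  have abs: "summable (\<lambda>n. norm (a n * \<zeta> ^ n))"
    unfolding a_def
  proof (rule norm_summable_fps)
    have "ereal (norm \<zeta>) < ereal 1" using \<zeta> by simp
    then show "ereal (norm \<zeta>) < fps_conv_radius (fps_expansion \<phi> 0)"
      using conv_radius_fps_expansion[OF \<phi>'] by (rule less_le_trans)
  qed
  have ck: "continuous_on (sphere 0 1) k"
    by (rule holomorphic_on_imp_continuous_on[OF holomorphic_on_subset[OF hk]]) (use r1 in auto)
  obtain B where B: "\<And>z. z \<in> sphere 0 1 \<Longrightarrow> norm (k z) \<le> B"
    using compact_imp_bounded[OF compact_continuous_image[OF ck compact_sphere]]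
    unfolding bounded_iff by blast
  have ul: "uniform_limit {0..2 * pi} (\<lambda>N \<theta>. \<Sum>n<N. a n * (\<zeta> / cis \<theta>) ^ n * k (cis \<theta>))
      (\<lambda>\<theta>. \<Sum>n. a n * (\<zeta> / cis \<theta>) ^ n * k (cis \<theta>)) sequentially"
  proof (rule Weierstrass_m_test)
    show "norm (a n * (\<zeta> / cis \<theta>) ^ n * k (cis \<theta>)) \<le> norm (a n * \<zeta> ^ n) * B" for n \<theta>
      using B[of "cis \<theta>"]
      by (auto simp: norm_mult norm_power norm_divide intro!: mult_left_mono)
    show "summable (\<lambda>n. norm (a n * \<zeta> ^ n) * B)"
      by (intro summable_mult2 abs)
  qed
  have cont: "continuous_on {0..2 * pi} (\<lambda>\<theta>. \<Sum>n<N. a n * (\<zeta> / cis \<theta>) ^ n * k (cis \<theta>))" for N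
    by (intro continuous_intros continuous_on_circle_param ck) auto
  obtain I J where IJ: "\<And>N. ((\<lambda>\<theta>. \<Sum>n<N. a n * (\<zeta> / cis \<theta>) ^ n * k (cis \<theta>)) has_integral I N) {0..2 * pi}"
      "((\<lambda>\<theta>. \<Sum>n. a n * (\<zeta> / cis \<theta>) ^ n * k (cis \<theta>)) has_integral J) {0..2 * pi}"
      "I \<longlonglongrightarrow> J"
    using uniform_limit_integral[OF ul cont] by auto
  have J: "J = of_real (2 * pi) * circle_mean (\<lambda>z. \<phi> (\<zeta> / z) * k z)"
  proof -
    have "(\<Sum>n. a n * (\<zeta> / cis \<theta>) ^ n * k (cis \<theta>)) = \<phi> (\<zeta> / cis \<theta>) * k (cis \<theta>)" for \<theta>
      using sums_mult2[OF sums[of "\<zeta> / cis \<theta>"], of "k (cis \<theta>)"] \<zeta>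
      by (simp add: norm_divide sums_iff)
    then have "integral {0..2 * pi} (\<lambda>\<theta>. \<phi> (\<zeta> / cis \<theta>) * k (cis \<theta>)) = J"
      using IJ(2) by (simp add: integral_unique)
    then show ?thesis by (simp add: circle_mean_def)
  qed
  have I: "I N = of_real (2 * pi) * (\<Sum>n<N. a n * b n * (of_real r * \<zeta>) ^ n)" for N
  proof -
    have "((\<lambda>\<theta>. \<Sum>n<N. a n * (\<zeta> / cis \<theta>) ^ n * k (cis \<theta>)) has_integral
        (\<Sum>n<N. of_real (2 * pi) * (a n * b n * (of_real r * \<zeta>) ^ n))) {0..2 * pi}"
    proof (rule has_integral_sum[OF finite_lessThan])
      fix n
      have "continuous_on (sphere 0 1) (\<lambda>z. k z / z ^ n)"
        by (intro continuous_intros ck) auto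
      from integrable_integral[OF circle_integrable[OF this]]
      have "((\<lambda>\<theta>. k (cis \<theta>) / cis \<theta> ^ n) has_integral of_real (2 * pi) * (b n * of_real r ^ n)) {0..2 * pi}"
        using circle_mean_coefficient[OF hk r1, of n] by (simp add: circle_mean_def bk field_simps)
      from has_integral_mult_right[OF this, of "a n * \<zeta> ^ n"]
      show "((\<lambda>\<theta>. a n * (\<zeta> / cis \<theta>) ^ n * k (cis \<theta>)) has_integral
          of_real (2 * pi) * (a n * b n * (of_real r * \<zeta>) ^ n)) {0..2 * pi}"
        by (simp add: power_mult_distrib power_divide mult_ac)
    qed
    from has_integral_unique[OF IJ(1)[of N] this] show ?thesis by (simp add: sum_distrib_left)
  qed
  have "(\<lambda>N. I N / of_real (2 * pi)) \<longlonglongrightarrow> J / of_real (2 * pi)"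
    by (intro tendsto_intros IJ) auto
  then have "(\<lambda>n. a n * b n * (of_real r * \<zeta>) ^ n) sums circle_mean (\<lambda>z. \<phi> (\<zeta> / z) * k z)"
    unfolding sums_def I J by simp
  then show ?thesis
    unfolding convolution_def a_def[symmetric] b_def[symmetric] by (simp add: sums_iff k_def)
qed

section \<open>The sign argument on the boundary\<close>

text \<open>On the circle the Schwarz kernel is imaginary, and whether its imaginary part exceeds the one at \<open>s\<close>
  depends on the side of \<open>z\<close> relative to the chord through \<open>t\<close> and \<open>s\<close>.\<close>
lemma kernel_difference_on_circle:
  fixes t s z :: complex
  assumes n: "norm t = 1" "norm s = 1" "norm z = 1" and ne: "t \<noteq> s" "t \<noteq> z"
  shows "(t + z) / (t - z) - (t + s) / (t - s) =
    - \<i> * of_real (4 * orientation t s z / ((norm (t - s))\<^sup>2 * (norm (t - z))\<^sup>2))"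
proof -
  have nz: "t \<noteq> 0" "s \<noteq> 0" "z \<noteq> 0" "t - s \<noteq> 0" "t - z \<noteq> 0" using n ne by auto
  have N: "of_real ((norm (t - s))\<^sup>2) = - ((t - s)\<^sup>2 / (t * s))" "of_real ((norm (t - z))\<^sup>2) = - ((t - z)\<^sup>2 / (t * z))"
    using diff_square_on_circle[OF n(1,2)] diff_square_on_circle[OF n(1,3)] nz by auto
  have "- \<i> * of_real (4 * orientation t s z / ((norm (t - s))\<^sup>2 * (norm (t - z))\<^sup>2)) =
    - \<i> * (4 * ((\<i> / 2) * ((t - s) * (s - z) * (z - t)) / (t * s * z)) / (((t - s)\<^sup>2 / (t * s)) * ((t - z)\<^sup>2 / (t * z))))"
    unfolding of_real_divide of_real_mult[of "_\<^sup>2"] N orientation_on_circle[OF n, symmetric] by simp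
  also have "\<dots> = - 2 * t * ((s - z) * (t - z) * (t - s)) / ((t - s)\<^sup>2 * (t - z)\<^sup>2)"
  proof -
    have "- \<i> * (4 * ((\<i> / 2) * (A * B * (- C)) / (t * s * z)) / ((A\<^sup>2 / (t * s)) * (C\<^sup>2 / (t * z)))) =
      - 2 * t * (B * C * A) / (A\<^sup>2 * C\<^sup>2)" if "A \<noteq> 0" "C \<noteq> 0" for A B C
      using nz that by (simp add: field_simps power2_eq_square)
    from this[of "t - s" "t - z" "s - z"] nz show ?thesis by simp
  qed
  also have "\<dots> = 2 * t * (z - s) / ((t - s) * (t - z))"
  proof -
    have "- 2 * t * (B * C * A) / (A\<^sup>2 * C\<^sup>2) = 2 * t * (- B) / (A * C)" if "A \<noteq> 0" "C \<noteq> 0" for A B C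
      using that by (simp add: field_simps power2_eq_square)
    from this[of "t - s" "t - z" "s - z"] nz show ?thesis by simp
  qed
  also have "\<dots> = (t + z) / (t - z) - (t + s) / (t - s)"
    using nz by (simp add: diff_frac_eq) (simp add: algebra_simps)
  finally show ?thesis by simp
qed

lemma orientation_cnj: "orientation (cnj a) (cnj b) (cnj c) = - orientation a b c"
  by (simp add: orientation_def algebra_simps)

lemma orientation_mult: "orientation (e * a) (e * b) (e * c) = (norm e)\<^sup>2 * orientation a b c"
  unfolding orientation_def cmod_power2 by (simp add: power2_eq_square algebra_simps)

lemma orientation_swap: "orientation a b c = - orientation b a c"
  by (simp add: orientation_def algebra_simps)

lemma orientation_flip: "orientation a c b = - orientation a b c"
  by (simp add: orientation_def algebra_simps)

lemma orientation_reciprocal_on_circle: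
  assumes "norm a = 1" "norm b = 1" "norm c = 1"
  shows "orientation (e / a) (e / b) (e / c) = - ((norm e)\<^sup>2) * orientation a b c"
proof -
  have "e / x = e * cnj x" if "norm x = 1" for x
    by (simp add: cnj_on_circle[OF that])
  then show ?thesis using assms by (simp add: orientation_mult orientation_cnj)
qed

lemma closure_interval_minus_finite:
  fixes a b x :: real
  assumes "finite X" "x \<in> {a..b}" "a < b"
  shows "x \<in> closure ({a..b} - X)"
proof -
  have "x islimpt {a..b}" using assms islimpt_Icc by auto
  moreover have "{a..b} \<subseteq> X \<union> ({a..b} - X)" by auto
  ultimately have "x islimpt ({a..b} - X)"
    using islimpt_Un_finite[OF assms(1)] islimpt_subset by blast
  then show ?thesis by (simp add: closure_def)
qed

lemma finite_circle_angles:
  assumes "finite E"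
  shows "finite {\<theta> \<in> {0..2 * pi}. cis \<theta> \<in> E}"
proof -
  have "inj_on cis {0..<2 * pi}"
  proof (rule inj_on_inverseI[where g = Arg2pi])
    show "Arg2pi (cis x) = x" if "x \<in> {0..<2 * pi}" for x
      using that by (intro Arg2pi_unique[of 1]) (auto simp: cis_conv_exp)
  qed
  then have "finite (cis -` E \<inter> {0..<2 * pi})"
    by (rule finite_vimage_IntI[OF assms])
  moreover have "{\<theta> \<in> {0..2 * pi}. cis \<theta> \<in> E} \<subseteq> insert (2 * pi) (cis -` E \<inter> {0..<2 * pi})"
    by auto
  ultimately show ?thesis using finite_subset by blast
qed

lemma circle_angle:
  assumes "norm z = 1"
  obtains \<theta> where "\<theta> \<in> {0..2 * pi}" "z = cis \<theta>"
proof
  show "Arg2pi z \<in> {0..2 * pi}" using Arg2pi_ge_0[of z] Arg2pi_lt_2pi[of z] by simp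
  show "z = cis (Arg2pi z)"
    using assms Arg2pi_eq[of z] by (simp add: cis_conv_exp)
qed

text \<open>A finite set \<open>E\<close>, where the sign is not controlled, does not matter by continuity.\<close>
lemma circle_integral_zero_sign:
  fixes P y :: "complex \<Rightarrow> real"
  assumes cP: "continuous_on (sphere 0 1) P" and cy: "continuous_on (sphere 0 1) y"
    and E: "finite E" and P: "\<And>z. norm z = 1 \<Longrightarrow> z \<notin> E \<Longrightarrow> P z \<ge> 0"
    and Py: "\<And>z. norm z = 1 \<Longrightarrow> z \<notin> E \<Longrightarrow> P z = 0 \<Longrightarrow> y z = 0"
    and I: "integral {0..2 * pi} (\<lambda>\<theta>. P (cis \<theta>)) = 0" and z: "norm z = 1"
  shows "y z = 0"
proof -
  define X where "X = {\<theta> \<in> {0..2 * pi}. cis \<theta> \<in> E}"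
  have X: "finite X" unfolding X_def by (rule finite_circle_angles[OF E])
  have cl: "closure ({0..2 * pi} - X) = {0..2 * pi}"
    using closure_interval_minus_finite[OF X, of _ 0 "2 * pi"] closure_minimal[of "{0..2 * pi} - X" "{0..2 * pi}"]
    by (auto simp: pi_gt_zero)
  have cP': "continuous_on {0..2 * pi} (\<lambda>\<theta>. P (cis \<theta>))" and cy': "continuous_on {0..2 * pi} (\<lambda>\<theta>. y (cis \<theta>))"
    by (intro continuous_on_circle_param cP cy)+
  have "P (cis \<theta>) \<ge> 0" if "\<theta> \<in> {0..2 * pi}" for \<theta>
    by (rule continuous_ge_on_closure[of "{0..2 * pi} - X" "\<lambda>\<theta>. P (cis \<theta>)"])
      (use cl cP' that P in \<open>auto simp: X_def\<close>)
  then have P0: "P (cis \<theta>) = 0" if "\<theta> \<in> {0..2 * pi}" for \<theta>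
    using integral_cbox_eq_0_iff[of 0 "2 * pi" "\<lambda>\<theta>. P (cis \<theta>)"] cP' I that pi_gt_zero by (auto simp: cbox_interval)
  have y0: "y (cis \<theta>) = 0" if "\<theta> \<in> {0..2 * pi}" for \<theta>
    by (rule continuous_constant_on_closure[of "{0..2 * pi} - X" "\<lambda>\<theta>. y (cis \<theta>)"])
      (use cl cy' that Py P0 in \<open>auto simp: X_def\<close>)
  obtain \<theta> where "\<theta> \<in> {0..2 * pi}" "z = cis \<theta>" using circle_angle[OF z] .
  then show ?thesis using y0 by blast
qed

text \<open>A constant functional would put the images of \<open>1\<close>, \<open>\<i>\<close> and \<open>-1\<close> on one line.\<close>
lemma convex_univalent_functional_nonconstant:
  assumes \<phi>: "\<phi> \<in> convex_univalent" and r: "0 < r" "r < (1::real)" and m: "m \<noteq> 0"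
  shows "\<not> (\<forall>z :: complex. norm z = 1 \<longrightarrow> Re (m * \<phi> (r * z)) = c)"
proof
  assume c: "\<forall>z :: complex. norm z = 1 \<longrightarrow> Re (m * \<phi> (r * z)) = c"
  define p q s where "p = \<phi> (r * 1)" and "q = \<phi> (r * \<i>)" and "s = \<phi> (r * (-1))"
  have "orientation p q s \<noteq> 0"
    unfolding p_def q_def s_def
    by (rule convex_univalent_not_collinear[OF \<phi>, where r = r])
      (use r in \<open>auto simp: norm_mult complex_eq_iff\<close>)
  moreover have "Re (m * (q - p)) = 0" "Re (m * (s - p)) = 0"
    using c[rule_format, of 1] c[rule_format, of \<i>] c[rule_format, of "-1"]
    by (auto simp: p_def q_def s_def right_diff_distrib)
  then have "(norm m)\<^sup>2 * Im (cnj (q - p) * (s - p)) = 0"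
    unfolding cmod_power2 by simp algebra
  ultimately show False using m by (simp add: orientation_def)
qed

text \<open>A point of the disc is written as \<open>r * \<zeta>\<close>; then \<open>\<psi>\<close> below, the dilation of \<open>z \<phi>\<^sub>1' z\<close>, is holomorphic
  beyond the unit circle, while \<open>\<phi> (\<zeta> / z)\<close> is defined for \<open>|z| \<ge> 1\<close>.\<close>
locale convolution_setting =
  fixes \<phi> \<phi>\<^sub>1 :: "complex \<Rightarrow> complex" and \<zeta> :: complex and r :: real
  assumes \<phi>: "\<phi> \<in> convex_univalent" and \<phi>\<^sub>1: "\<phi>\<^sub>1 \<in> convex_univalent"
    and \<zeta>: "\<zeta> \<noteq> 0" "norm \<zeta> < 1" and r: "0 < r" "r < 1"
begin

definition \<psi> :: "complex \<Rightarrow> complex" where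
  "\<psi> z = of_real r * z * deriv \<phi>\<^sub>1 (of_real r * z)"

text \<open>This is \<open>(\<phi> (\<zeta> / z) - \<phi> (\<zeta> / t)) * (t + z) / (t - z)\<close> with the singularity at \<open>z = t\<close> removed
  (see \<open>kernel_eq\<close>).  Subtracting \<open>\<phi> (\<zeta> / t)\<close> does not change the mean against \<open>\<psi>\<close> for \<open>|t| > 1\<close>,
  because \<open>\<psi> z * (t + z) / (t - z)\<close> is holomorphic on the closed disc and vanishes at \<open>0\<close>; and it allows
  \<open>t\<close> to lie on the circle of integration.\<close>
definition kernel :: "complex \<Rightarrow> complex \<Rightarrow> complex" where
  "kernel t z = \<zeta> / (z * t) * divided_difference \<phi> (\<zeta> / z) (\<zeta> / t) * (t + z)"

lemma \<psi>_holomorphic: "\<psi> holomorphic_on ball 0 (1 / r)"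
proof -
  have "deriv \<phi>\<^sub>1 holomorphic_on unit_disc"
    by (rule holomorphic_deriv[OF convex_univalentD(1)[OF \<phi>\<^sub>1] open_ball])
  then have "(\<lambda>z. deriv \<phi>\<^sub>1 (of_real r * z)) holomorphic_on ball 0 (1 / r)"
    by (rule holomorphic_on_compose_gen[of "\<lambda>z. of_real r * z", unfolded o_def, rotated])
      (use r in \<open>auto intro!: holomorphic_intros simp: norm_mult field_simps\<close>)
  then show ?thesis unfolding \<psi>_def by (intro holomorphic_intros)
qed

lemma inverse_radius_gt_1: "1 / r > 1" using r by simp

lemma \<psi>_continuous: "continuous_on (sphere 0 1) \<psi>"
  by (rule holomorphic_on_imp_continuous_on[OF holomorphic_on_subset[OF \<psi>_holomorphic]]) (use inverse_radius_gt_1 in auto)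

lemma \<zeta>_div: "norm t \<ge> 1 \<Longrightarrow> norm (\<zeta> / t) < 1"
  using \<zeta> by (simp add: norm_divide divide_less_eq)

lemma kernel_eq:
  assumes "norm z \<ge> 1" "norm t \<ge> 1" "z \<noteq> t"
  shows "kernel t z = (\<phi> (\<zeta> / z) - \<phi> (\<zeta> / t)) * ((t + z) / (t - z))"
proof -
  have nz: "z \<noteq> 0" "t \<noteq> 0" using assms by auto
  have "\<phi> (\<zeta> / z) - \<phi> (\<zeta> / t) = divided_difference \<phi> (\<zeta> / z) (\<zeta> / t) * (\<zeta> / z - \<zeta> / t)"
    by (rule divided_difference_mult[symmetric])
  also have "\<zeta> / z - \<zeta> / t = \<zeta> / (z * t) * (t - z)"
    using nz by (simp add: field_simps)
  finally show ?thesis unfolding kernel_def using assms(3) by simp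
qed

lemma continuous_on_kernel: "continuous_on ({t. norm t \<ge> 1} \<times> sphere 0 1) (\<lambda>(t, z). kernel t z)"
proof -
  have "continuous_on ({t. norm t \<ge> 1} \<times> sphere 0 1) (\<lambda>p. (\<zeta> / snd p, \<zeta> / fst p))"
    by (intro continuous_intros) auto
  from continuous_on_compose2[OF continuous_on_divided_difference[OF convex_univalentD(1)[OF \<phi>] open_ball convex_ball] this]
  have "continuous_on ({t. norm t \<ge> 1} \<times> sphere 0 1) (\<lambda>p. divided_difference \<phi> (\<zeta> / snd p) (\<zeta> / fst p))"
    using \<zeta>_div by (auto simp: case_prod_unfold image_subset_iff)
  then show ?thesis unfolding kernel_def case_prod_unfold
    by (intro continuous_intros) auto
qed

lemma continuous_on_kernel_circle:
  assumes "norm t \<ge> 1"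
  shows "continuous_on (sphere 0 1) (kernel t)"
proof -
  have "continuous_on (sphere 0 1) (\<lambda>z. (t, z))" by (intro continuous_intros)
  from continuous_on_compose2[OF continuous_on_kernel this] show ?thesis
    using assms by (simp add: image_subset_iff)
qed

lemma continuous_on_\<phi>_circle: "continuous_on (sphere 0 1) (\<lambda>z. \<phi> (\<zeta> / z))"
  by (rule continuous_on_compose2[OF convex_univalentD(6)[OF \<phi>]])
    (auto intro!: continuous_intros simp: norm_divide \<zeta>)

definition kernel_pairing :: "complex \<Rightarrow> complex" where
  "kernel_pairing t = circle_mean (\<lambda>z. kernel t z * \<psi> z)"

definition starlike_pairing :: complex where
  "starlike_pairing = circle_mean (\<lambda>z. \<phi> (\<zeta> / z) * \<psi> z)"

lemma continuous_on_kernel_pairing: "continuous_on {t. norm t \<ge> 1} kernel_pairing"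
  unfolding kernel_pairing_def
proof (rule circle_mean_continuous_on_param)
  have "continuous_on ({t. norm t \<ge> 1} \<times> sphere 0 1) (\<lambda>p. \<psi> (snd p))"
    by (rule continuous_on_compose2[OF \<psi>_continuous]) (auto intro!: continuous_intros)
  with continuous_on_kernel
  show "continuous_on ({t. 1 \<le> cmod t} \<times> sphere 0 1) (\<lambda>(t, z). kernel t z * \<psi> z)"
    unfolding case_prod_unfold by (intro continuous_intros)
qed

text \<open>The mean of \<open>C * \<psi>\<close> vanishes by the assumption on the pairing.  The mean of \<open>C * cnj \<psi>\<close> always
  vanishes: on the circle both factors are holomorphic functions of \<open>1 / z = cnj z\<close>, and \<open>\<psi> 0 = 0\<close>.  Together
  they give the real functions \<open>Re (m * \<psi>)\<close>.\<close>
lemma boundary_orthogonality: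
  assumes t: "norm t = 1" and eq: "kernel_pairing t = \<i> * of_real \<alpha> * starlike_pairing"
  defines "C \<equiv> \<lambda>z. kernel t z - \<i> * of_real \<alpha> * (\<phi> (\<zeta> / z) - \<phi> (\<zeta> / t))"
  shows "integral {0..2 * pi} (\<lambda>\<theta>. Re (\<kappa> * C (cis \<theta>)) * Re (m * \<psi> (cis \<theta>))) = 0"
proof -
  have cC: "continuous_on (sphere 0 1) C"
    unfolding C_def
    by (intro continuous_intros continuous_on_kernel_circle continuous_on_\<phi>_circle) (use t in auto)
  note cont = cC \<psi>_continuous continuous_on_\<phi>_circle continuous_on_kernel_circle
  have \<psi>0: "\<psi> 0 = 0" by (simp add: \<psi>_def)
  have m\<psi>: "circle_mean \<psi> = 0"
    using circle_mean_holomorphic[OF \<psi>_holomorphic inverse_radius_gt_1] \<psi>0 by simp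
  have A: "circle_mean (\<lambda>z. C z * \<psi> z) = 0"
  proof -
    have "circle_mean (\<lambda>z. C z * \<psi> z) = circle_mean (\<lambda>z. (kernel t z * \<psi> z - \<i> * of_real \<alpha> * (\<phi> (\<zeta> / z) * \<psi> z))
        + \<i> * of_real \<alpha> * \<phi> (\<zeta> / t) * \<psi> z)"
      by (rule circle_mean_cong) (simp add: C_def algebra_simps)
    also have "\<dots> = (kernel_pairing t - \<i> * of_real \<alpha> * starlike_pairing) + \<i> * of_real \<alpha> * \<phi> (\<zeta> / t) * circle_mean \<psi>"
      unfolding kernel_pairing_def starlike_pairing_def circle_mean_cmult[symmetric] using t
      by (subst circle_mean_add circle_mean_diff; (intro continuous_intros cont)?; simp)+
    finally show ?thesis using eq m\<psi> by simp
  qed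
  have B: "circle_mean (\<lambda>z. C z * cnj (\<psi> z)) = 0"
  proof -
    define k where "k v = \<zeta> / t * divided_difference \<phi> (\<zeta> * v) (\<zeta> / t) * (t * v + 1)
        - \<i> * of_real \<alpha> * (\<phi> (\<zeta> * v) - \<phi> (\<zeta> / t))" for v
    have Rz: "1 / norm \<zeta> > 1" using \<zeta> by simp
    have comp: "(\<lambda>v. f (\<zeta> * v)) holomorphic_on ball 0 (1 / norm \<zeta>)" if "f holomorphic_on unit_disc" for f
      by (rule holomorphic_on_compose_gen[OF _ that, of "\<lambda>v. \<zeta> * v", unfolded o_def])
        (use \<zeta> in \<open>auto intro!: holomorphic_intros simp: norm_mult field_simps\<close>)
    have hk: "k holomorphic_on ball 0 (1 / norm \<zeta>)"
      unfolding k_def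
      by (intro holomorphic_intros comp[OF holomorphic_divided_difference[OF _ open_ball]] comp
          convex_univalentD(1)[OF \<phi>])
    define K where "K = cnj \<circ> k \<circ> cnj"
    have hK: "K holomorphic_on ball 0 (1 / norm \<zeta>)"
      unfolding K_def by (rule holomorphic_on_compose_cnj_cnj) 
        (use hk in \<open>auto simp: image_cnj_conv_vimage_cnj intro: holomorphic_on_subset\<close>)
    define R where "R = min (1 / norm \<zeta>) (1 / r)"
    have R: "R > 1" using Rz inverse_radius_gt_1 by (simp add: R_def)
    have "(\<lambda>z. K z * \<psi> z) holomorphic_on ball 0 R"
      by (intro holomorphic_intros holomorphic_on_subset[OF hK] holomorphic_on_subset[OF \<psi>_holomorphic])
        (auto simp: R_def)
    from circle_mean_holomorphic[OF this R] have "circle_mean (\<lambda>z. K z * \<psi> z) = 0"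
      by (simp add: \<psi>0)
    moreover have "circle_mean (\<lambda>z. C z * cnj (\<psi> z)) = cnj (circle_mean (\<lambda>z. K z * \<psi> z))"
      unfolding circle_mean_cnj[symmetric]
    proof (rule circle_mean_cong)
      fix z :: complex assume z: "norm z = 1"
      have nz: "z \<noteq> 0" "t \<noteq> 0" using z t by auto
      have "k (1 / z) = C z"
        unfolding k_def C_def kernel_def using nz by (simp add: field_simps)
      then show "C z * cnj (\<psi> z) = cnj (K z * \<psi> z)"
        by (simp add: K_def cnj_on_circle[OF z])
    qed
    ultimately show ?thesis by simp
  qed
  have "circle_mean (\<lambda>z. \<kappa> * (C z * of_real (Re (m * \<psi> z)))) =
      circle_mean (\<lambda>z. (\<kappa> * m / 2) * (C z * \<psi> z) + (\<kappa> * cnj m / 2) * (C z * cnj (\<psi> z)))"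
  proof (rule circle_mean_cong)
    fix z
    have "of_real (Re (m * \<psi> z)) = (m * \<psi> z + cnj (m * \<psi> z)) / 2"
      by (simp add: complex_eq_iff)
    then show "\<kappa> * (C z * of_real (Re (m * \<psi> z))) =
        (\<kappa> * m / 2) * (C z * \<psi> z) + (\<kappa> * cnj m / 2) * (C z * cnj (\<psi> z))"
      by (simp add: field_simps)
  qed
  also have "\<dots> = (\<kappa> * m / 2) * circle_mean (\<lambda>z. C z * \<psi> z) + (\<kappa> * cnj m / 2) * circle_mean (\<lambda>z. C z * cnj (\<psi> z))"
    unfolding circle_mean_cmult[symmetric] by (rule circle_mean_add) (intro continuous_intros cont)+
  also have "\<dots> = 0" by (simp add: A B)
  finally have "Re (circle_mean (\<lambda>z. \<kappa> * (C z * of_real (Re (m * \<psi> z))))) = 0" by simp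
  moreover have "Re (\<kappa> * (c * of_real x)) = Re (\<kappa> * c) * x" for c x
    by (simp add: algebra_simps)
  ultimately show ?thesis
    by (subst (asm) Re_circle_mean) (auto intro!: continuous_intros cont)
qed

end

lemma orientation_nonzero_on_circle:
  assumes "norm a = 1" "norm b = 1" "norm c = 1" "a \<noteq> b" "b \<noteq> c" "a \<noteq> c"
  shows "orientation a b c \<noteq> 0"
proof
  assume "orientation a b c = 0"
  then have "(\<i> / 2) * ((a - b) * (b - c) * (c - a)) / (a * b * c) = 0"
    using orientation_on_circle[OF assms(1-3)] by simp
  then show False using assms by auto
qed

lemma parallel_of_common_normal:
  assumes "\<kappa> \<noteq> 0" "Im (\<kappa> * x) = 0" "Im (\<kappa> * y) = 0"
  shows "Im (cnj x * y) = 0"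
proof -
  have "(norm \<kappa>)\<^sup>2 * Im (cnj x * y) = 0"
    using assms(2,3) unfolding cmod_power2 by simp algebra
  then show ?thesis using assms(1) by simp
qed

context convolution_setting
begin

text \<open>Otherwise, \<open>boundary_orthogonality\<close> provides a vanishing integral of a product of three factors:
  the kernel minus \<open>\<i> \<alpha>\<close>, which changes sign at \<open>t\<close> and at its zero \<open>s\<close>; a real linear
  functional of \<open>\<phi> (\<zeta> / z) - \<phi> (\<zeta> / t)\<close>, chosen to change sign at \<open>t\<close> and \<open>z1\<close>, or
  nowhere if \<open>z1 = t\<close>; and the derivative \<open>y\<close>
  of a linear functional along the curve \<open>\<phi>\<^sub>1 (r z)\<close>, chosen with maximum at \<open>s\<close>, so that it changes sign
  at \<open>s\<close> and at the minimum \<open>z1\<close>.  The product has constant sign, so \<open>y\<close> vanishes and the functional is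
  constant, which is impossible.\<close>
lemma kernel_pairing_not_imaginary:
  assumes t: "norm t = 1"
  shows "kernel_pairing t \<noteq> \<i> * of_real \<alpha> * starlike_pairing"
proof
  assume eq: "kernel_pairing t = \<i> * of_real \<alpha> * starlike_pairing"
  note K = convex_univalentD[OF \<phi>] and K1 = convex_univalentD[OF \<phi>\<^sub>1]
  have \<alpha>nz: "\<i> * of_real \<alpha> + 1 \<noteq> 0" by (simp add: complex_eq_iff)
  \<comment> \<open>The solution of \<open>(t + s) / (t - s) = \<i> * \<alpha>\<close>.\<close>
  define s where "s = t * ((\<i> * of_real \<alpha> - 1) / (\<i> * of_real \<alpha> + 1))"
  have "norm (\<i> * of_real \<alpha> - 1) = norm (\<i> * of_real \<alpha> + 1)" by (simp add: cmod_def)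
  then have ns: "norm s = 1" using t \<alpha>nz by (simp add: s_def norm_mult norm_divide)
  have tnz: "t \<noteq> 0" using t by auto
  have ts: "t + s = t * (2 * \<i> * of_real \<alpha>) / (\<i> * of_real \<alpha> + 1)" "t - s = t * 2 / (\<i> * of_real \<alpha> + 1)"
    using \<alpha>nz by (simp_all add: s_def field_simps)
  have st: "s \<noteq> t" using ts(2) tnz \<alpha>nz by auto
  have s\<alpha>: "(t + s) / (t - s) = \<i> * of_real \<alpha>"
    unfolding ts using tnz \<alpha>nz by simp
  \<comment> \<open>This direction is normal to the curve \<open>\<phi>\<^sub>1 (r z)\<close> at \<open>s\<close>, so the functional is maximal there.\<close>
  define m where "m = cnj (\<psi> s)"
  have m0: "m \<noteq> 0"
    using convex_univalent_deriv_nonzero[OF \<phi>\<^sub>1, of "of_real r * s"] ns r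
    by (auto simp: m_def \<psi>_def norm_mult)
  define y where "y z = Re (m * (\<i> * \<psi> z))" for z
  have max: "Re (m * \<phi>\<^sub>1 (of_real r * z)) \<le> Re (m * \<phi>\<^sub>1 (of_real r * s))" if "norm z = 1" for z
    using convex_univalent_supporting_line[OF \<phi>\<^sub>1, of "of_real r * z" "of_real r * s"] that ns r
    by (simp add: m_def \<psi>_def norm_mult right_diff_distrib)
  have cphi1: "continuous_on (sphere 0 1) (\<lambda>z. Re (m * \<phi>\<^sub>1 (of_real r * z)))"
    by (intro continuous_intros continuous_on_compose2[OF K1(6)]) (use r in \<open>auto simp: norm_mult\<close>)
  obtain z1 where z1: "norm z1 = 1"
      and min: "\<And>z. norm z = 1 \<Longrightarrow> Re (m * \<phi>\<^sub>1 (of_real r * z1)) \<le> Re (m * \<phi>\<^sub>1 (of_real r * z))"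
    using continuous_attains_inf[OF compact_sphere _ cphi1] by auto
  note nonconst = convex_univalent_functional_nonconstant[OF \<phi>\<^sub>1 r m0]
  have z1s: "z1 \<noteq> s"
  proof
    assume "z1 = s"
    then have "Re (m * \<phi>\<^sub>1 (of_real r * z)) = Re (m * \<phi>\<^sub>1 (of_real r * s))" if "norm z = 1" for z
      using max[OF that] min[OF that, unfolded \<open>z1 = s\<close>] by linarith
    then show False using nonconst by blast
  qed
  have mono: "orientation z1 z s * y z \<ge> 0" if "norm z = 1" "z \<noteq> z1" "z \<noteq> s" for z
    using convex_univalent_monotone_arc[OF \<phi>\<^sub>1 _ _ z1s z1 ns _ r min max, of z] that
    by (simp add: y_def \<psi>_def)
  define C where "C z = kernel t z - \<i> * of_real \<alpha> * (\<phi> (\<zeta> / z) - \<phi> (\<zeta> / t))" for z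
  define w where "w z = 4 / ((norm (t - s))\<^sup>2 * (norm (t - z))\<^sup>2)" for z
  have C: "Re (\<kappa> * C z) = Im (\<kappa> * (\<phi> (\<zeta> / z) - \<phi> (\<zeta> / t))) * (orientation t s z * w z)"
    if z: "norm z = 1" "z \<noteq> t" for \<kappa> z
  proof -
    have "C z = (\<phi> (\<zeta> / z) - \<phi> (\<zeta> / t)) * ((t + z) / (t - z) - (t + s) / (t - s))"
      unfolding C_def s\<alpha> using kernel_eq[of z t] z t by (simp add: algebra_simps)
    also have "(t + z) / (t - z) - (t + s) / (t - s) = - \<i> * of_real (orientation t s z * w z)"
      using kernel_difference_on_circle[OF t ns z(1)] st z(2) by (simp add: w_def)
    finally have "\<kappa> * C z = \<kappa> * (\<phi> (\<zeta> / z) - \<phi> (\<zeta> / t)) * (- \<i> * of_real (orientation t s z * w z))"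
      by (simp only: mult.assoc)
    moreover have "Re (X * (- \<i> * of_real x)) = Im X * x" for X x by simp
    ultimately show ?thesis by presburger
  qed
  have wpos: "w z > 0" if "z \<noteq> t" for z using that st by (simp add: w_def)
  have n\<zeta>: "norm (\<zeta> / z) = norm \<zeta>" if "norm z = 1" for z using that by (simp add: norm_divide)
  have noncol: "orientation (\<phi> (\<zeta> / a)) (\<phi> (\<zeta> / b)) (\<phi> (\<zeta> / c)) \<noteq> 0"
    if "a \<noteq> b" "b \<noteq> c" "a \<noteq> c" "norm a = 1" "norm b = 1" "norm c = 1" for a b c
  proof -
    have "a \<noteq> 0" "b \<noteq> 0" "c \<noteq> 0" using that by auto
    then show ?thesis
      by (intro convex_univalent_not_collinear[OF \<phi>, where r="norm \<zeta>"])
        (use that \<zeta> in \<open>auto simp: norm_divide field_simps\<close>)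
  qed
  have "\<exists>\<kappa> \<epsilon> E. finite E \<and> t \<in> E \<and> (\<forall>z. norm z = 1 \<longrightarrow> z \<notin> E \<longrightarrow>
      \<epsilon> * (Im (\<kappa> * (\<phi> (\<zeta> / z) - \<phi> (\<zeta> / t))) * orientation t s z * y z) \<ge> 0 \<and>
      (\<epsilon> * (Im (\<kappa> * (\<phi> (\<zeta> / z) - \<phi> (\<zeta> / t))) * orientation t s z * y z) = 0 \<longrightarrow> y z = 0))"
  proof (cases "z1 = t")
    case True
    define a where "a = \<zeta> / t"
    \<comment> \<open>The chord through \<open>\<phi> (\<zeta> / t)\<close> and \<open>\<phi> (\<zeta> / z1)\<close> degenerates to the tangent.  Another point of the
      curve on the tangent is not excluded at this stage; there is at most one, and it is put into \<open>E\<close>.\<close>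
    define \<kappa> where "\<kappa> = - \<i> * cnj (a * deriv \<phi> a)"
    define S where "S z = Im (\<kappa> * (\<phi> (\<zeta> / z) - \<phi> (\<zeta> / t)))" for z
    define A where "A = {z. norm z = 1 \<and> z \<noteq> t \<and> S z = 0}"
    have "a \<noteq> 0" "norm a < 1" using \<zeta> tnz n\<zeta>[OF t] by (auto simp: a_def)
    then have \<kappa>0: "\<kappa> \<noteq> 0"
      using convex_univalent_deriv_nonzero[OF \<phi>, of a] by (simp add: \<kappa>_def)
    have "u = v" if "u \<in> A" "v \<in> A" for u v
    proof (rule ccontr)
      assume "u \<noteq> v"
      then have "orientation (\<phi> (\<zeta> / t)) (\<phi> (\<zeta> / u)) (\<phi> (\<zeta> / v)) \<noteq> 0"
        using that t by (intro noncol) (auto simp: A_def)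
      moreover have "Im (cnj (\<phi> (\<zeta> / u) - \<phi> (\<zeta> / t)) * (\<phi> (\<zeta> / v) - \<phi> (\<zeta> / t))) = 0"
        using that unfolding A_def S_def by (intro parallel_of_common_normal[OF \<kappa>0]) blast+
      ultimately show False by (simp add: orientation_def)
    qed
    then have "finite A"
    proof (cases "A = {}")
      case False
      then obtain u where "u \<in> A" by blast
      with \<open>\<And>u v. u \<in> A \<Longrightarrow> v \<in> A \<Longrightarrow> u = v\<close> have "A \<subseteq> {u}" by blast
      then show ?thesis using finite_subset by blast
    qed simp
    moreover have "(-1) * (S z * orientation t s z * y z) \<ge> 0 \<and>
        ((-1) * (S z * orientation t s z * y z) = 0 \<longrightarrow> y z = 0)"
      if z: "norm z = 1" "z \<notin> {t, s} \<union> A" for z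
    proof -
      have "S z = - Re (cnj (a * deriv \<phi> a) * (\<phi> (\<zeta> / z) - \<phi> a))"
      proof -
        have rot: "Im (- \<i> * X * Y) = - Re (X * Y)" for X Y by simp
        show ?thesis unfolding S_def \<kappa>_def rot a_def ..
      qed
      moreover have "Re (cnj (a * deriv \<phi> a) * (\<phi> (\<zeta> / z) - \<phi> a)) \<le> 0"
        by (rule convex_univalent_supporting_line[OF \<phi>])
          (use n\<zeta>[OF t] n\<zeta>[OF z(1)] \<zeta> in \<open>auto simp: a_def\<close>)
      ultimately have "S z \<ge> 0" by linarith
      moreover have "S z \<noteq> 0" using z by (auto simp: A_def)
      moreover have "orientation t s z \<noteq> 0"
        using z st by (intro orientation_nonzero_on_circle t ns) auto
      moreover have "- (orientation t s z * y z) \<ge> 0"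
        using mono[of z] z True orientation_flip[of t z s] by auto
      ultimately show ?thesis
        by (simp add: mult.assoc mult_le_0_iff)
    qed
    ultimately show ?thesis unfolding S_def
      by (intro exI[of _ \<kappa>] exI[of _ "-1"] exI[of _ "{t, s} \<union> A"]) auto
  next
    case False
    define e where "e = \<zeta> / of_real (norm \<zeta>)"
    have ne: "norm e = 1" using \<zeta> by (simp add: e_def norm_divide)
    have e: "of_real (norm \<zeta>) * (e / z) = \<zeta> / z" for z using \<zeta> by (simp add: e_def)
    have neu: "norm (e / z) = 1" if "norm z = 1" for z using that ne by (simp add: norm_divide)
    have or: "orientation (\<phi> (\<zeta> / a)) (\<phi> (\<zeta> / b)) (\<phi> (\<zeta> / c)) * orientation a b c < 0"
      if "a \<noteq> b" "b \<noteq> c" "a \<noteq> c" "norm a = 1" "norm b = 1" "norm c = 1" for a b c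
    proof -
      have nz: "a \<noteq> 0" "b \<noteq> 0" "c \<noteq> 0" "e \<noteq> 0" using that ne by auto
      have d: "e / a \<noteq> e / b" "e / b \<noteq> e / c" "e / a \<noteq> e / c"
        using nz that by (auto simp: divide_simps)
      show ?thesis
        using convex_univalent_orientation_preserving[OF \<phi> d neu[OF that(4)] neu[OF that(5)] neu[OF that(6)], of "norm \<zeta>"]
        unfolding e using \<zeta> orientation_reciprocal_on_circle[OF that(4-6), of e] ne by simp
    qed
    define \<kappa> where "\<kappa> = cnj (\<phi> (\<zeta> / z1) - \<phi> (\<zeta> / t))"
    define S where "S z = Im (\<kappa> * (\<phi> (\<zeta> / z) - \<phi> (\<zeta> / t)))" for z
    define Or where "Or = orientation t z1 s"
    have Or0: "Or \<noteq> 0" unfolding Or_def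
      by (rule orientation_nonzero_on_circle) (use t z1 ns False z1s st in auto)
    have "Or * (S z * orientation t s z * y z) \<ge> 0 \<and>
        (Or * (S z * orientation t s z * y z) = 0 \<longrightarrow> y z = 0)"
      if z: "norm z = 1" "z \<notin> {t, s, z1}" for z
    proof -
      have 1: "S z * orientation t z1 z < 0"
        using or[of t z1 z] z t z1 False by (auto simp: S_def \<kappa>_def orientation_def)
      have 2: "orientation z1 z s * y z \<ge> 0" using mono z by auto
      have 3: "orientation t z1 z * orientation z1 z s * orientation t s z * Or < 0"
        using orientation_product_on_circle[OF t z1 ns z(1)] z False z1s st
          orientation_flip[of z1 s z] orientation_swap[of s t z]
        by (auto simp: Or_def)
      have "(Or * (S z * orientation t s z * y z)) * (orientation t z1 z * orientation z1 z s)\<^sup>2 =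
          (orientation t z1 z * orientation z1 z s * orientation t s z * Or) *
          (S z * orientation t z1 z) * (orientation z1 z s * y z)"
        by (simp add: power2_eq_square)
      also have "\<dots> \<ge> 0"
        using mult_nonneg_nonneg[OF mult_nonpos_nonpos[OF less_imp_le[OF 3] less_imp_le[OF 1]] 2] .
      finally have "(Or * (S z * orientation t s z * y z)) * (orientation t z1 z * orientation z1 z s)\<^sup>2 \<ge> 0" .
      moreover have "(orientation t z1 z * orientation z1 z s)\<^sup>2 > 0" using 3 by auto
      ultimately have "Or * (S z * orientation t s z * y z) \<ge> 0" by (simp add: zero_le_mult_iff)
      moreover have "S z \<noteq> 0" "orientation t s z \<noteq> 0" using 1 3 by auto
      ultimately show ?thesis using Or0 by simp
    qed
    then show ?thesis unfolding S_def
      by (intro exI[of _ \<kappa>] exI[of _ Or] exI[of _ "{t, s, z1}"]) auto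
  qed
  then obtain \<kappa> \<epsilon> E where E: "finite E" "t \<in> E"
    and sign: "\<And>z. norm z = 1 \<Longrightarrow> z \<notin> E \<Longrightarrow>
      \<epsilon> * (Im (\<kappa> * (\<phi> (\<zeta> / z) - \<phi> (\<zeta> / t))) * orientation t s z * y z) \<ge> 0"
    and sign0: "\<And>z. norm z = 1 \<Longrightarrow> z \<notin> E \<Longrightarrow>
      \<epsilon> * (Im (\<kappa> * (\<phi> (\<zeta> / z) - \<phi> (\<zeta> / t))) * orientation t s z * y z) = 0 \<Longrightarrow> y z = 0"
    by blast
  define P where "P z = \<epsilon> * (Re (\<kappa> * C z) * y z)" for z
  have Peq: "P z = \<epsilon> * (Im (\<kappa> * (\<phi> (\<zeta> / z) - \<phi> (\<zeta> / t))) * orientation t s z * y z) * w z"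
    if "norm z = 1" "z \<notin> E" for z
    using C[of z \<kappa>] that E(2) by (auto simp: P_def mult_ac)
  have cy: "continuous_on (sphere 0 1) y"
    unfolding y_def by (intro continuous_intros \<psi>_continuous)
  have cC: "continuous_on (sphere 0 1) C"
    unfolding C_def
    by (intro continuous_intros continuous_on_kernel_circle continuous_on_\<phi>_circle) (use t in auto)
  have y0: "y z = 0" if "norm z = 1" for z
  proof (rule circle_integral_zero_sign[where P = P, OF _ cy E(1) _ _ _ that])
    show "continuous_on (sphere 0 1) P"
      unfolding P_def by (intro continuous_intros cy cC)
    show "P z \<ge> 0" if "norm z = 1" "z \<notin> E" for z
    proof -
      have "w z > 0" using wpos[of z] E that by auto
      then show ?thesis unfolding Peq[OF that] by (rule mult_nonneg_nonneg[OF sign[OF that] less_imp_le])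
    qed
    show "y z = 0" if "norm z = 1" "z \<notin> E" "P z = 0" for z
    proof -
      have "w z > 0" using wpos[of z] E that by auto
      then show ?thesis using sign0[OF that(1,2)] that by (simp add: Peq)
    qed
    have "integral {0..2 * pi} (\<lambda>\<theta>. Re (\<kappa> * C (cis \<theta>)) * y (cis \<theta>)) = 0"
      using boundary_orthogonality[OF t eq, of \<kappa> "m * \<i>"]
      unfolding C_def[symmetric] y_def by (simp only: mult.assoc)
    then show "integral {0..2 * pi} (\<lambda>\<theta>. P (cis \<theta>)) = 0" unfolding P_def by simp
  qed
  define Y where "Y \<theta> = Re (m * \<phi>\<^sub>1 (of_real r * cis \<theta>))" for \<theta>
  have "(Y has_real_derivative 0) (at \<theta>)" for \<theta>
  proof -
    have in1: "of_real r * cis \<theta> \<in> unit_disc" using r by (simp add: norm_mult)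
    have "((\<lambda>\<theta>. of_real r * cis \<theta>) has_vector_derivative of_real r * (\<i> * cis \<theta>)) (at \<theta>)"
      unfolding has_vector_derivative_def
      by (auto intro!: derivative_eq_intros simp: scaleR_conv_of_real mult_ac)
    from field_vector_diff_chain_at[OF this holomorphic_derivI[OF K1(1) open_ball in1]]
    have "((\<lambda>\<theta>. m * \<phi>\<^sub>1 (of_real r * cis \<theta>)) has_vector_derivative m * (\<i> * \<psi> (cis \<theta>))) (at \<theta>)"
      by (intro has_vector_derivative_mult_right) (simp add: o_def \<psi>_def mult_ac)
    from has_field_derivative_Re[OF this] show ?thesis
      using y0[of "cis \<theta>"] by (simp add: Y_def[abs_def] y_def)
  qed
  then have const: "Y \<theta> = Y 0" for \<theta> using DERIV_isconst_all[of Y] by blast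
  have "\<forall>z. norm z = 1 \<longrightarrow> Re (m * \<phi>\<^sub>1 (of_real r * z)) = Y 0"
  proof (intro allI impI)
    fix z :: complex assume "norm z = 1"
    then obtain \<theta> where "z = cis \<theta>" using circle_angle by blast
    then show "Re (m * \<phi>\<^sub>1 (of_real r * z)) = Y 0" using const[of \<theta>] by (simp add: Y_def)
  qed
  with nonconst show False by blast
qed

lemma kernel_pairing_outside:
  assumes t: "norm t > 1"
  shows "kernel_pairing t = circle_mean (\<lambda>z. \<phi> (\<zeta> / z) * \<psi> z * ((t + z) / (t - z)))"
proof -
  define R where "R = min (norm t) (1 / r)"
  have R: "R > 1" using t inverse_radius_gt_1 by (simp add: R_def)
  have hol: "(\<lambda>z. \<psi> z * ((t + z) / (t - z))) holomorphic_on ball 0 R"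
    by (intro holomorphic_intros holomorphic_on_subset[OF \<psi>_holomorphic]) (auto simp: R_def)
  have m0: "circle_mean (\<lambda>z. \<psi> z * ((t + z) / (t - z))) = 0"
    using circle_mean_holomorphic[OF hol R] by (simp add: \<psi>_def)
  have ck: "continuous_on (sphere 0 1) (\<lambda>z. (t + z) / (t - z))"
    using t by (intro continuous_intros) auto
  have "kernel_pairing t = circle_mean (\<lambda>z. \<phi> (\<zeta> / z) * \<psi> z * ((t + z) / (t - z)) - \<phi> (\<zeta> / t) * (\<psi> z * ((t + z) / (t - z))))"
    unfolding kernel_pairing_def
  proof (rule circle_mean_cong)
    fix z :: complex assume "norm z = 1"
    then have "kernel t z = (\<phi> (\<zeta> / z) - \<phi> (\<zeta> / t)) * ((t + z) / (t - z))"
      using t by (intro kernel_eq) auto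
    then show "kernel t z * \<psi> z = \<phi> (\<zeta> / z) * \<psi> z * ((t + z) / (t - z)) - \<phi> (\<zeta> / t) * (\<psi> z * ((t + z) / (t - z)))"
      by (simp only: left_diff_distrib mult.assoc mult.commute[of "\<psi> z"])
  qed
  also have "\<dots> = circle_mean (\<lambda>z. \<phi> (\<zeta> / z) * \<psi> z * ((t + z) / (t - z))) -
      circle_mean (\<lambda>z. \<phi> (\<zeta> / t) * (\<psi> z * ((t + z) / (t - z))))"
    by (intro circle_mean_diff continuous_on_mult ck continuous_on_\<phi>_circle \<psi>_continuous continuous_on_const)
  finally show ?thesis by (simp only: circle_mean_cmult m0) simp
qed

text \<open>For \<open>T > 1\<close> the Schwarz formula on the circle of radius \<open>T\<close> may be inserted into the mean and the
  order of integration exchanged.  The resulting mean over \<open>T * s\<close> does not depend on \<open>T\<close> and is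
  continuous up to \<open>T = 1\<close>.\<close>
lemma circle_mean_against_F:
  assumes F: "F holomorphic_on ball 0 (1 / r)"
  shows "circle_mean (\<lambda>z. \<phi> (\<zeta> / z) * \<psi> z * F z) =
    \<i> * of_real (Im (F 0)) * starlike_pairing + circle_mean (\<lambda>s. of_real (Re (F s)) * kernel_pairing s)"
proof -
  define J where "J T = circle_mean (\<lambda>s. of_real (Re (F (of_real T * s))) * kernel_pairing (of_real T * s))" for T :: real
  note cont = continuous_on_\<phi>_circle \<psi>_continuous
  have cF: "continuous_on (ball 0 (1 / r)) F" by (rule holomorphic_on_imp_continuous_on[OF F])
  have cF1: "continuous_on (sphere 0 1) F"
    by (rule continuous_on_subset[OF cF]) (use inverse_radius_gt_1 in auto)
  define L where "L = circle_mean (\<lambda>z. \<phi> (\<zeta> / z) * \<psi> z * F z)"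
  have JT: "J T = L - \<i> * of_real (Im (F 0)) * starlike_pairing" if T: "1 < T" "T < 1 / r" for T
  proof -
    define k where "k z s = (of_real T * s + z) / (of_real T * s - z)" for z s :: complex
    have Ts: "norm (of_real T * s) = T" if "norm s = 1" for s :: complex
      using that T by (simp add: norm_mult)
    have ne: "of_real T * s - z \<noteq> 0" if "norm s = 1" "norm z = 1" for s z :: complex
      using Ts[of s] that T by auto
    have rep: "F z = \<i> * of_real (Im (F 0)) + circle_mean (\<lambda>s. of_real (Re (F (of_real T * s))) * k z s)"
      if z: "norm z = 1" for z
    proof -
      have "(\<lambda>s. F (of_real T * s)) holomorphic_on ball 0 (1 / (r * T))"
        by (rule holomorphic_on_compose_gen[OF _ F, of "\<lambda>s. of_real T * s", unfolded o_def])
          (use r T in \<open>auto intro!: holomorphic_intros simp: norm_mult field_simps\<close>)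
      moreover have "1 / (r * T) > 1" using r T by (simp add: field_simps)
      moreover have "norm (z / of_real T) < 1" using z T by (simp add: norm_divide)
      ultimately have "F (of_real T * (z / of_real T)) = \<i> * of_real (Im (F (of_real T * 0))) +
          circle_mean (\<lambda>s. of_real (Re (F (of_real T * s))) * ((s + z / of_real T) / (s - z / of_real T)))"
        by (rule Schwarz_integral_formula)
      also have "circle_mean (\<lambda>s. of_real (Re (F (of_real T * s))) * ((s + z / of_real T) / (s - z / of_real T))) =
          circle_mean (\<lambda>s. of_real (Re (F (of_real T * s))) * k z s)"
      proof (rule circle_mean_cong)
        fix s :: complex
        have "(of_real T * (s + z / of_real T)) / (of_real T * (s - z / of_real T)) = k z s"
          using T by (simp add: k_def distrib_left right_diff_distrib)
        moreover have "(of_real T * (s + z / of_real T)) / (of_real T * (s - z / of_real T)) =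
            (s + z / of_real T) / (s - z / of_real T)"
          using T by (intro mult_divide_mult_cancel_left) auto
        ultimately show "of_real (Re (F (of_real T * s))) * ((s + z / of_real T) / (s - z / of_real T)) =
            of_real (Re (F (of_real T * s))) * k z s" by simp
      qed
      finally show ?thesis using T by simp
    qed
    have cFT: "continuous_on (sphere 0 1 \<times> sphere 0 1) (\<lambda>p. F (of_real T * snd p))"
    proof (rule continuous_on_compose2[OF cF])
      show "continuous_on (sphere 0 1 \<times> sphere 0 1) (\<lambda>p. of_real T * snd p :: complex)"
        by (intro continuous_intros)
    qed (use T Ts in auto)
    have cj: "continuous_on (sphere 0 1 \<times> sphere 0 1)
        (\<lambda>(z, s). \<phi> (\<zeta> / z) * \<psi> z * (of_real (Re (F (of_real T * s))) * k z s))"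
    proof -
      have "continuous_on (sphere 0 1 \<times> sphere 0 1) (\<lambda>p. \<phi> (\<zeta> / fst p))"
        by (rule continuous_on_compose2[OF continuous_on_\<phi>_circle]) (auto intro: continuous_on_fst continuous_on_id)
      moreover have "continuous_on (sphere 0 1 \<times> sphere 0 1) (\<lambda>p. \<psi> (fst p))"
        by (rule continuous_on_compose2[OF \<psi>_continuous]) (auto intro: continuous_on_fst continuous_on_id)
      moreover have "continuous_on (sphere 0 1 \<times> sphere 0 1) (\<lambda>p. k (fst p) (snd p))"
        unfolding k_def using ne by (intro continuous_intros) auto
      ultimately show ?thesis
        unfolding case_prod_unfold using cFT by (intro continuous_intros)
    qed
    have "circle_mean (\<lambda>z. \<phi> (\<zeta> / z) * \<psi> z * circle_mean (\<lambda>s. of_real (Re (F (of_real T * s))) * k z s)) =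
        circle_mean (\<lambda>z. circle_mean (\<lambda>s. \<phi> (\<zeta> / z) * \<psi> z * (of_real (Re (F (of_real T * s))) * k z s)))"
      by (simp only: circle_mean_cmult)
    also have "\<dots> = circle_mean (\<lambda>s. circle_mean (\<lambda>z. \<phi> (\<zeta> / z) * \<psi> z * (of_real (Re (F (of_real T * s))) * k z s)))"
      by (rule circle_mean_swap[OF cj])
    also have "\<dots> = J T"
      unfolding J_def
    proof (rule circle_mean_cong)
      fix s :: complex assume s: "norm s = 1"
      have "circle_mean (\<lambda>z. \<phi> (\<zeta> / z) * \<psi> z * (of_real (Re (F (of_real T * s))) * k z s)) =
          circle_mean (\<lambda>z. of_real (Re (F (of_real T * s))) * (\<phi> (\<zeta> / z) * \<psi> z * k z s))"
        by (rule circle_mean_cong) (simp only: mult_ac)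
      also have "\<dots> = of_real (Re (F (of_real T * s))) * kernel_pairing (of_real T * s)"
        using kernel_pairing_outside[of "of_real T * s"] Ts[OF s] T unfolding circle_mean_cmult k_def by simp
      finally show "circle_mean (\<lambda>z. \<phi> (\<zeta> / z) * \<psi> z * (of_real (Re (F (of_real T * s))) * k z s)) =
          of_real (Re (F (of_real T * s))) * kernel_pairing (of_real T * s)" .
    qed
    finally have "J T = circle_mean (\<lambda>z. \<phi> (\<zeta> / z) * \<psi> z * circle_mean (\<lambda>s. of_real (Re (F (of_real T * s))) * k z s))"
      by simp
    also have "\<dots> = circle_mean (\<lambda>z. \<phi> (\<zeta> / z) * \<psi> z * F z - \<i> * of_real (Im (F 0)) * (\<phi> (\<zeta> / z) * \<psi> z))"
    proof (rule circle_mean_cong)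
      fix z :: complex assume "norm z = 1"
      then have r': "circle_mean (\<lambda>s. of_real (Re (F (of_real T * s))) * k z s) = F z - \<i> * of_real (Im (F 0))"
        using rep[of z] by (metis add_diff_cancel_left')
      show "\<phi> (\<zeta> / z) * \<psi> z * circle_mean (\<lambda>s. of_real (Re (F (of_real T * s))) * k z s) =
        \<phi> (\<zeta> / z) * \<psi> z * F z - \<i> * of_real (Im (F 0)) * (\<phi> (\<zeta> / z) * \<psi> z)"
        unfolding r' by (simp only: right_diff_distrib mult_ac)
    qed
    also have "\<dots> = L - \<i> * of_real (Im (F 0)) * starlike_pairing"
      unfolding L_def starlike_pairing_def circle_mean_cmult[symmetric]
      by (intro circle_mean_diff continuous_on_mult continuous_on_const cont cF1)
    finally show ?thesis .
  qed
  obtain T1 where T1: "1 < T1" "T1 < 1 / r" using inverse_radius_gt_1 dense by blast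
  have cJ: "continuous_on {1..T1} J"
    unfolding J_def
  proof (rule circle_mean_continuous_on_param)
    have Ts: "norm (of_real T * s) = T" if "norm s = 1" "T \<ge> 1" for s :: complex and T :: real
      using that by (simp add: norm_mult)
    have "continuous_on ({1..T1} \<times> sphere 0 1) (\<lambda>p. of_real (fst p) * snd p :: complex)"
      by (intro continuous_intros)
    note scale = this
    have "continuous_on ({1..T1} \<times> sphere 0 1) (\<lambda>p. F (of_real (fst p) * snd p))"
      by (rule continuous_on_compose2[OF cF scale]) (use T1 in \<open>auto simp: Ts\<close>)
    moreover have "continuous_on ({1..T1} \<times> sphere 0 1) (\<lambda>p. kernel_pairing (of_real (fst p) * snd p))"
      by (rule continuous_on_compose2[OF continuous_on_kernel_pairing scale]) (auto simp: Ts)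
    ultimately show "continuous_on ({1..T1} \<times> sphere 0 1)
        (\<lambda>(T, s). of_real (Re (F (of_real T * s))) * kernel_pairing (of_real T * s))"
      unfolding case_prod_unfold by (intro continuous_intros)
  qed
  have "J 1 = L - \<i> * of_real (Im (F 0)) * starlike_pairing"
  proof (rule continuous_constant_on_closure[where S = "{1<..<T1}" and f = J and x = 1])
    show "1 \<in> closure {1<..<T1}" using T1 by (simp add: closure_greaterThanLessThan)
  qed (use JT T1 cJ in \<open>auto simp: closure_greaterThanLessThan\<close>)
  then show ?thesis by (simp add: J_def L_def)
qed

text \<open>On the unit circle \<open>Re (kernel_pairing t / starlike_pairing)\<close> never vanishes, so it has one sign; it is
  positive because its mean is \<open>1\<close>, as the case \<open>F = 1\<close> shows.  Averaging it against \<open>Re F\<close> gives the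
  claim.\<close>
lemma convolution_positivity_circle:
  assumes F: "F holomorphic_on ball 0 (1 / r)" and pos: "\<And>z. z \<in> ball 0 (1 / r) \<Longrightarrow> Re (F z) > 0"
    and D0: "starlike_pairing \<noteq> 0"
  shows "Re (circle_mean (\<lambda>z. \<phi> (\<zeta> / z) * \<psi> z * F z) / starlike_pairing) > 0"
proof -
  define q where "q t = Re (kernel_pairing t / starlike_pairing)" for t
  have cN: "continuous_on (sphere 0 1) kernel_pairing" by (rule continuous_on_subset[OF continuous_on_kernel_pairing]) auto
  have cq: "continuous_on (sphere 0 1) q"
    unfolding q_def by (intro continuous_intros cN) (use D0 in auto)
  have q0: "q t \<noteq> 0" if "norm t = 1" for t
  proof
    assume "q t = 0"
    then have "kernel_pairing t / starlike_pairing = \<i> * of_real (Im (kernel_pairing t / starlike_pairing))" by (simp add: q_def complex_eq_iff)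
    then have "kernel_pairing t = \<i> * of_real (Im (kernel_pairing t / starlike_pairing)) * starlike_pairing" using D0 by (simp add: field_simps)
    then show False using kernel_pairing_not_imaginary[OF that] by blast
  qed
  have cF: "continuous_on (sphere 0 1) F"
    by (rule holomorphic_on_imp_continuous_on[OF holomorphic_on_subset[OF F]]) (use inverse_radius_gt_1 in auto)
  have "circle_mean kernel_pairing = starlike_pairing"
    using circle_mean_against_F[of "\<lambda>_. 1"] by (simp add: starlike_pairing_def)
  then have "circle_mean (\<lambda>s. (1 / starlike_pairing) * kernel_pairing s) = 1"
    using D0 by (simp only: circle_mean_cmult) simp
  then have "1 = Re (circle_mean (\<lambda>s. (1 / starlike_pairing) * kernel_pairing s))" by simp
  also have "\<dots> = integral {0..2 * pi} (\<lambda>\<theta>. q (cis \<theta>)) / (2 * pi)"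
    by (subst Re_circle_mean) (intro continuous_intros cN, simp add: q_def)
  finally have qint: "integral {0..2 * pi} (\<lambda>\<theta>. q (cis \<theta>)) = 2 * pi" by simp
  have "connected (q ` sphere 0 1)"
    by (intro connected_continuous_image cq connected_sphere) simp
  have qpos: "q t > 0" if "norm t = 1" for t
  proof (rule ccontr)
    assume "\<not> q t > 0"
    then have "q t < 0" using q0[OF that] by simp
    have "q s < 0" if "norm s = 1" for s
    proof (rule ccontr)
      assume "\<not> q s < 0"
      then have "0 \<in> q ` sphere 0 1"
        using connectedD_interval[OF \<open>connected (q ` sphere 0 1)\<close>, of "q t" "q s" 0] \<open>q t < 0\<close> that \<open>norm t = 1\<close>
        by auto
      then show False using q0 by auto
    qed
    then have "integral {0..2 * pi} (\<lambda>\<theta>. q (cis \<theta>)) \<le> 0"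
      using integral_le[OF circle_integrable[OF cq], of "\<lambda>_. 0"] by (auto simp: less_imp_le)
    with qint show False using pi_gt_zero by linarith
  qed
  have int0: "integral {0..2 * pi} (\<lambda>\<theta>. Re (F (cis \<theta>)) * q (cis \<theta>)) > 0"
  proof -
    have pos': "Re (F z) * q z > 0" if "norm z = 1" for z
      using pos[of z] qpos[OF that] that inverse_radius_gt_1 by simp
    have c: "continuous_on {0..2 * pi} (\<lambda>\<theta>. Re (F (cis \<theta>)) * q (cis \<theta>))"
      by (intro continuous_intros continuous_on_circle_param cF cq)
    have "integral {0..2 * pi} (\<lambda>\<theta>. Re (F (cis \<theta>)) * q (cis \<theta>)) \<ge> 0"
      using pos' by (intro integral_nonneg integrable_continuous_interval c) (auto intro: less_imp_le)
    moreover have "integral {0..2 * pi} (\<lambda>\<theta>. Re (F (cis \<theta>)) * q (cis \<theta>)) \<noteq> 0"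
    proof
      assume 0: "integral {0..2 * pi} (\<lambda>\<theta>. Re (F (cis \<theta>)) * q (cis \<theta>)) = 0"
      have "\<forall>\<theta>\<in>cbox 0 (2 * pi). Re (F (cis \<theta>)) * q (cis \<theta>) = 0"
      proof (rule integral_cbox_eq_0_iff[THEN iffD1])
        show "Re (F (cis \<theta>)) * q (cis \<theta>) \<ge> 0" for \<theta>
          using pos'[of "cis \<theta>"] by simp
      qed (use c 0 pi_gt_zero in \<open>auto simp: cbox_interval not_le\<close>)
      then show False using pos'[of "cis 0"] pi_gt_zero by (force simp: cbox_interval)
    qed
    ultimately show ?thesis by linarith
  qed
  have "circle_mean (\<lambda>z. \<phi> (\<zeta> / z) * \<psi> z * F z) / starlike_pairing =
      \<i> * of_real (Im (F 0)) + (1 / starlike_pairing) * circle_mean (\<lambda>s. of_real (Re (F s)) * kernel_pairing s)"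
    unfolding circle_mean_against_F[OF F] using D0 by (simp add: field_simps)
  also have "(1 / starlike_pairing) * circle_mean (\<lambda>s. of_real (Re (F s)) * kernel_pairing s) =
      circle_mean (\<lambda>s. of_real (Re (F s)) * (kernel_pairing s / starlike_pairing))"
    unfolding circle_mean_cmult[symmetric] by simp
  finally have "Re (circle_mean (\<lambda>z. \<phi> (\<zeta> / z) * \<psi> z * F z) / starlike_pairing) =
      Re (circle_mean (\<lambda>s. of_real (Re (F s)) * (kernel_pairing s / starlike_pairing)))" by simp
  also have "\<dots> = integral {0..2 * pi} (\<lambda>\<theta>. Re (F (cis \<theta>)) * q (cis \<theta>)) / (2 * pi)"
  proof (subst Re_circle_mean)
    show "continuous_on (sphere 0 1) (\<lambda>s. of_real (Re (F s)) * (kernel_pairing s / starlike_pairing))"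
      by (intro continuous_intros cF cN) (use D0 in auto)
    have "Re (of_real x * w) = x * Re w" for x w by simp
    then show "integral {0..2 * pi} (\<lambda>\<theta>. Re (of_real (Re (F (cis \<theta>))) * (kernel_pairing (cis \<theta>) / starlike_pairing))) / (2 * pi) =
        integral {0..2 * pi} (\<lambda>\<theta>. Re (F (cis \<theta>)) * q (cis \<theta>)) / (2 * pi)"
      by (simp only: q_def)
  qed
  finally show ?thesis using int0 by simp
qed

end

text \<open>The half-plane case of the theorem of Ruscheweyh and Sheil-Small.\<close>
theorem convolution_positivity:
  assumes \<phi>: "\<phi> \<in> convex_univalent" and \<phi>\<^sub>1: "\<phi>\<^sub>1 \<in> convex_univalent"
    and p: "p holomorphic_on unit_disc" "\<And>z. z \<in> unit_disc \<Longrightarrow> Re (p z) > 0"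
    and x: "x \<in> unit_disc" and nz: "(\<phi> \<star> (\<lambda>z. z * deriv \<phi>\<^sub>1 z)) x \<noteq> 0"
  shows "Re ((\<phi> \<star> (\<lambda>z. z * deriv \<phi>\<^sub>1 z * p z)) x / (\<phi> \<star> (\<lambda>z. z * deriv \<phi>\<^sub>1 z)) x) > 0"
proof -
  note K = convex_univalentD[OF \<phi>] and K1 = convex_univalentD[OF \<phi>\<^sub>1]
  have dh: "deriv \<phi>\<^sub>1 holomorphic_on unit_disc"
    by (rule holomorphic_deriv[OF K1(1) open_ball])
  define r where "r = (1 + norm x) / 2"
  have r: "0 < r" "r < 1" "norm x < r"
    using x norm_ge_zero[of x] by (auto simp: r_def field_simps simp del: norm_ge_zero)
  \<comment> \<open>Now \<open>x = r * \<zeta>\<close> with both factors in the disc.\<close>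
  define \<zeta> where "\<zeta> = x / of_real r"
  have x\<zeta>: "x = of_real r * \<zeta>" using r by (simp add: \<zeta>_def)
  have n\<zeta>: "norm \<zeta> < 1" using r by (simp add: \<zeta>_def norm_divide)
  have "\<zeta> \<noteq> 0"
  proof
    assume "\<zeta> = 0"
    then have "x = 0" using x\<zeta> by simp
    then have "(\<phi> \<star> (\<lambda>z. z * deriv \<phi>\<^sub>1 z)) x = 0"
      using K(3) by (simp add: convolution_def fps_expansion_def power_0_left if_distrib cong: if_cong)
    with nz show False by simp
  qed
  then interpret convolution_setting \<phi> \<phi>\<^sub>1 \<zeta> r
    using \<phi> \<phi>\<^sub>1 n\<zeta> r by unfold_locales auto
  have h1: "(\<lambda>z. z * deriv \<phi>\<^sub>1 z) holomorphic_on unit_disc"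
    and h2: "(\<lambda>z. z * deriv \<phi>\<^sub>1 z * p z) holomorphic_on unit_disc"
    by (intro holomorphic_intros dh p)+
  have e1: "(\<phi> \<star> (\<lambda>z. z * deriv \<phi>\<^sub>1 z)) x = starlike_pairing"
    unfolding x\<zeta> convolution_circle_mean[OF K(1) h1 n\<zeta> r(1,2)] starlike_pairing_def by (simp add: \<psi>_def)
  have e2: "(\<phi> \<star> (\<lambda>z. z * deriv \<phi>\<^sub>1 z * p z)) x = circle_mean (\<lambda>z. \<phi> (\<zeta> / z) * \<psi> z * p (of_real r * z))"
    unfolding x\<zeta> convolution_circle_mean[OF K(1) h2 n\<zeta> r(1,2)] by (simp add: \<psi>_def mult_ac)
  have rz: "of_real r * z \<in> unit_disc" if "z \<in> ball 0 (1 / r)" for z :: complex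
    using that r by (simp add: norm_mult field_simps)
  have "(\<lambda>z. p (of_real r * z)) holomorphic_on ball 0 (1 / r)"
    by (rule holomorphic_on_compose_gen[OF _ p(1), of "\<lambda>z. of_real r * z", unfolded o_def])
      (use rz in \<open>auto intro!: holomorphic_intros\<close>)
  then show ?thesis unfolding e1 e2
    by (rule convolution_positivity_circle) (use rz p(2) nz e1 in auto)
qed

section \<open>Shears over vertical strips\<close>

text \<open>The Schwarz lemma for the Cayley transform of \<open>p\<close> that sends \<open>p w0\<close> to \<open>0\<close>.  It is an inequality of Harnack type: the
  oscillation of \<open>p\<close>, and not only of \<open>Re p\<close>, is controlled by \<open>Re (p w0)\<close>.\<close>
lemma Schwarz_Pick_half_radius:
  assumes p: "p holomorphic_on ball w0 R" "\<And>w. w \<in> ball w0 R \<Longrightarrow> Re (p w) > 0"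
    and R: "R > 0" and w: "dist w0 w \<le> R / 2"
  shows "norm (p w - p w0) \<le> 2 * Re (p w0)"
proof -
  define q where "q z = (p (w0 + of_real R * z) - p w0) / (p (w0 + of_real R * z) + cnj (p w0))" for z
  have inb: "w0 + of_real R * z \<in> ball w0 R" if "norm z < 1" for z
    using that R by (simp add: dist_norm norm_mult)
  have pos0: "Re (p w0) > 0" using p(2)[of w0] R by simp
  have nz: "p (w0 + of_real R * z) + cnj (p w0) \<noteq> 0" if "norm z < 1" for z
  proof -
    have "Re (p (w0 + of_real R * z) + cnj (p w0)) > 0" using p(2)[OF inb[OF that]] pos0 by simp
    then show ?thesis by force
  qed
  have "(\<lambda>z. p (w0 + of_real R * z)) holomorphic_on ball 0 1"
    by (rule holomorphic_on_compose_gen[OF _ p(1), of "\<lambda>z. w0 + of_real R * z", unfolded o_def])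
      (use inb in \<open>auto intro!: holomorphic_intros\<close>)
  then have hq: "q holomorphic_on ball 0 1"
    unfolding q_def using nz by (intro holomorphic_intros) auto
  have q1: "norm (q z) < 1" if "norm z < 1" for z
  proof -
    define a where "a = p (w0 + of_real R * z)"
    have a: "Re a > 0" using p(2)[OF inb[OF that]] by (simp add: a_def)
    have "(norm (a + cnj (p w0)))\<^sup>2 - (norm (a - p w0))\<^sup>2 = 4 * Re a * Re (p w0)"
      unfolding cmod_power2 by (simp add: power2_eq_square algebra_simps)
    then have "(norm (a - p w0))\<^sup>2 < (norm (a + cnj (p w0)))\<^sup>2"
      using mult_pos_pos[OF a pos0] by linarith
    then have "norm (a - p w0) < norm (a + cnj (p w0))"
      by (rule power2_less_imp_less) simp
    then show ?thesis using nz[OF that] by (simp add: q_def norm_divide a_def[symmetric])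
  qed
  define z where "z = (w - w0) / of_real R"
  have z: "norm z \<le> 1 / 2" using w R by (simp add: z_def norm_divide dist_norm norm_minus_commute field_simps)
  then have z1: "norm z < 1" by simp
  have wz: "w0 + of_real R * z = w" using R by (simp add: z_def)
  have "norm (q z) \<le> norm z"
    by (rule Schwarz_Lemma(1)[OF hq _ q1 z1]) (simp add: q_def)
  then have "norm (q z) \<le> 1 / 2" using z by linarith
  then have "norm (p w - p w0) \<le> norm (p w + cnj (p w0)) / 2"
    using nz[OF z1] unfolding q_def wz by (simp add: norm_divide field_simps)
  also have "norm (p w + cnj (p w0)) \<le> norm (p w - p w0) + 2 * Re (p w0)"
  proof -
    have "p w + cnj (p w0) = (p w - p w0) + of_real (2 * Re (p w0))" by (simp add: complex_eq_iff)
    then have "norm (p w + cnj (p w0)) \<le> norm (p w - p w0) + norm (of_real (2 * Re (p w0)) :: complex)"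
      using norm_triangle_ineq by metis
    then show ?thesis using pos0 by (simp del: of_real_mult)
  qed
  finally show ?thesis by simp
qed

lemma convex_real_between:
  fixes I :: "real set"
  assumes "convex I" "a \<in> I" "b \<in> I" "a \<le> t" "t \<le> b"
  shows "t \<in> I"
  using assms is_interval_convex_1[of I] unfolding is_interval_1 by blast

text \<open>A chain of discs of one radius, the same for all heights \<open>y\<close>; in each step the real part grows at most by
  the factor \<open>3\<close>.\<close>
lemma horizontal_oscillation_bound:
  assumes I: "open I" "convex I" and p: "p holomorphic_on {w. Re w \<in> I}"
      "\<And>w. Re w \<in> I \<Longrightarrow> Re (p w) > 0"
    and x: "x1 \<in> I" "x3 \<in> I" "x2 \<in> {x1..x3}"
  obtains B where "\<And>x y. x \<in> {x1..x3} \<Longrightarrow> norm (p (Complex x y) - p (Complex x2 y)) \<le> B * Re (p (Complex x2 y))"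
proof -
  obtain d1 where d1: "d1 > 0" "ball x1 d1 \<subseteq> I" using I(1) x(1) open_contains_ball by blast
  obtain d3 where d3: "d3 > 0" "ball x3 d3 \<subseteq> I" using I(1) x(2) open_contains_ball by blast
  define d where "d = min d1 d3"
  have d: "d > 0" using d1 d3 by (simp add: d_def)
  have inI: "t \<in> I" if "x \<in> {x1..x3}" "\<bar>t - x\<bar> < d" for t x
  proof -
    consider "t < x1" | "t > x3" | "x1 \<le> t" "t \<le> x3" by linarith
    then show ?thesis
    proof cases
      case 1
      then have "t \<in> ball x1 d1" using that by (auto simp: dist_real_def d_def)
      then show ?thesis using d1 by auto
    next
      case 2
      then have "t \<in> ball x3 d3" using that by (auto simp: dist_real_def d_def)
      then show ?thesis using d3 by auto
    next
      case 3
      then show ?thesis using convex_real_between[OF I(2) x(1,2)] by blast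
    qed
  qed
  have step: "norm (p (Complex x y) - p (Complex x' y)) \<le> 2 * Re (p (Complex x' y))"
    if "x' \<in> {x1..x3}" "\<bar>x - x'\<bar> \<le> d / 2" for x x' y
  proof (rule Schwarz_Pick_half_radius[where p = p and ?w0.0 = "Complex x' y", OF _ _ d])
    have sub: "ball (Complex x' y) d \<subseteq> {w. Re w \<in> I}"
    proof clarsimp
      fix w assume "dist (Complex x' y) w < d"
      then have "\<bar>Re w - x'\<bar> < d"
        using abs_Re_le_cmod[of "w - Complex x' y"] by (simp add: dist_norm norm_minus_commute)
      then show "Re w \<in> I" using inI that(1) by blast
    qed
    show "p holomorphic_on ball (Complex x' y) d" by (rule holomorphic_on_subset[OF p(1) sub])
    show "Re (p w) > 0" if "w \<in> ball (Complex x' y) d" for w using that sub p(2) by blast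
    have "Complex x' y - Complex x y = of_real (x' - x)" by (simp add: complex_eq_iff)
    then show "dist (Complex x' y) (Complex x y) \<le> d / 2"
      using that(2) abs_minus_commute[of x x'] unfolding dist_norm by (simp del: of_real_diff)
  qed
  have chain: "norm (p (Complex x y) - p (Complex x2 y)) \<le> (3 ^ n - 1) * Re (p (Complex x2 y))"
    if "x \<in> {x1..x3}" "\<bar>x - x2\<bar> \<le> real n * (d / 2)" for n x y
    using that
  proof (induction n arbitrary: x)
    case 0
    then show ?case by simp
  next
    case (Suc n)
    define t where "t = real n / real (Suc n)"
    define x' where "x' = (1 - t) * x2 + t * x"
    have t: "0 \<le> t" "t \<le> 1" by (auto simp: t_def)
    have x': "x' \<in> {x1..x3}"
      using convexD_alt[of "{x1..x3}" x2 x t] x(3) Suc.prems(1) t by (simp add: x'_def)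
    have "x' - x2 = t * (x - x2)" "x - x' = (1 - t) * (x - x2)"
      by (simp_all add: x'_def algebra_simps)
    then have split: "\<bar>x' - x2\<bar> = t * \<bar>x - x2\<bar>" "\<bar>x - x'\<bar> = (1 - t) * \<bar>x - x2\<bar>"
      using t by (simp_all add: abs_mult)
    have "\<bar>x' - x2\<bar> = t * \<bar>x - x2\<bar>" by (rule split(1))
    also have "\<dots> \<le> t * (real (Suc n) * (d / 2))" using Suc.prems(2) t by (intro mult_left_mono) auto
    also have "\<dots> = real n * (d / 2)" by (simp add: t_def)
    finally have IH: "norm (p (Complex x' y) - p (Complex x2 y)) \<le> (3 ^ n - 1) * Re (p (Complex x2 y))"
      using Suc.IH x' by blast
    have "\<bar>x - x'\<bar> = (1 - t) * \<bar>x - x2\<bar>" by (rule split(2))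
    also have "\<dots> \<le> (1 - t) * (real (Suc n) * (d / 2))" using Suc.prems(2) t by (intro mult_left_mono) auto
    also have "\<dots> = d / 2" by (simp add: t_def field_simps)
    finally have st: "norm (p (Complex x y) - p (Complex x' y)) \<le> 2 * Re (p (Complex x' y))"
      using step[OF x'] by blast
    have "Re (p (Complex x' y)) - Re (p (Complex x2 y)) \<le> norm (p (Complex x' y) - p (Complex x2 y))"
      using complex_Re_le_cmod[of "p (Complex x' y) - p (Complex x2 y)"] by simp
    then have "Re (p (Complex x' y)) \<le> 3 ^ n * Re (p (Complex x2 y))"
      using IH by (simp add: algebra_simps)
    moreover have "norm (p (Complex x y) - p (Complex x2 y)) \<le>
        norm (p (Complex x y) - p (Complex x' y)) + norm (p (Complex x' y) - p (Complex x2 y))"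
      using norm_triangle_ineq[of "p (Complex x y) - p (Complex x' y)" "p (Complex x' y) - p (Complex x2 y)"] by simp
    ultimately show ?case using st IH by (simp add: algebra_simps)
  qed
  obtain n :: nat where n: "(x3 - x1) / (d / 2) \<le> real n" using real_arch_simple by blast
  have "norm (p (Complex x y) - p (Complex x2 y)) \<le> (3 ^ n - 1) * Re (p (Complex x2 y))"
    if "x \<in> {x1..x3}" for x y
  proof (rule chain[OF that])
    have "\<bar>x - x2\<bar> \<le> x3 - x1" using that x(3) by auto
    also have "\<dots> \<le> real n * (d / 2)" using n d by (simp add: field_simps)
    finally show "\<bar>x - x2\<bar> \<le> real n * (d / 2)" .
  qed
  then show thesis using that by blast
qed

lemma bounded_increasing_small_derivative:
  fixes f :: "real \<Rightarrow> real"
  assumes f: "\<And>t. (f has_real_derivative f' t) (at t)" and bd: "\<And>t. f t < c" and e: "e > 0"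
  obtains t where "t \<ge> t0" "f' t < e"
proof (rule ccontr)
  assume "\<not> thesis"
  then have ge: "f' t \<ge> e" if "t \<ge> t0" for t using that \<open>\<And>t. t \<ge> t0 \<Longrightarrow> f' t < e \<Longrightarrow> thesis\<close> not_le by blast
  define T where "T = t0 + \<bar>c - f t0\<bar> / e + 1"
  have T: "T > t0" using e by (simp add: T_def add_nonneg_pos)
  obtain z where z: "t0 < z" "z < T" "f T - f t0 = (T - t0) * f' z"
    using MVT2[OF T, of f f'] f by blast
  have "(T - t0) * e \<le> (T - t0) * f' z" using ge[of z] z T by (intro mult_left_mono) auto
  moreover have "(T - t0) * e = \<bar>c - f t0\<bar> + e" using e by (simp add: T_def field_simps)
  ultimately have "f T \<ge> c" using z(3) e by linarith
  with bd show False using not_le by blast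
qed

locale vertical_growth =
  fixes I :: "real set" and V p :: "complex \<Rightarrow> complex"
  assumes I: "open I" "convex I"
    and V: "\<And>w. Re w \<in> I \<Longrightarrow> (V has_field_derivative p w) (at w)"
    and p_pos: "\<And>w. Re w \<in> I \<Longrightarrow> Re (p w) > 0"
begin

lemma open_strip: "open {w. Re w \<in> I}"
  using open_vimage[OF I(1), of Re] by (simp add: vimage_def continuous_on_Re continuous_on_id)

lemma V_holomorphic: "V holomorphic_on {w. Re w \<in> I}"
  using V open_strip holomorphic_on_open by blast

lemma p_holomorphic: "p holomorphic_on {w. Re w \<in> I}"
proof -
  have "deriv V holomorphic_on {w. Re w \<in> I}" by (rule holomorphic_deriv[OF V_holomorphic open_strip])
  then show ?thesis by (rule holomorphic_transform) (use V DERIV_imp_deriv in blast)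
qed

lemma Im_V_vertical:
  assumes "x \<in> I"
  shows "((\<lambda>t. \<sigma> * Im (V (Complex x (\<sigma> * t)))) has_real_derivative \<sigma>\<^sup>2 * Re (p (Complex x (\<sigma> * t)))) (at t)"
proof -
  have "((\<lambda>t. Complex x (\<sigma> * t)) has_vector_derivative \<i> * of_real \<sigma>) (at t)"
    unfolding Complex_eq by (auto intro!: derivative_eq_intros)
  from field_vector_diff_chain_at[OF this V] assms
  have "((\<lambda>t. V (Complex x (\<sigma> * t))) has_vector_derivative \<i> * of_real \<sigma> * p (Complex x (\<sigma> * t))) (at t)"
    by (simp add: o_def)
  from DERIV_cmult[OF has_field_derivative_Im[OF this], of \<sigma>] show ?thesis
    by (simp add: power2_eq_square mult_ac)
qed

lemma Im_V_strict_mono: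
  assumes "x \<in> I" "y < y'"
  shows "Im (V (Complex x y)) < Im (V (Complex x y'))"
  using DERIV_pos_imp_increasing[OF assms(2), of "\<lambda>t. Im (V (Complex x t))"]
    Im_V_vertical[OF assms(1), of 1] p_pos[of "Complex x _"] assms(1) by force

text \<open>The factor \<open>\<sigma>\<close> treats the upper and the lower end of the strip at once.  Suppose that \<open>\<sigma> * Im V\<close> stays
  below \<open>\<sigma> * c\<close> on the line over \<open>x2\<close>.  Over \<open>x1\<close> and \<open>x3\<close> it eventually exceeds that
  level by some \<open>\<delta> > 0\<close>.  But at suitable far points \<open>u = Re (p (Complex x2 \<eta>))\<close> is small, and there, by
  \<open>horizontal_oscillation_bound\<close>, \<open>Im V\<close> is affine in \<open>x\<close> up to an error of order \<open>u\<close>; an affine function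
  cannot be larger at both ends than in between.\<close>
lemma level_between_one_side:
  assumes x: "x1 < x2" "x2 < x3" "x1 \<in> I" "x3 \<in> I" and \<sigma>: "\<sigma> = 1 \<or> \<sigma> = -1"
    and c: "Im (V (Complex x1 y1)) = c" "Im (V (Complex x3 y3)) = c"
  shows "\<exists>y. \<sigma> * Im (V (Complex x2 y)) \<ge> \<sigma> * c"
proof (rule ccontr)
  assume "\<not> ?thesis"
  then have less: "\<sigma> * Im (V (Complex x2 y)) < \<sigma> * c" for y using not_le by blast
  have x2: "x2 \<in> I" using convex_real_between[OF I(2) x(3,4)] x by simp
  have \<sigma>2: "\<sigma>\<^sup>2 = 1" "\<sigma> * (\<sigma> * t) = t" for t using \<sigma> by auto
  define f where "f x t = \<sigma> * Im (V (Complex x (\<sigma> * t)))" for x t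
  have f: "(f x has_real_derivative Re (p (Complex x (\<sigma> * t)))) (at t)" if "x \<in> I" for x t
    using Im_V_vertical[OF that, of \<sigma> t] \<sigma>2 by (simp add: f_def[abs_def])
  have inc: "f x t < f x t'" if "x \<in> I" "t < t'" for x t t'
    by (rule DERIV_pos_imp_increasing[OF that(2)]) (use f[OF that(1)] p_pos that(1) in force)
  obtain B where B: "\<And>x y. x \<in> {x1..x3} \<Longrightarrow>
      norm (p (Complex x y) - p (Complex x2 y)) \<le> B * Re (p (Complex x2 y))"
    using horizontal_oscillation_bound[OF I p_holomorphic p_pos, of x1 x3 x2] x by auto
  define t0 where "t0 = max (\<sigma> * y1) (\<sigma> * y3) + 1"
  define \<delta> where "\<delta> = min (f x1 t0) (f x3 t0) - \<sigma> * c"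
  have "f x1 (\<sigma> * y1) = \<sigma> * c" "f x3 (\<sigma> * y3) = \<sigma> * c" by (simp_all add: f_def \<sigma>2 c)
  then have \<delta>: "\<delta> > 0"
    using inc[OF x(3), of "\<sigma> * y1" t0] inc[OF x(4), of "\<sigma> * y3" t0] by (auto simp: \<delta>_def t0_def)
  have far: "f x1 t \<ge> \<sigma> * c + \<delta>" "f x3 t \<ge> \<sigma> * c + \<delta>" if "t \<ge> t0" for t
    using inc[OF x(3), of t0 t] inc[OF x(4), of t0 t] that by (cases "t = t0"; auto simp: \<delta>_def)+
  define a b where "a = x2 - x1" and "b = x3 - x2"
  have ab: "a > 0" "b > 0" using x by (auto simp: a_def b_def)
  \<comment> \<open>The two linear estimates below, weighted by \<open>b\<close> and \<open>a\<close>, are contradictory if \<open>u < e\<close>.\<close>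
  define e where "e = \<delta> * (a + b) / (2 * (\<bar>B\<bar> + 1) * a * b)"
  have e: "e > 0" using \<delta> ab by (simp add: e_def)
  obtain t where t: "t \<ge> t0" "Re (p (Complex x2 (\<sigma> * t))) < e"
    using bounded_increasing_small_derivative[OF f[OF x2] _ e] less by (metis f_def)
  define \<eta> u where "\<eta> = \<sigma> * t" and "u = Re (p (Complex x2 \<eta>))"
  have u: "0 < u" "u < e" using t p_pos x2 by (auto simp: u_def \<eta>_def)
  define q where "q = \<sigma> * Im (p (Complex x2 \<eta>))"
  have lin: "\<bar>f x t - f x2 t - (x - x2) * q\<bar> \<le> \<bar>B\<bar> * u * \<bar>x - x2\<bar>" if xx: "x \<in> {x1..x3}" for x
  proof -
    define S where "S = (\<lambda>x. Complex x \<eta>) ` {x1..x3}"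
    have S: "convex S"
    proof -
      have "S = (\<lambda>w. Complex 0 \<eta> + w) ` ((\<lambda>x. x *\<^sub>R (1::complex)) ` {x1..x3})"
        unfolding S_def image_image by (intro image_cong) (auto simp: complex_eq_iff)
      also have "convex \<dots>"
        by (intro convex_translation convex_linear_image linear_scaleR_left) auto
      finally show ?thesis .
    qed
    have "norm ((V (Complex x \<eta>) - p (Complex x2 \<eta>) * Complex x \<eta>) - (V (Complex x2 \<eta>) - p (Complex x2 \<eta>) * Complex x2 \<eta>))
        \<le> (\<bar>B\<bar> * u) * norm (Complex x \<eta> - Complex x2 \<eta>)"
    proof (rule field_differentiable_bound[OF S, where f' = "\<lambda>w. p w - p (Complex x2 \<eta>)"])
      fix w assume "w \<in> S"
      then obtain x' where x': "w = Complex x' \<eta>" "x' \<in> {x1..x3}" by (auto simp: S_def)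
      have "x' \<in> I" using convex_real_between[OF I(2) x(3,4)] x'(2) by simp
      then have "(V has_field_derivative p w) (at w within S)"
        unfolding x'(1) by (rule has_field_derivative_at_within[OF V[of "Complex x' \<eta>", simplified]])
      from DERIV_diff[OF this DERIV_cmult[OF DERIV_ident, of "p (Complex x2 \<eta>)"]]
      show "((\<lambda>w. V w - p (Complex x2 \<eta>) * w) has_field_derivative p w - p (Complex x2 \<eta>)) (at w within S)"
        by simp
      have "B * u \<le> \<bar>B\<bar> * u" using u by (intro mult_right_mono) auto
      then show "norm (p w - p (Complex x2 \<eta>)) \<le> \<bar>B\<bar> * u"
        using B[OF x'(2), of \<eta>] x'(1) by (simp add: u_def)
    qed (use xx x in \<open>auto simp: S_def\<close>)
    moreover have "Complex x \<eta> - Complex x2 \<eta> = of_real (x - x2)" by (simp add: complex_eq_iff)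
    moreover have "(V (Complex x \<eta>) - P * Complex x \<eta>) - (V (Complex x2 \<eta>) - P * Complex x2 \<eta>) =
        V (Complex x \<eta>) - V (Complex x2 \<eta>) - of_real (x - x2) * P" for P
      by (simp add: complex_eq_iff algebra_simps)
    ultimately have le: "norm (V (Complex x \<eta>) - V (Complex x2 \<eta>) - of_real (x - x2) * p (Complex x2 \<eta>))
        \<le> \<bar>B\<bar> * u * \<bar>x - x2\<bar>" by (simp del: of_real_diff)
    have "\<bar>f x t - f x2 t - (x - x2) * q\<bar> =
        \<bar>\<sigma> * Im (V (Complex x \<eta>) - V (Complex x2 \<eta>) - of_real (x - x2) * p (Complex x2 \<eta>))\<bar>"
      by (simp add: f_def q_def \<eta>_def algebra_simps)
    also have "\<dots> = \<bar>Im (V (Complex x \<eta>) - V (Complex x2 \<eta>) - of_real (x - x2) * p (Complex x2 \<eta>))\<bar>"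
      using \<sigma> by auto
    also have "\<dots> \<le> norm (V (Complex x \<eta>) - V (Complex x2 \<eta>) - of_real (x - x2) * p (Complex x2 \<eta>))"
      by (rule abs_Im_le_cmod)
    finally show ?thesis using le by linarith
  qed
  have f2: "f x2 t < \<sigma> * c" using less by (simp add: f_def)
  have L1: "\<delta> < - a * q + \<bar>B\<bar> * u * a" and L3: "\<delta> < b * q + \<bar>B\<bar> * u * b"
    using lin[of x1] lin[of x3] far[OF t(1)] f2 x by (auto simp: a_def b_def abs_le_iff algebra_simps)
  have "b * \<delta> + a * \<delta> < b * (- a * q + \<bar>B\<bar> * u * a) + a * (b * q + \<bar>B\<bar> * u * b)"
    using L1 L3 ab by (intro add_strict_mono mult_strict_left_mono)
  also have "\<dots> = 2 * \<bar>B\<bar> * a * b * u" by (simp add: algebra_simps)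
  also have "\<dots> \<le> 2 * (\<bar>B\<bar> + 1) * a * b * e"
    using u ab by (intro mult_mono) auto
  also have "\<dots> = \<delta> * (a + b)"
    using ab by (simp add: e_def) 
  finally show False by (simp add: algebra_simps)
qed

definition level_abscissae :: "real \<Rightarrow> real set" where
  "level_abscissae c = {x \<in> I. \<exists>y. Im (V (Complex x y)) = c}"

lemma continuous_on_V: "continuous_on {w. Re w \<in> I} V"
  by (rule holomorphic_on_imp_continuous_on[OF V_holomorphic])

lemma level_abscissae_interval: "is_interval (level_abscissae c)"
  unfolding is_interval_1
proof (intro ballI allI impI)
  fix x1 x3 x2 assume 1: "x1 \<in> level_abscissae c" and 3: "x3 \<in> level_abscissae c" and x: "x1 \<le> x2 \<and> x2 \<le> x3"
  show "x2 \<in> level_abscissae c"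
  proof (cases "x2 = x1 \<or> x2 = x3")
    case False
    have x2: "x2 \<in> I" using convex_real_between[OF I(2), of x1 x3 x2] 1 3 x by (simp add: level_abscissae_def)
    obtain y1 y3 where y: "Im (V (Complex x1 y1)) = c" "Im (V (Complex x3 y3)) = c"
      using 1 3 by (auto simp: level_abscissae_def)
    obtain y where y: "Im (V (Complex x2 y)) \<ge> c"
      using level_between_one_side[of x1 x2 x3 1, OF _ _ _ _ _ y] x 1 3 False by (auto simp: level_abscissae_def)
    obtain y' where y': "Im (V (Complex x2 y')) \<le> c"
      using level_between_one_side[of x1 x2 x3 "-1" y1 c y3] \<open>Im (V (Complex x1 y1)) = c\<close> \<open>Im (V (Complex x3 y3)) = c\<close>
        x 1 3 False by (auto simp: level_abscissae_def)
    have "y' \<le> y" using Im_V_strict_mono[OF x2, of y y'] y y' by force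
    have "continuous_on {y'..y} (\<lambda>t. Im (V (Complex x2 t)))"
      unfolding Complex_eq
      by (intro continuous_intros continuous_on_compose2[OF continuous_on_V]) (use x2 in auto)
    then obtain t where "Im (V (Complex x2 t)) = c"
      using IVT'[of "\<lambda>t. Im (V (Complex x2 t))" y' c y] y y' \<open>y' \<le> y\<close> by auto
    then show ?thesis using x2 by (auto simp: level_abscissae_def)
  qed (use 1 3 in auto)
qed

definition level_ordinate :: "real \<Rightarrow> real \<Rightarrow> real" where
  "level_ordinate c x = (SOME y. Im (V (Complex x y)) = c)"

lemma level_ordinate: "x \<in> level_abscissae c \<Longrightarrow> Im (V (Complex x (level_ordinate c x))) = c"
  unfolding level_ordinate_def level_abscissae_def by (rule someI_ex) auto

lemma level_ordinate_unique:
  assumes "Re w \<in> I" "Im (V w) = c"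
  shows "Re w \<in> level_abscissae c" "w = Complex (Re w) (level_ordinate c (Re w))"
proof -
  show l: "Re w \<in> level_abscissae c" using assms by (auto simp: level_abscissae_def intro!: exI[of _ "Im w"])
  have "Im w = level_ordinate c (Re w)"
    using Im_V_strict_mono[OF assms(1), of "Im w" "level_ordinate c (Re w)"]
      Im_V_strict_mono[OF assms(1), of "level_ordinate c (Re w)" "Im w"] level_ordinate[OF l] assms(2)
    by (cases "Im w" "level_ordinate c (Re w)" rule: linorder_cases) auto
  then show "w = Complex (Re w) (level_ordinate c (Re w))" by (simp add: complex_eq_iff)
qed

lemma continuous_on_level_ordinate: "continuous_on (level_abscissae c) (level_ordinate c)"
  unfolding continuous_on_iff
proof (intro ballI allI impI)
  fix x0 e assume x0: "x0 \<in> level_abscissae c" and e: "(e::real) > 0"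
  have x0I: "x0 \<in> I" using x0 by (simp add: level_abscissae_def)
  let ?y = "level_ordinate c x0"
  have cont: "isCont (\<lambda>x. Im (V (Complex x y))) x0" for y
  proof -
    have "continuous_on I (\<lambda>x. Im (V (Complex x y)))"
      unfolding Complex_eq
      by (intro continuous_intros continuous_on_compose2[OF continuous_on_V]) auto
    then show ?thesis using I(1) x0I continuous_on_eq_continuous_at by blast
  qed
  have lim: "((\<lambda>x. Im (V (Complex x y))) \<longlongrightarrow> Im (V (Complex x0 y))) (nhds x0)" for y
    using cont[of y] tendsto_at_iff_tendsto_nhds[of "\<lambda>x. Im (V (Complex x y))" x0]
    unfolding isCont_def by blast
  have lo: "Im (V (Complex x0 (?y - e))) < c" and hi: "c < Im (V (Complex x0 (?y + e)))"
    using Im_V_strict_mono[OF x0I, of "?y - e" ?y] Im_V_strict_mono[OF x0I, of ?y "?y + e"] level_ordinate[OF x0] e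
    by auto
  have "\<forall>\<^sub>F x in nhds x0. Im (V (Complex x (?y - e))) < c"
    by (rule order_tendstoD(2)[OF lim lo])
  moreover have "\<forall>\<^sub>F x in nhds x0. c < Im (V (Complex x (?y + e)))"
    by (rule order_tendstoD(1)[OF lim hi])
  ultimately have "\<forall>\<^sub>F x in nhds x0. Im (V (Complex x (?y - e))) < c \<and> c < Im (V (Complex x (?y + e)))"
    by (rule eventually_conj)
  then obtain d where d: "d > 0" "\<And>x. dist x x0 < d \<Longrightarrow>
      Im (V (Complex x (?y - e))) < c \<and> c < Im (V (Complex x (?y + e)))"
    unfolding eventually_nhds_metric by blast
  show "\<exists>d>0. \<forall>x\<in>level_abscissae c. dist x x0 < d \<longrightarrow> dist (level_ordinate c x) (level_ordinate c x0) < e"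
  proof (intro exI[of _ d] conjI ballI impI d(1))
    fix x assume x: "x \<in> level_abscissae c" "dist x x0 < d"
    then have xI: "x \<in> I" by (simp add: level_abscissae_def)
    have "\<not> level_ordinate c x \<le> ?y - e"
      using Im_V_strict_mono[OF xI, of "level_ordinate c x" "?y - e"] d(2)[OF x(2)] level_ordinate[OF x(1)] by force
    moreover have "\<not> level_ordinate c x \<ge> ?y + e"
      using Im_V_strict_mono[OF xI, of "?y + e" "level_ordinate c x"] d(2)[OF x(2)] level_ordinate[OF x(1)] by force
    ultimately show "dist (level_ordinate c x) (level_ordinate c x0) < e" by (auto simp: dist_real_def)
  qed
qed

end

text \<open>If \<open>X a = X b\<close>, then \<open>X\<close> has an extremum inside \<open>{a..b}\<close>, and it is not injective near that point.\<close>
lemma locally_injective_imp_injective_on_interval: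
  fixes X :: "real \<Rightarrow> real"
  assumes E: "is_interval E" and X: "continuous_on E X"
    and loc: "\<And>x. x \<in> E \<Longrightarrow> \<exists>d>0. inj_on X (E \<inter> ball x d)"
  shows "inj_on X E"
proof -
  have False if ab: "a \<in> E" "b \<in> E" "a < b" "X a = X b" for a b
  proof -
    have sub: "{a..b} \<subseteq> E" using convex_real_between[of E a b] E ab is_interval_convex_1 by auto
    have cX: "continuous_on {a..b} X" by (rule continuous_on_subset[OF X sub])
    obtain M where M: "M \<in> {a..b}" "\<And>x. x \<in> {a..b} \<Longrightarrow> X x \<le> X M"
      using continuous_attains_sup[OF compact_Icc _ cX] ab by auto
    obtain m where m: "m \<in> {a..b}" "\<And>x. x \<in> {a..b} \<Longrightarrow> X m \<le> X x"
      using continuous_attains_inf[OF compact_Icc _ cX] ab by auto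
    \<comment> \<open>If both extrema lie at the end points, \<open>X\<close> is constant and the midpoint serves.\<close>
    have "\<exists>\<xi>\<in>{a<..<b}. (\<forall>x\<in>{a..b}. X x \<le> X \<xi>) \<or> (\<forall>x\<in>{a..b}. X \<xi> \<le> X x)"
    proof (cases "M \<in> {a<..<b} \<or> m \<in> {a<..<b}")
      case True
      then show ?thesis using M m by blast
    next
      case False
      then have "X M = X a" "X m = X a" using M(1) m(1) ab by (auto simp: less_le)
      moreover have mid: "(a + b) / 2 \<in> {a<..<b}" using ab(3) by simp
      ultimately have "X x \<le> X ((a + b) / 2)" if "x \<in> {a..b}" for x
        using M(2)[OF that] m(2)[of "(a + b) / 2"] by simp
      then show ?thesis using mid by blast
    qed
    then obtain \<xi> where \<xi>: "\<xi> \<in> {a<..<b}"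
      and ext: "(\<forall>x\<in>{a..b}. X x \<le> X \<xi>) \<or> (\<forall>x\<in>{a..b}. X \<xi> \<le> X x)" by blast
    have \<xi>': "\<xi> \<in> {a..b}" using \<xi> by simp
    then obtain d where d: "d > 0" "inj_on X (E \<inter> ball \<xi> d)" using loc[of \<xi>] sub by blast
    define l u where "l = max a (\<xi> - d / 2)" and "u = min b (\<xi> + d / 2)"
    have lu: "l < \<xi>" "\<xi> < u" "{l..u} \<subseteq> {a..b}" "{l..u} \<subseteq> ball \<xi> d"
      using \<xi> d by (auto simp: l_def u_def dist_real_def)
    have "(X l < X \<xi> \<and> X \<xi> < X u) \<or> (X u < X \<xi> \<and> X \<xi> < X l)"
    proof (rule continuous_inj_imp_mono[OF lu(1,2)])
      show "continuous_on {l..u} X" by (rule continuous_on_subset[OF cX lu(3)])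
      show "inj_on X {l..u}" by (rule inj_on_subset[OF d(2)]) (use lu(3,4) sub in blast)
    qed
    moreover have "l \<in> {a..b}" "u \<in> {a..b}" using lu by auto
    ultimately show False using ext by force
  qed
  then show ?thesis unfolding inj_on_def by (metis linorder_neqE)
qed

text \<open>The level sets of the imaginary part are graphs of continuous functions over intervals.  Along such
  a graph the real part is a locally injective function on an interval, hence injective.\<close>
theorem shear_on_strip:
  assumes I: "open I" "convex I"
    and h: "\<And>w. Re w \<in> I \<Longrightarrow> (h has_field_derivative h' w) (at w)"
    and g: "\<And>w. Re w \<in> I \<Longrightarrow> (g has_field_derivative g' w) (at w)"
    and pos: "\<And>w. Re w \<in> I \<Longrightarrow> Re (h' w - g' w) > 0"
    and loc: "locally_univalent_on {w. Re w \<in> I} (harmonic_map h g)"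
  shows "inj_on (harmonic_map h g) {w. Re w \<in> I}"
    and "connected {w. Re w \<in> I \<and> Im (harmonic_map h g w) = c}"
proof -
  interpret vertical_growth I "\<lambda>w. h w - g w" "\<lambda>w. h' w - g' w"
    using I pos by unfold_locales (auto intro!: DERIV_diff h g)
  let ?F = "harmonic_map h g"
  have Im_F: "Im (?F w) = Im (h w - g w)" for w by (simp add: harmonic_map_def)
  define \<gamma> where "\<gamma> c x = Complex x (level_ordinate c x)" for c x
  have \<gamma>cont: "continuous_on (level_abscissae c) (\<gamma> c)" for c
    unfolding \<gamma>_def Complex_eq by (intro continuous_intros continuous_on_level_ordinate)
  have \<gamma>I: "Re (\<gamma> c x) \<in> I" "Im (?F (\<gamma> c x)) = c" if "x \<in> level_abscissae c" for c x
    using that level_ordinate[OF that] unfolding Im_F by (auto simp: \<gamma>_def level_abscissae_def)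
  have eq: "{w. Re w \<in> I \<and> Im (?F w) = c} = \<gamma> c ` level_abscissae c" for c
  proof (intro subset_antisym subsetI)
    fix w assume "w \<in> {w. Re w \<in> I \<and> Im (?F w) = c}"
    then have "Re w \<in> I" "Im (h w - g w) = c" by (auto simp: Im_F)
    from level_ordinate_unique[OF this] show "w \<in> \<gamma> c ` level_abscissae c"
      unfolding \<gamma>_def by blast
  qed (use \<gamma>I in auto)
  show "connected {w. Re w \<in> I \<and> Im (?F w) = c}"
    unfolding eq by (intro connected_continuous_image \<gamma>cont) (simp add: level_abscissae_interval is_interval_connected)
  have hgc: "continuous_on {w. Re w \<in> I} h" "continuous_on {w. Re w \<in> I} g"
    using h g DERIV_isCont by (blast intro: continuous_at_imp_continuous_on)+
  have Fcont: "continuous_on {w. Re w \<in> I} ?F"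
    unfolding harmonic_map_def by (intro continuous_intros hgc)
  have inj: "inj_on (\<lambda>x. Re (?F (\<gamma> c x))) (level_abscissae c)" for c
  proof (rule locally_injective_imp_injective_on_interval[OF level_abscissae_interval])
    show "continuous_on (level_abscissae c) (\<lambda>x. Re (?F (\<gamma> c x)))"
      by (intro continuous_intros continuous_on_compose2[OF Fcont \<gamma>cont]) (use \<gamma>I in auto)
    fix x assume x: "x \<in> level_abscissae c"
    then obtain U where U: "open U" "\<gamma> c x \<in> U" "inj_on ?F (U \<inter> {w. Re w \<in> I})"
      using loc \<gamma>I(1) unfolding locally_univalent_on_def by blast
    obtain e where e: "e > 0" "ball (\<gamma> c x) e \<subseteq> U" using U open_contains_ball by blast
    obtain d where d: "d > 0" "\<And>x'. x' \<in> level_abscissae c \<Longrightarrow> dist x' x < d \<Longrightarrow> dist (\<gamma> c x') (\<gamma> c x) < e"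
      using \<gamma>cont[of c] x e(1) unfolding continuous_on_iff by blast
    have "inj_on (\<lambda>x. Re (?F (\<gamma> c x))) (level_abscissae c \<inter> ball x d)"
    proof (rule inj_onI)
      fix a b assume a: "a \<in> level_abscissae c \<inter> ball x d" and b: "b \<in> level_abscissae c \<inter> ball x d"
        and "Re (?F (\<gamma> c a)) = Re (?F (\<gamma> c b))"
      then have "?F (\<gamma> c a) = ?F (\<gamma> c b)" using \<gamma>I(2) by (simp add: complex_eq_iff)
      moreover have "\<gamma> c a \<in> U" "\<gamma> c b \<in> U"
        using d(2)[of a] d(2)[of b] a b e(2) by (auto simp: dist_commute)
      ultimately have "\<gamma> c a = \<gamma> c b" using U(3) \<gamma>I(1) a b by (auto simp: inj_on_def)
      then show "a = b" by (simp add: \<gamma>_def)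
    qed
    then show "\<exists>d>0. inj_on (\<lambda>x. Re (?F (\<gamma> c x))) (level_abscissae c \<inter> ball x d)" using d(1) by blast
  qed
  show "inj_on ?F {w. Re w \<in> I}"
  proof (rule inj_onI)
    fix v w assume v: "v \<in> {w. Re w \<in> I}" and w: "w \<in> {w. Re w \<in> I}" and vw: "?F v = ?F w"
    define c where "c = Im (?F v)"
    have "v \<in> \<gamma> c ` level_abscissae c" "w \<in> \<gamma> c ` level_abscissae c" using v w vw by (auto simp: eq[symmetric] c_def)
    then obtain a b where ab: "a \<in> level_abscissae c" "b \<in> level_abscissae c" "v = \<gamma> c a" "w = \<gamma> c b" by auto
    then have "a = b" using inj[of c] vw by (auto simp: inj_on_def)
    then show "v = w" using ab by simp
  qed
qed

lemma quadratic_of_quotient: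
  fixes a n c :: complex
  assumes "n \<noteq> 0"
  shows "1 - 2 * (a / n) * c + (a / n)\<^sup>2 = (n * n - (2 * c) * a * n + a * a) / (n * n)"
  using assms by (simp add: field_simps power2_eq_square)

text \<open>The map \<open>\<kappa>\<close> is the inverse of the primitive of \<open>1 / (1 - 2 z cos \<nu> + z\<^sup>2)\<close>.  If \<open>sin \<nu> = 0\<close>, this primitive is a
  Moebius map onto a half-plane.  Otherwise it is a logarithm: \<open>\<kappa>\<close> is the exponential \<open>E\<close> from the strip to the
  upper half-plane, followed by a Moebius map to the disc.\<close>
lemma strip_uniformization:
  fixes \<nu> :: real
  obtains I :: "real set" and \<kappa> :: "complex \<Rightarrow> complex"
  where "open I" "convex I"
    "\<And>w. Re w \<in> I \<Longrightarrow> \<kappa> w \<in> unit_disc"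
    "\<And>w. Re w \<in> I \<Longrightarrow> (\<kappa> has_field_derivative (1 - 2 * \<kappa> w * of_real (cos \<nu>) + (\<kappa> w)\<^sup>2)) (at w)"
    "\<And>z. z \<in> unit_disc \<Longrightarrow> \<exists>w. Re w \<in> I \<and> \<kappa> w = z"
proof (cases "sin \<nu> = 0")
  case True
  define \<epsilon> where "\<epsilon> = cos \<nu>"
  have \<epsilon>: "\<epsilon> * \<epsilon> = 1" using True sin_cos_squared_add[of \<nu>] by (simp add: \<epsilon>_def power2_eq_square)
  then have \<epsilon>c: "of_real \<epsilon> * of_real \<epsilon> = (1 :: complex)" by (metis of_real_1 of_real_mult)
  define I where "I = {x :: real. - 1 / 2 < \<epsilon> * x}"
  define \<kappa> where "\<kappa> w = w / (1 + of_real \<epsilon> * w)" for w :: complex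
  have "open I" unfolding I_def by (intro open_Collect_less continuous_intros)
  moreover have "convex I"
  proof -
    have "I = (\<lambda>x. \<epsilon> * x) -` {- 1 / 2 <..}" by (auto simp: I_def)
    then show ?thesis by (simp add: convex_linear_vimage linear_times)
  qed
  moreover have sq: "(norm (1 + of_real \<epsilon> * w))\<^sup>2 - (norm w)\<^sup>2 = 1 + 2 * (\<epsilon> * Re w)" for w :: complex
  proof -
    have "(norm (of_real \<epsilon> * w))\<^sup>2 = (norm w)\<^sup>2"
      using \<epsilon> by (simp add: norm_mult power_mult_distrib power2_eq_square[of \<epsilon>])
    moreover have "(norm (1 + of_real \<epsilon> * w))\<^sup>2 = 1 + 2 * (\<epsilon> * Re w) + (norm (of_real \<epsilon> * w))\<^sup>2"
      unfolding cmod_power2 by (simp add: power2_eq_square algebra_simps)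
    ultimately show ?thesis by simp
  qed
  have less: "norm w < norm (1 + of_real \<epsilon> * w)" if "Re w \<in> I" for w :: complex
  proof (rule power2_less_imp_less)
    show "(norm w)\<^sup>2 < (norm (1 + of_real \<epsilon> * w))\<^sup>2" using sq[of w] that by (simp add: I_def)
  qed simp
  have nz: "1 + of_real \<epsilon> * w \<noteq> 0" if "Re w \<in> I" for w using less[OF that] by auto
  have "\<kappa> w \<in> unit_disc" if "Re w \<in> I" for w
    using less[OF that] nz[OF that] by (simp add: \<kappa>_def norm_divide)
  moreover have "(\<kappa> has_field_derivative (1 - 2 * \<kappa> w * of_real (cos \<nu>) + (\<kappa> w)\<^sup>2)) (at w)"
    if "Re w \<in> I" for w
  proof -
    let ?N = "1 + of_real \<epsilon> * w"
    have "(\<kappa> has_field_derivative (1 * ?N - w * of_real \<epsilon>) / (?N * ?N)) (at w)"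
      unfolding \<kappa>_def by (rule DERIV_divide) (use nz[OF that] in \<open>auto intro!: derivative_eq_intros\<close>)
    moreover have "1 - 2 * (w / ?N) * of_real \<epsilon> + (w / ?N)\<^sup>2 =
        (?N * ?N - (2 * of_real \<epsilon>) * w * ?N + w * w) / (?N * ?N)"
      by (rule quadratic_of_quotient[OF nz[OF that]])
    moreover have "?N * ?N - (2 * of_real \<epsilon>) * w * ?N + w * w = 1 + (1 - of_real \<epsilon> * of_real \<epsilon>) * (w * w)"
      by (simp add: algebra_simps)
    ultimately show ?thesis by (simp add: \<epsilon>c \<epsilon>_def[symmetric] \<kappa>_def mult.commute)
  qed
  moreover have "\<exists>w. Re w \<in> I \<and> \<kappa> w = z" if z: "z \<in> unit_disc" for z
  proof -
    have ne: "1 - of_real \<epsilon> * z \<noteq> 0"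
    proof
      assume "1 - of_real \<epsilon> * z = 0"
      then have "\<bar>\<epsilon>\<bar> * norm z = 1" by (metis eq_iff_diff_eq_0 norm_mult norm_of_real norm_one)
      moreover have "\<bar>\<epsilon>\<bar> \<le> 1" by (simp add: \<epsilon>_def)
      ultimately show False using z mult_right_mono[of "\<bar>\<epsilon>\<bar>" 1 "norm z"] by simp
    qed
    define w where "w = z / (1 - of_real \<epsilon> * z)"
    have 1: "1 + of_real \<epsilon> * w = 1 / (1 - of_real \<epsilon> * z)" using ne by (simp add: w_def field_simps)
    have "norm w < norm (1 + of_real \<epsilon> * w)"
      unfolding 1 using z ne by (simp add: w_def norm_divide divide_strict_right_mono)
    then have "(norm w)\<^sup>2 < (norm (1 + of_real \<epsilon> * w))\<^sup>2" by (intro power_strict_mono) auto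
    then have "Re w \<in> I" using sq[of w] by (simp add: I_def)
    moreover have "\<kappa> w = z" unfolding \<kappa>_def 1 using ne by (simp add: w_def)
    ultimately show ?thesis by blast
  qed
  ultimately show thesis using that by blast
next
  case False
  define \<mu> where "\<mu> = arccos (cos \<nu>)"
  have c\<mu>: "cos \<mu> = cos \<nu>" by (simp add: \<mu>_def)
  have "cos \<nu> \<noteq> 1" "cos \<nu> \<noteq> - 1" using False sin_squared_eq[of \<nu>] by auto
  then have "-1 < cos \<nu>" "cos \<nu> < 1" using cos_le_one[of \<nu>] cos_ge_minus_one[of \<nu>] by linarith+
  then have \<mu>: "0 < \<mu>" "\<mu> < pi" using arccos_lt_bounded by (auto simp: \<mu>_def)
  define s where "s = sin \<mu>"
  have s: "s > 0" using \<mu> by (simp add: s_def sin_gt_zero)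
  define e where "e = cis \<mu>"
  have e: "norm e = 1" "Im e = s" "Re e = cos \<nu>" "e \<noteq> 0" by (auto simp: e_def s_def c\<mu>)
  have ecnj: "e * cnj e = 1" using e(1) by (simp add: complex_norm_square[symmetric])
  define I where "I = {x. 0 < 2 * s * x + \<mu> \<and> 2 * s * x + \<mu> < pi}"
  define E where "E w = exp (\<i> * (2 * of_real s * w + of_real \<mu>))" for w
  define \<kappa> where "\<kappa> w = (E w - e) / (e * E w - 1)" for w
  have "open I" unfolding I_def by (intro open_Collect_conj open_Collect_less continuous_intros)
  moreover have "convex I"
  proof -
    have "I = {- \<mu> / (2 * s)<..<(pi - \<mu>) / (2 * s)}" using s by (auto simp: I_def field_simps)
    then show ?thesis by simp
  qed
  moreover have less: "norm (E w - e) < norm (e * E w - 1)" if "Im (E w) > 0" for w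
  proof -
    have "e * E w - 1 = e * (E w - cnj e)" using ecnj by (simp add: algebra_simps)
    then have n: "norm (e * E w - 1) = norm (E w - cnj e)" by (simp add: norm_mult e)
    have "(norm (E w - cnj e))\<^sup>2 - (norm (E w - e))\<^sup>2 = 4 * Im (E w) * Im e"
      unfolding cmod_power2 by (simp add: power2_eq_square algebra_simps)
    moreover have "4 * Im (E w) * Im e > 0" using that s e(2) by simp
    ultimately have "(norm (E w - e))\<^sup>2 < (norm (E w - cnj e))\<^sup>2" by linarith
    then show ?thesis unfolding n by (rule power2_less_imp_less) simp
  qed
  have ImE: "Im (E w) > 0" if "Re w \<in> I" for w
    using that by (simp add: E_def I_def Im_exp sin_gt_zero)
  have nz: "e * E w - 1 \<noteq> 0" if "Re w \<in> I" for w using less[OF ImE[OF that]] by auto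
  have "\<kappa> w \<in> unit_disc" if "Re w \<in> I" for w
    using less[OF ImE[OF that]] nz[OF that] by (simp add: \<kappa>_def norm_divide)
  moreover have "(\<kappa> has_field_derivative (1 - 2 * \<kappa> w * of_real (cos \<nu>) + (\<kappa> w)\<^sup>2)) (at w)"
    if "Re w \<in> I" for w
  proof -
    let ?E = "E w" and ?N = "e * E w - 1"
    have c2: "2 * of_real (cos \<nu>) = e + cnj e" "2 * \<i> * of_real s = e - cnj e"
      using e by (auto simp: complex_eq_iff)
    have dE: "(E has_field_derivative 2 * \<i> * of_real s * ?E) (at w)"
      unfolding E_def by (auto intro!: derivative_eq_intros)
    have "(\<kappa> has_field_derivative ((2 * \<i> * of_real s * ?E) * ?N - (?E - e) * (e * (2 * \<i> * of_real s * ?E))) / (?N * ?N)) (at w)"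
      unfolding \<kappa>_def
      by (rule DERIV_divide) (use nz[OF that] dE in \<open>auto intro!: derivative_eq_intros\<close>)
    moreover have "1 - 2 * ((?E - e) / ?N) * of_real (cos \<nu>) + ((?E - e) / ?N)\<^sup>2 =
        (?N * ?N - (e + cnj e) * (?E - e) * ?N + (?E - e) * (?E - e)) / (?N * ?N)"
      unfolding c2(1)[symmetric] by (rule quadratic_of_quotient[OF nz[OF that]])
    moreover have "(e - cnj e) * ?E * ?N - (?E - e) * (e * ((e - cnj e) * ?E)) =
        ?N * ?N - (e + cnj e) * (?E - e) * ?N + (?E - e) * (?E - e)"
      using ecnj by algebra
    ultimately show ?thesis unfolding c2(2) by (simp add: \<kappa>_def)
  qed
  moreover have "\<exists>w. Re w \<in> I \<and> \<kappa> w = z" if z: "z \<in> unit_disc" for z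
  proof -
    have ne: "1 - e * z \<noteq> 0"
    proof
      assume "1 - e * z = 0"
      then have "norm e * norm z = 1" by (metis eq_iff_diff_eq_0 norm_mult norm_one)
      then show False using z e by simp
    qed
    define M where "M = (e - z) / (1 - e * z)"
    have "M = (e - z) * cnj (1 - e * z) / of_real ((norm (1 - e * z))\<^sup>2)"
      unfolding M_def by (subst complex_div_cnj) simp
    then have "Im M = Im ((e - z) * cnj (1 - e * z)) / (norm (1 - e * z))\<^sup>2"
      by (simp only: Im_divide_of_real)
    also have "(e - z) * cnj (1 - e * z) = e - (z + cnj z) + cnj e * (z * cnj z)"
      using ecnj by (simp add: algebra_simps)
    also have "Im \<dots> = s * (1 - (norm z)\<^sup>2)"
      using e unfolding complex_norm_square[symmetric] by (simp add: algebra_simps)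
    finally have ImM: "Im M > 0" using s z ne by (simp add: power_less_one_iff abs_square_less_1)
    then have M0: "M \<noteq> 0" by auto
    define w where "w = (Ln M - \<i> * of_real \<mu>) / (2 * \<i> * of_real s)"
    have EM: "E w = M"
    proof -
      have "\<i> * (2 * of_real s * w + of_real \<mu>) = Ln M" using s by (simp add: w_def field_simps)
      then show ?thesis using M0 by (simp add: E_def exp_Ln)
    qed
    have "Re w = (Im (Ln M) - \<mu>) / (2 * s)"
      using s by (simp add: w_def Re_divide_of_real complex_eq_iff Re_divide Im_divide power2_eq_square field_simps)
    then have "2 * s * Re w + \<mu> = Im (Ln M)" using s by simp
    moreover have "0 < Im (Ln M)" "Im (Ln M) < pi"
      using ImM M0 Im_Ln_pos_lt_imp Im_Ln_pos_lt[OF M0] by auto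
    ultimately have "Re w \<in> I" by (simp add: I_def)
    moreover have "\<kappa> w = z"
    proof -
      have den: "e * (e - z) - (1 - e * z) = e * e - 1" by (simp add: algebra_simps)
      have num: "(e - z) - e * (1 - e * z) = z * (e * e - 1)" by (simp add: algebra_simps)
      have "e * e - 1 \<noteq> 0"
      proof
        assume "e * e - 1 = 0"
        then have "e * e = e * cnj e" using ecnj by simp
        then have "e = cnj e" using e(4) by simp
        then have "Im e = 0" by (simp add: complex_eq_iff)
        then show False using s e(2) by simp
      qed
      moreover have "\<kappa> w = ((e - z) - e * (1 - e * z)) / (e * (e - z) - (1 - e * z))"
        unfolding \<kappa>_def EM M_def using ne by (simp add: divide_simps)
      ultimately show ?thesis unfolding den num by simp
    qed
    ultimately show ?thesis by blast
  qed
  ultimately show thesis using that by blast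
qed

section \<open>Convolutions and the shear criterion on the disc\<close>

abbreviation coefficient :: "(complex \<Rightarrow> complex) \<Rightarrow> nat \<Rightarrow> complex" where
  "coefficient f n \<equiv> fps_nth (fps_expansion f 0) n"

lemma disc_fps_expansion:
  assumes "f holomorphic_on unit_disc"
  shows "f has_fps_expansion fps_expansion f 0"
  by (rule has_fps_expansion_fps_expansion[OF open_ball _ assms]) simp

lemma coefficient_sums:
  assumes "f holomorphic_on unit_disc" "z \<in> unit_disc"
  shows "(\<lambda>n. coefficient f n * z ^ n) sums f z"
  using holomorphic_power_series[OF assms(1), of z] assms(2) by (simp add: fps_expansion_def)

lemma conv_radius_disc:
  assumes "f holomorphic_on unit_disc"
  shows "fps_conv_radius (fps_expansion f 0) \<ge> 1"
  using conv_radius_fps_expansion[of f 0 1] assms by (simp add: one_ereal_def)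

text \<open>For \<open>t < r < 1\<close> the coefficients of \<open>f\<close> are \<open>O (1 / r\<^sup>n)\<close>, and the series of \<open>g\<close> converges absolutely at
  \<open>t / r < 1\<close>.\<close>
lemma conv_radius_hadamard:
  assumes f: "f holomorphic_on unit_disc" and g: "g holomorphic_on unit_disc"
  shows "fps_conv_radius (Abs_fps (\<lambda>n. coefficient f n * coefficient g n)) \<ge> 1"
  unfolding fps_conv_radius_def
proof (rule conv_radius_geI_ex)
  fix t :: real assume t: "0 < t" "ereal t < 1"
  then have t1: "t < 1" by (simp add: one_ereal_def)
  define r where "r = (1 + t) / 2"
  have r: "0 < r" "r < 1" "t < r" using t t1 by (auto simp: r_def)
  have sf: "summable (\<lambda>n. coefficient f n * of_real r ^ n)"
    using coefficient_sums[OF f, of "of_real r"] r by (simp add: sums_iff)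
  then obtain B where B: "\<And>n. norm (coefficient f n * of_real r ^ n) \<le> B"
    using summable_imp_bounded by (auto simp: bounded_iff)
  have "norm (of_real (t / r) :: complex) < 1" using r t(1) by (simp add: norm_divide)
  also have "ereal 1 \<le> fps_conv_radius (fps_expansion g 0)"
    using conv_radius_disc[OF g] by (simp add: one_ereal_def)
  finally have sg: "summable (\<lambda>n. norm (coefficient g n * of_real (t / r) ^ n))"
    by (intro norm_summable_fps) simp
  have "summable (\<lambda>n. (coefficient f n * coefficient g n) * of_real t ^ n)"
  proof (rule summable_comparison_test[OF _ summable_mult[OF sg, of B]], intro exI allI impI)
    fix n
    have "(coefficient f n * coefficient g n) * of_real t ^ n =
        (coefficient f n * of_real r ^ n) * (coefficient g n * of_real (t / r) ^ n)"
      using r by (simp add: power_divide)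
    then have "norm ((coefficient f n * coefficient g n) * of_real t ^ n) =
        norm (coefficient f n * of_real r ^ n) * norm (coefficient g n * of_real (t / r) ^ n)"
      by (simp only: norm_mult[symmetric])
    also have "\<dots> \<le> B * norm (coefficient g n * of_real (t / r) ^ n)"
      by (rule mult_right_mono[OF B norm_ge_zero])
    finally show "norm ((coefficient f n * coefficient g n) * of_real t ^ n) \<le>
        B * norm (coefficient g n * of_real (t / r) ^ n)" .
  qed
  then show "\<exists>z. norm z = t \<and> summable (\<lambda>n. fps_nth (Abs_fps (\<lambda>n. coefficient f n * coefficient g n)) n * z ^ n)"
    using t by (intro exI[of _ "of_real t"]) simp
qed

lemma convolution_eval_fps:
  "(f \<star> g) = eval_fps (Abs_fps (\<lambda>n. coefficient f n * coefficient g n))"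
  by (simp add: fun_eq_iff convolution_def eval_fps_def)

lemma in_conv_radius_hadamard:
  assumes "f holomorphic_on unit_disc" "g holomorphic_on unit_disc" "z \<in> unit_disc"
  shows "ereal (norm z) < fps_conv_radius (Abs_fps (\<lambda>n. coefficient f n * coefficient g n))"
proof -
  have "ereal (norm z) < 1" using assms(3) by (simp add: one_ereal_def)
  then show ?thesis using conv_radius_hadamard[OF assms(1,2)] by (rule less_le_trans)
qed

lemma convolution_holomorphic:
  assumes "f holomorphic_on unit_disc" "g holomorphic_on unit_disc"
  shows "(f \<star> g) holomorphic_on unit_disc"
  unfolding convolution_eval_fps
  by (rule holomorphic_on_eval_fps) (use in_conv_radius_hadamard[OF assms] in \<open>auto simp: in_eball_iff\<close>)

lemma convolution_sums:
  assumes "f holomorphic_on unit_disc" "g holomorphic_on unit_disc" "z \<in> unit_disc"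
  shows "(\<lambda>n. coefficient f n * coefficient g n * z ^ n) sums (f \<star> g) z"
  using sums_eval_fps[OF in_conv_radius_hadamard[OF assms]] by (simp add: convolution_eval_fps)

lemma convolution_commute: "f \<star> g = g \<star> f"
  by (simp add: fun_eq_iff convolution_def mult.commute)

lemma convolution_cong:
  assumes "\<And>z. z \<in> unit_disc \<Longrightarrow> g z = k z"
  shows "f \<star> g = f \<star> k"
proof -
  have "fps_expansion g 0 = fps_expansion k 0"
    by (rule fps_expansion_cong) (use assms eventually_nhds_in_open[OF open_ball, of 0 0 1] in \<open>auto elim: eventually_mono\<close>)
  then show ?thesis by (simp add: fun_eq_iff convolution_def)
qed

lemma coefficient_euler:
  assumes "f holomorphic_on unit_disc"
  shows "coefficient (\<lambda>z. z * deriv f z) n = of_nat n * coefficient f n"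
proof -
  have "(\<lambda>z. z * deriv f z) has_fps_expansion fps_X * fps_deriv (fps_expansion f 0)"
    by (intro fps_expansion_intros disc_fps_expansion[OF assms])
  then have "fps_expansion (\<lambda>z. z * deriv f z) 0 = fps_X * fps_deriv (fps_expansion f 0)"
    by (rule fps_expansion_eqI)
  then show ?thesis by (cases n) simp_all
qed

text \<open>The Euler operator \<open>z d/dz\<close> multiplies the \<open>n\<close>-th coefficient by \<open>n\<close>, so it may be moved to one factor of a
  convolution.\<close>
lemma convolution_euler:
  assumes f: "f holomorphic_on unit_disc" and g: "g holomorphic_on unit_disc" and z: "z \<in> unit_disc"
  shows "z * deriv (f \<star> g) z = (g \<star> (\<lambda>z. z * deriv f z)) z"
proof -
  have d: "deriv f holomorphic_on unit_disc" by (rule holomorphic_deriv[OF f open_ball])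
  let ?C = "f \<star> g"
  have C: "?C holomorphic_on unit_disc" by (rule convolution_holomorphic[OF f g])
  have dC: "deriv ?C holomorphic_on unit_disc" by (rule holomorphic_deriv[OF C open_ball])
  have "coefficient ?C n = coefficient f n * coefficient g n" for n
  proof -
    have "0 < fps_conv_radius (Abs_fps (\<lambda>n. coefficient f n * coefficient g n))"
      using in_conv_radius_hadamard[OF f g, of 0] by (simp add: zero_ereal_def)
    then have "?C has_fps_expansion Abs_fps (\<lambda>n. coefficient f n * coefficient g n)"
      unfolding convolution_eval_fps by (rule eval_fps_has_fps_expansion)
    from fps_expansion_eqI[OF this] show ?thesis by simp
  qed
  then have "coefficient (\<lambda>z. z * deriv ?C z) n = coefficient g n * coefficient (\<lambda>z. z * deriv f z) n" for n
    by (simp add: coefficient_euler[OF C] coefficient_euler[OF f])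
  then have "(\<lambda>n. coefficient g n * coefficient (\<lambda>z. z * deriv f z) n * z ^ n) sums (z * deriv ?C z)"
    using coefficient_sums[of "\<lambda>z. z * deriv ?C z" z] dC z by (simp add: holomorphic_intros)
  moreover have "(\<lambda>z. z * deriv f z) holomorphic_on unit_disc" by (intro holomorphic_intros d)
  from convolution_sums[OF g this z]
  have "(\<lambda>n. coefficient g n * coefficient (\<lambda>z. z * deriv f z) n * z ^ n) sums (g \<star> (\<lambda>z. z * deriv f z)) z" .
  ultimately show ?thesis by (rule sums_unique2)
qed

lemma deriv_convolution_0:
  assumes f: "f holomorphic_on unit_disc" and g: "g holomorphic_on unit_disc"
  shows "deriv (f \<star> g) 0 = deriv f 0 * deriv g 0"
proof -
  have "(eval_fps (Abs_fps (\<lambda>n. coefficient f n * coefficient g n)) has_field_derivative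
      eval_fps (fps_deriv (Abs_fps (\<lambda>n. coefficient f n * coefficient g n))) 0) (at 0)"
    by (rule has_field_derivative_eval_fps) (use in_conv_radius_hadamard[OF f g, of 0] in simp)
  then show ?thesis
    unfolding convolution_eval_fps by (auto dest!: DERIV_imp_deriv simp: eval_fps_at_0 fps_expansion_def)
qed

text \<open>Away from the origin this is \<open>convolution_positivity\<close> for \<open>p = k' / \<phi>\<^sub>1'\<close>, both derivatives being
  rewritten with the Euler operator.  At the origin the operator loses the information, but there the
  derivative of a convolution is the product of the derivatives.\<close>
lemma convolution_deriv_ratio_positive:
  assumes \<phi>: "\<phi> \<in> convex_univalent" and \<phi>\<^sub>1: "\<phi>\<^sub>1 \<in> convex_univalent" and k: "k holomorphic_on unit_disc"
    and pos: "\<And>z. z \<in> unit_disc \<Longrightarrow> Re (deriv k z / deriv \<phi>\<^sub>1 z) > 0"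
    and x: "x \<in> unit_disc" and nz: "deriv (\<phi>\<^sub>1 \<star> \<phi>) x \<noteq> 0"
  shows "Re (deriv (k \<star> \<phi>) x / deriv (\<phi>\<^sub>1 \<star> \<phi>) x) > 0"
proof -
  note K = convex_univalentD[OF \<phi>] and K1 = convex_univalentD[OF \<phi>\<^sub>1]
  have nz1: "deriv \<phi>\<^sub>1 z \<noteq> 0" if "z \<in> unit_disc" for z
    by (rule convex_univalent_deriv_nonzero[OF \<phi>\<^sub>1 that])
  show ?thesis
  proof (cases "x = 0")
    case True
    then show ?thesis
      using pos[of 0] K(4) K1(4) by (simp add: deriv_convolution_0[OF k K(1)] deriv_convolution_0[OF K1(1) K(1)])
  next
    case False
    define p where "p z = deriv k z / deriv \<phi>\<^sub>1 z" for z
    have p: "p holomorphic_on unit_disc"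
      unfolding p_def using nz1
      by (intro holomorphic_intros holomorphic_deriv[OF k open_ball] holomorphic_deriv[OF K1(1) open_ball]) auto
    have "\<phi> \<star> (\<lambda>z. z * deriv k z) = \<phi> \<star> (\<lambda>z. z * deriv \<phi>\<^sub>1 z * p z)"
      by (rule convolution_cong) (use nz1 in \<open>simp add: p_def\<close>)
    then have e1: "x * deriv (k \<star> \<phi>) x = (\<phi> \<star> (\<lambda>z. z * deriv \<phi>\<^sub>1 z * p z)) x"
      using convolution_euler[OF k K(1) x] by simp
    have e2: "x * deriv (\<phi>\<^sub>1 \<star> \<phi>) x = (\<phi> \<star> (\<lambda>z. z * deriv \<phi>\<^sub>1 z)) x"
      by (rule convolution_euler[OF K1(1) K(1) x])
    have "Re ((x * deriv (k \<star> \<phi>) x) / (x * deriv (\<phi>\<^sub>1 \<star> \<phi>) x)) > 0"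
      unfolding e1 e2
      by (rule convolution_positivity[OF \<phi> \<phi>\<^sub>1 p _ x]) (use pos nz False in \<open>auto simp: p_def e2[symmetric]\<close>)
    then show ?thesis using False by simp
  qed
qed

text \<open>In the coordinate \<open>w\<close> with \<open>z = cis (- \<mu>) * \<kappa> w\<close> and after multiplication by \<open>cis \<mu>\<close>, the map becomes
  \<open>h + cnj g\<close> with \<open>h' - g'\<close> equal to the function whose real part is assumed positive, and lines in the
  direction \<open>- \<mu>\<close> become horizontal.\<close>
theorem shear_criterion:
  fixes \<mu> \<nu> :: real
  assumes H: "H holomorphic_on unit_disc" and G: "G holomorphic_on unit_disc"
    and loc: "locally_univalent_on unit_disc (harmonic_map H G)"
    and pos: "\<And>z. z \<in> unit_disc \<Longrightarrow> Re ((deriv H z - cis (- 2 * \<mu>) * deriv G z) *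
      (1 - 2 * z * cis \<mu> * of_real (cos \<nu>) + z\<^sup>2 * cis (2 * \<mu>))) > 0"
  shows "inj_on (harmonic_map H G) unit_disc"
    and "map_convex_in_direction (- \<mu>) (harmonic_map H G)"
proof -
  obtain I \<kappa> where I: "open I" "convex I"
    and \<kappa>D: "\<And>w. Re w \<in> I \<Longrightarrow> \<kappa> w \<in> unit_disc"
    and \<kappa>': "\<And>w. Re w \<in> I \<Longrightarrow> (\<kappa> has_field_derivative (1 - 2 * \<kappa> w * of_real (cos \<nu>) + (\<kappa> w)\<^sup>2)) (at w)"
    and \<kappa>onto: "\<And>z. z \<in> unit_disc \<Longrightarrow> \<exists>w. Re w \<in> I \<and> \<kappa> w = z"
    by (rule strip_uniformization[of \<nu>]) (rule that; assumption)
  define S where "S = {w. Re w \<in> I}"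
  define x where "x w = cis (- \<mu>) * \<kappa> w" for w
  define q where "q w = 1 - 2 * \<kappa> w * of_real (cos \<nu>) + (\<kappa> w)\<^sup>2" for w
  have xD: "x w \<in> unit_disc" if "Re w \<in> I" for w
    using \<kappa>D[OF that] by (simp add: x_def norm_mult)
  have x\<kappa>: "x w * cis \<mu> = \<kappa> w" for w
  proof -
    have "x w * cis \<mu> = (cis (- \<mu>) * cis \<mu>) * \<kappa> w" by (simp only: x_def mult_ac)
    then show ?thesis by (simp add: cis_mult)
  qed
  have x\<kappa>2: "(x w)\<^sup>2 * cis (2 * \<mu>) = (\<kappa> w)\<^sup>2" for w
  proof -
    have "cis (2 * \<mu>) = cis \<mu> * cis \<mu>" by (simp add: cis_mult)
    then have "(x w)\<^sup>2 * cis (2 * \<mu>) = (x w * cis \<mu>)\<^sup>2" by (simp add: power2_eq_square mult_ac)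
    then show ?thesis by (simp only: x\<kappa>)
  qed
  have dx: "(x has_field_derivative cis (- \<mu>) * q w) (at w)" if "Re w \<in> I" for w
    unfolding x_def q_def by (intro DERIV_cmult \<kappa>' that)
  define h g where "h w = cis \<mu> * H (x w)" and "g w = cis (- \<mu>) * G (x w)" for w
  have dh: "(h has_field_derivative deriv H (x w) * q w) (at w)" if "Re w \<in> I" for w
  proof -
    have "(h has_field_derivative cis \<mu> * (deriv H (x w) * (cis (- \<mu>) * q w))) (at w)"
      unfolding h_def
      by (intro DERIV_cmult DERIV_chain2[OF _ dx[OF that]] holomorphic_derivI[OF H open_ball xD[OF that]])
    moreover have "cis \<mu> * (deriv H (x w) * (cis (- \<mu>) * q w)) = (cis \<mu> * cis (- \<mu>)) * (deriv H (x w) * q w)"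
      by (simp only: mult_ac)
    ultimately show ?thesis by (simp add: cis_mult)
  qed
  have dg: "(g has_field_derivative cis (- 2 * \<mu>) * deriv G (x w) * q w) (at w)" if "Re w \<in> I" for w
  proof -
    have "(g has_field_derivative cis (- \<mu>) * (deriv G (x w) * (cis (- \<mu>) * q w))) (at w)"
      unfolding g_def
      by (intro DERIV_cmult DERIV_chain2[OF _ dx[OF that]] holomorphic_derivI[OF G open_ball xD[OF that]])
    moreover have "cis (- \<mu>) * (deriv G (x w) * (cis (- \<mu>) * q w)) = (cis (- \<mu>) * cis (- \<mu>)) * deriv G (x w) * q w"
      by (simp only: mult_ac)
    ultimately show ?thesis by (simp add: cis_mult)
  qed
  have pos': "Re (deriv H (x w) * q w - cis (- 2 * \<mu>) * deriv G (x w) * q w) > 0" if "Re w \<in> I" for w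
  proof -
    have "1 - 2 * x w * cis \<mu> * of_real (cos \<nu>) + (x w)\<^sup>2 * cis (2 * \<mu>) = q w"
      unfolding q_def x\<kappa>2 using x\<kappa>[of w] by (simp add: mult.assoc)
    then show ?thesis using pos[OF xD[OF that]] by (simp add: left_diff_distrib del: times_complex.sel)
  qed
  have qnz: "q w \<noteq> 0" if "Re w \<in> I" for w using pos'[OF that] by auto
  let ?f = "harmonic_map H G" and ?F = "harmonic_map h g"
  have F: "?F w = cis \<mu> * ?f (x w)" for w
    by (simp add: harmonic_map_def h_def g_def cis_cnj distrib_left)
  have opS: "open S"
    unfolding S_def using open_vimage[OF I(1), of Re] by (simp add: vimage_def continuous_on_Re continuous_on_id)
  have locF: "locally_univalent_on S ?F"
    unfolding locally_univalent_on_def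
  proof
    fix w assume "w \<in> S"
    then have w: "Re w \<in> I" by (simp add: S_def)
    obtain U where U: "open U" "x w \<in> U" "inj_on ?f (U \<inter> unit_disc)"
      using loc xD[OF w] unfolding locally_univalent_on_def by blast
    have xS: "x holomorphic_on S" using dx opS by (auto simp: S_def holomorphic_on_open)
    have "deriv x w \<noteq> 0" using DERIV_imp_deriv[OF dx[OF w]] qnz[OF w] by simp
    then obtain r where r: "r > 0" "ball w r \<subseteq> S" "inj_on x (ball w r)"
      using has_complex_derivative_locally_injective[OF xS \<open>w \<in> S\<close> opS] by blast
    define U' where "U' = ball w r \<inter> x -` U"
    have "open U'"
      unfolding U'_def
      by (rule continuous_open_preimage[OF _ open_ball U(1)])
        (rule holomorphic_on_imp_continuous_on[OF holomorphic_on_subset[OF xS r(2)]])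
    moreover have "w \<in> U'" using r(1) U(2) by (simp add: U'_def)
    moreover have "inj_on ?F (U' \<inter> S)"
    proof (rule inj_onI)
      fix a b assume a: "a \<in> U' \<inter> S" and b: "b \<in> U' \<inter> S" and "?F a = ?F b"
      then have "?f (x a) = ?f (x b)" by (simp add: F)
      then have "x a = x b" using U(3) a b xD by (auto simp: inj_on_def U'_def S_def)
      then show "a = b" using r(3) a b by (auto simp: inj_on_def U'_def)
    qed
    ultimately show "\<exists>U. open U \<and> w \<in> U \<and> inj_on ?F (U \<inter> S)" by blast
  qed
  note shear = shear_on_strip[OF I dh dg pos' locF[unfolded S_def]]
  have onto: "\<exists>w. Re w \<in> I \<and> x w = z" if "z \<in> unit_disc" for z
  proof -
    have "cis \<mu> * z \<in> unit_disc" using that by (simp add: norm_mult)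
    then obtain w where "Re w \<in> I" "\<kappa> w = cis \<mu> * z" using \<kappa>onto by blast
    moreover from this have "x w = z" by (simp add: x_def mult.assoc[symmetric] cis_mult)
    ultimately show ?thesis by blast
  qed
  show inj: "inj_on ?f unit_disc"
  proof (rule inj_onI)
    fix a b assume ab: "a \<in> unit_disc" "b \<in> unit_disc" "?f a = ?f b"
    obtain u v where uv: "Re u \<in> I" "x u = a" "Re v \<in> I" "x v = b" using onto ab by metis
    then have "?F u = ?F v" using ab(3) by (simp add: F)
    then have "u = v" using shear(1) uv by (auto simp: inj_on_def)
    then show "a = b" using uv by simp
  qed
  have cf: "continuous_on unit_disc ?f"
    unfolding harmonic_map_def
    by (intro continuous_intros holomorphic_on_imp_continuous_on H G)
  have img: "?f ` unit_disc = (\<lambda>w. cis (- \<mu>) * ?F w) ` S"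
  proof -
    have "unit_disc = x ` S"
    proof (intro subset_antisym subsetI)
      fix z assume "z \<in> unit_disc"
      then obtain w where "Re w \<in> I" "x w = z" using onto by blast
      then show "z \<in> x ` S" unfolding S_def by blast
    qed (use xD in \<open>auto simp: S_def\<close>)
    then show ?thesis by (simp add: image_image F mult.assoc[symmetric] cis_mult)
  qed
  have cF: "continuous_on S ?F"
    unfolding harmonic_map_def S_def
    by (intro continuous_intros) (use dh dg DERIV_isCont in \<open>blast intro: continuous_at_imp_continuous_on\<close>)+
  have "convex_in_direction (- \<mu>) (?f ` unit_disc)"
    unfolding convex_in_direction_def
  proof
    fix v :: complex
    define c where "c = Im (cis \<mu> * v)"
    have inv1: "cis (- \<mu>) * (cis \<mu> * a) = a" and inv2: "cis \<mu> * (cis (- \<mu>) * a) = a" for a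
      by (simp_all add: mult.assoc[symmetric] cis_mult)
    have line: "(\<exists>t :: real. z = v + of_real t * cis (- \<mu>)) \<longleftrightarrow> Im (cis \<mu> * z) = c" for z
    proof
      assume "\<exists>t :: real. z = v + of_real t * cis (- \<mu>)"
      then obtain t :: real where "z = v + of_real t * cis (- \<mu>)" by blast
      then have "cis \<mu> * z = cis \<mu> * v + of_real t"
        by (simp add: distrib_left mult.left_commute[of "cis \<mu>"] cis_mult)
      then show "Im (cis \<mu> * z) = c" by (simp add: c_def del: times_complex.sel)
    next
      assume "Im (cis \<mu> * z) = c"
      define t where "t = Re (cis \<mu> * z - cis \<mu> * v)"
      have "cis \<mu> * z = cis \<mu> * v + of_real t"
        using \<open>Im (cis \<mu> * z) = c\<close> by (simp add: c_def t_def complex_eq_iff)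
      then have "cis (- \<mu>) * (cis \<mu> * z) = cis (- \<mu>) * (cis \<mu> * v) + cis (- \<mu>) * of_real t"
        by (simp only: distrib_left)
      then have "z = v + of_real t * cis (- \<mu>)"
        unfolding inv1 by (simp only: mult.commute)
      then show "\<exists>t :: real. z = v + of_real t * cis (- \<mu>)" by blast
    qed
    have "?f ` unit_disc \<inter> {v + of_real t * cis (- \<mu>) | t :: real. True} =
        (\<lambda>w. cis (- \<mu>) * ?F w) ` {w. Re w \<in> I \<and> Im (?F w) = c}"
    proof (intro subset_antisym subsetI)
      fix z assume "z \<in> ?f ` unit_disc \<inter> {v + of_real t * cis (- \<mu>) | t :: real. True}"
      then obtain w where w: "Re w \<in> I" "z = cis (- \<mu>) * ?F w" and "Im (cis \<mu> * z) = c"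
        unfolding img using line[of z] by (auto simp: S_def simp del: times_complex.sel)
      then have "Im (?F w) = c" by (simp only: inv2)
      with w show "z \<in> (\<lambda>w. cis (- \<mu>) * ?F w) ` {w. Re w \<in> I \<and> Im (?F w) = c}" by blast
    next
      fix z assume "z \<in> (\<lambda>w. cis (- \<mu>) * ?F w) ` {w. Re w \<in> I \<and> Im (?F w) = c}"
      then obtain w where w: "Re w \<in> I" "z = cis (- \<mu>) * ?F w" "Im (?F w) = c" by blast
      then have "Im (cis \<mu> * z) = c" by (simp only: inv2)
      with w(1,2) show "z \<in> ?f ` unit_disc \<inter> {v + of_real t * cis (- \<mu>) | t :: real. True}"
        unfolding img S_def using line[of z] by blast
    qed
    also have "connected \<dots>"
      by (intro connected_continuous_image shear(2) continuous_intros continuous_on_subset[OF cF])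
        (auto simp: S_def)
    finally show "connected (?f ` unit_disc \<inter> {v + of_real t * cis (- \<mu>) | t :: real. True})" .
  qed
  moreover have "open (?f ` unit_disc)"
    by (rule invariance_of_domain[OF cf open_ball inj])
  moreover have "connected (?f ` unit_disc)"
    by (rule connected_continuous_image[OF cf]) simp
  ultimately show "map_convex_in_direction (- \<mu>) ?f"
    by (simp add: map_convex_in_direction_def)
qed

lemma kernel_denominator_nonzero:
  assumes "z \<in> unit_disc"
  shows "1 - 2 * z * cis \<mu> * of_real (cos \<nu>) + z\<^sup>2 * cis (2 * \<mu>) \<noteq> 0"
proof -
  have "cis (2 * \<mu>) = cis \<mu> * cis \<mu>" "2 * of_real (cos \<nu>) = cis \<nu> + cis (- \<nu>)" "cis \<nu> * cis (- \<nu>) = 1"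
    by (simp_all add: cis_mult complex_eq_iff)
  then have "1 - 2 * z * cis \<mu> * of_real (cos \<nu>) + z\<^sup>2 * cis (2 * \<mu>) =
      (1 - z * cis \<mu> * cis \<nu>) * (1 - z * cis \<mu> * cis (- \<nu>))"
    by algebra
  moreover have "1 - z * cis \<mu> * cis t \<noteq> 0" for t
  proof
    assume "1 - z * cis \<mu> * cis t = 0"
    then have "norm (z * cis \<mu> * cis t) = 1" by (metis eq_iff_diff_eq_0 norm_one)
    then show False using assms by (simp add: norm_mult)
  qed
  ultimately show ?thesis by simp
qed

lemma Re_ratio_positive:
  assumes "norm b < norm (a :: complex)"
  shows "Re ((a - b) / (a + b)) > 0"
proof -
  have "a + b \<noteq> 0"
  proof
    assume "a + b = 0"
    then have "a = - b" by (simp add: add_eq_0_iff2)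
    with assms show False by simp
  qed
  moreover have "Re ((a - b) / (a + b)) = Re ((a - b) * cnj (a + b)) / (norm (a + b))\<^sup>2"
    by (subst complex_div_cnj) (simp only: Re_divide_of_real)
  moreover have "Re ((a - b) * cnj (a + b)) = (norm a)\<^sup>2 - (norm b)\<^sup>2"
    unfolding cmod_power2 by (simp add: power2_eq_square algebra_simps)
  moreover have "(norm b)\<^sup>2 < (norm a)\<^sup>2" using assms by (intro power_strict_mono) auto
  ultimately show ?thesis by simp
qed

lemma coefficient_add_cmult:
  assumes "f holomorphic_on unit_disc" "g holomorphic_on unit_disc"
  shows "coefficient (\<lambda>z. f z + c * g z) n = coefficient f n + c * coefficient g n"
proof -
  have "(\<lambda>z. f z + c * g z) has_fps_expansion fps_expansion f 0 + fps_const c * fps_expansion g 0"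
    by (intro fps_expansion_intros disc_fps_expansion assms)
  from fps_expansion_eqI[OF this] show ?thesis by simp
qed

theorem theorem2p4:
  fixes h\<^sub>1 g\<^sub>1 h\<^sub>2 g\<^sub>2 :: "complex \<Rightarrow> complex" and \<mu>\<^sub>1 \<mu>\<^sub>2 \<nu> :: real
  assumes "normalized_harmonic h\<^sub>1 g\<^sub>1"
    and "locally_univalent_on unit_disc (harmonic_map h\<^sub>1 g\<^sub>1)"
    and "sense_preserving_on unit_disc (harmonic_map h\<^sub>1 g\<^sub>1)"
    and "normalized_harmonic h\<^sub>2 g\<^sub>2"
    and "locally_univalent_on unit_disc (harmonic_map h\<^sub>2 g\<^sub>2)"
    and "sense_preserving_on unit_disc (harmonic_map h\<^sub>2 g\<^sub>2)"
    and "(\<lambda>z. h\<^sub>1 z + cis (- 2 * \<mu>\<^sub>1) * g\<^sub>1 z) \<in> convex_univalent"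
    and "(\<lambda>z. h\<^sub>2 z + cis (- 2 * \<mu>\<^sub>2) * g\<^sub>2 z) \<in> convex_univalent"
    and "\<And>z. z \<in> unit_disc \<Longrightarrow>
      ((\<lambda>z. h\<^sub>1 z + cis (- 2 * \<mu>\<^sub>1) * g\<^sub>1 z) \<star> (\<lambda>z. h\<^sub>2 z + cis (- 2 * \<mu>\<^sub>2) * g\<^sub>2 z)) z =
      contour_integral (linepath 0 z)
        (\<lambda>\<xi>. 1 / (1 - 2 * \<xi> * cis (\<mu>\<^sub>1 + \<mu>\<^sub>2) * of_real (cos \<nu>) + \<xi>\<^sup>2 * cis (2 * (\<mu>\<^sub>1 + \<mu>\<^sub>2))))"
    and "locally_univalent_on unit_disc (harmonic_convolution h\<^sub>1 g\<^sub>1 h\<^sub>2 g\<^sub>2)"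
    and "sense_preserving_on unit_disc (harmonic_convolution h\<^sub>1 g\<^sub>1 h\<^sub>2 g\<^sub>2)"
  shows "inj_on (harmonic_convolution h\<^sub>1 g\<^sub>1 h\<^sub>2 g\<^sub>2) unit_disc \<and>
    map_convex_in_direction (- (\<mu>\<^sub>1 + \<mu>\<^sub>2)) (harmonic_convolution h\<^sub>1 g\<^sub>1 h\<^sub>2 g\<^sub>2)"
proof -
  define \<mu> where "\<mu> = \<mu>\<^sub>1 + \<mu>\<^sub>2"
  define e\<^sub>1 e\<^sub>2 where "e\<^sub>1 = cis (- 2 * \<mu>\<^sub>1)" and "e\<^sub>2 = cis (- 2 * \<mu>\<^sub>2)"
  have ee: "e\<^sub>1 * e\<^sub>2 = cis (- 2 * \<mu>)"
    by (simp add: e\<^sub>1_def e\<^sub>2_def \<mu>_def cis_mult algebra_simps)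
  define \<phi>\<^sub>1 \<phi>\<^sub>2 where "\<phi>\<^sub>1 z = h\<^sub>1 z + e\<^sub>1 * g\<^sub>1 z" and "\<phi>\<^sub>2 z = h\<^sub>2 z + e\<^sub>2 * g\<^sub>2 z" for z
  define k\<^sub>1 k\<^sub>2 where "k\<^sub>1 z = h\<^sub>1 z + (- e\<^sub>1) * g\<^sub>1 z" and "k\<^sub>2 z = h\<^sub>2 z + (- e\<^sub>2) * g\<^sub>2 z" for z
  have \<phi>: "\<phi>\<^sub>1 \<in> convex_univalent" "\<phi>\<^sub>2 \<in> convex_univalent"
    using assms(7,8) by (simp_all add: \<phi>\<^sub>1_def[abs_def] \<phi>\<^sub>2_def[abs_def] e\<^sub>1_def e\<^sub>2_def)
  have hol: "h\<^sub>1 holomorphic_on unit_disc" "g\<^sub>1 holomorphic_on unit_disc"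
      "h\<^sub>2 holomorphic_on unit_disc" "g\<^sub>2 holomorphic_on unit_disc"
    using assms(1,4) by (auto simp: normalized_harmonic_def)
  have hol\<phi>: "\<phi>\<^sub>1 holomorphic_on unit_disc" "\<phi>\<^sub>2 holomorphic_on unit_disc"
      "k\<^sub>1 holomorphic_on unit_disc" "k\<^sub>2 holomorphic_on unit_disc"
    unfolding \<phi>\<^sub>1_def \<phi>\<^sub>2_def k\<^sub>1_def k\<^sub>2_def by (intro holomorphic_intros hol)+
  have sp: "norm (deriv g\<^sub>1 z) < norm (deriv h\<^sub>1 z)" "norm (deriv g\<^sub>2 z) < norm (deriv h\<^sub>2 z)"
    if "z \<in> unit_disc" for z
    using assms(3,6) sense_preserving_harmonic_map_iff hol that by blast+
  have dsum: "deriv (\<lambda>z. h z + c * g z) z = deriv h z + c * deriv g z"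
    if "h holomorphic_on unit_disc" "g holomorphic_on unit_disc" "z \<in> unit_disc" for h g c z
    by (intro DERIV_imp_deriv DERIV_add DERIV_cmult holomorphic_derivI[OF that(1) open_ball that(3)]
        holomorphic_derivI[OF that(2) open_ball that(3)])
  have ratio: "Re (deriv (\<lambda>z. h z + (- c) * g z) z / deriv (\<lambda>z. h z + c * g z) z) > 0"
    if "h holomorphic_on unit_disc" "g holomorphic_on unit_disc" "z \<in> unit_disc"
      "norm (deriv g z) < norm (deriv h z)" "norm c = 1" for h g c z
    unfolding dsum[OF that(1-3)]
    using Re_ratio_positive[of "c * deriv g z" "deriv h z"] that(4,5) by (simp add: norm_mult)
  have pos: "Re (deriv k\<^sub>1 z / deriv \<phi>\<^sub>1 z) > 0" "Re (deriv k\<^sub>2 z / deriv \<phi>\<^sub>2 z) > 0" if "z \<in> unit_disc" for z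
    unfolding k\<^sub>1_def k\<^sub>2_def \<phi>\<^sub>1_def \<phi>\<^sub>2_def
    by (intro ratio hol that sp; simp add: e\<^sub>1_def e\<^sub>2_def)+
  define Q where "Q z = 1 - 2 * z * cis \<mu> * of_real (cos \<nu>) + z\<^sup>2 * cis (2 * \<mu>)" for z
  have Qnz: "Q z \<noteq> 0" if "z \<in> unit_disc" for z
    unfolding Q_def by (rule kernel_denominator_nonzero[OF that])
  define \<Phi> where "\<Phi> = \<phi>\<^sub>1 \<star> \<phi>\<^sub>2"
  have d\<Phi>: "deriv \<Phi> z = 1 / Q z" if z: "z \<in> unit_disc" for z
  proof -
    have hQ: "(\<lambda>\<xi>. 1 / Q \<xi>) holomorphic_on unit_disc"
      using Qnz unfolding Q_def by (intro holomorphic_intros) auto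
    obtain P where P: "\<And>\<xi>. \<xi> \<in> unit_disc \<Longrightarrow> (P has_field_derivative 1 / Q \<xi>) (at \<xi> within unit_disc)"
      using holomorphic_convex_primitive'[OF convex_ball open_ball hQ] by blast
    have P': "(P has_field_derivative 1 / Q \<xi>) (at \<xi>)" if "\<xi> \<in> unit_disc" for \<xi>
      using P[OF that] at_within_open[OF that open_ball] by simp
    have eq: "P w - P 0 = \<Phi> w" if w: "w \<in> unit_disc" for w
    proof -
      have "closed_segment 0 w \<subseteq> unit_disc" by (rule closed_segment_subset) (use w in auto)
      then have "contour_integral (linepath 0 w) (\<lambda>\<xi>. 1 / Q \<xi>) = P w - P 0"
        using contour_integral_primitive[OF P, of "linepath 0 w"] contour_integral_unique by fastforce
      then show ?thesis
        using assms(9)[OF w] by (simp add: \<Phi>_def \<phi>\<^sub>1_def[abs_def] \<phi>\<^sub>2_def[abs_def] e\<^sub>1_def e\<^sub>2_def Q_def \<mu>_def)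
    qed
    have "((\<lambda>w. P w - P 0) has_field_derivative 1 / Q z) (at z)"
      using DERIV_diff[OF P'[OF z] DERIV_const[of "P 0"]] by simp
    then have "(\<Phi> has_field_derivative 1 / Q z) (at z)"
      by (rule has_field_derivative_transform_within_open[OF _ open_ball z]) (rule eq)
    then show ?thesis by (rule DERIV_imp_deriv)
  qed
  define H G where "H = h\<^sub>1 \<star> h\<^sub>2" and "G = g\<^sub>1 \<star> g\<^sub>2"
  have HG: "H holomorphic_on unit_disc" "G holomorphic_on unit_disc"
    unfolding H_def G_def by (intro convolution_holomorphic hol)+
  define A B where "A = k\<^sub>1 \<star> \<phi>\<^sub>2" and "B = k\<^sub>2 \<star> \<phi>\<^sub>1"
  have AB: "A holomorphic_on unit_disc" "B holomorphic_on unit_disc"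
    unfolding A_def B_def by (intro convolution_holomorphic hol\<phi>)+
  have avg: "2 * (H z + (- cis (- 2 * \<mu>)) * G z) = A z + B z" if z: "z \<in> unit_disc" for z
  proof -
    have "(\<lambda>n. coefficient k\<^sub>1 n * coefficient \<phi>\<^sub>2 n * z ^ n + coefficient k\<^sub>2 n * coefficient \<phi>\<^sub>1 n * z ^ n) sums (A z + B z)"
      unfolding A_def B_def by (intro sums_add convolution_sums hol\<phi> z)
    moreover have "(\<lambda>n. 2 * (coefficient h\<^sub>1 n * coefficient h\<^sub>2 n * z ^ n +
        (- cis (- 2 * \<mu>)) * (coefficient g\<^sub>1 n * coefficient g\<^sub>2 n * z ^ n))) sums
        (2 * (H z + (- cis (- 2 * \<mu>)) * G z))"
      unfolding H_def G_def by (intro sums_mult sums_add convolution_sums hol z)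
    moreover have "coefficient k\<^sub>1 n * coefficient \<phi>\<^sub>2 n * z ^ n + coefficient k\<^sub>2 n * coefficient \<phi>\<^sub>1 n * z ^ n =
        2 * (coefficient h\<^sub>1 n * coefficient h\<^sub>2 n * z ^ n +
        (- cis (- 2 * \<mu>)) * (coefficient g\<^sub>1 n * coefficient g\<^sub>2 n * z ^ n))" for n
      unfolding k\<^sub>1_def k\<^sub>2_def \<phi>\<^sub>1_def \<phi>\<^sub>2_def coefficient_add_cmult[OF hol(1,2)] coefficient_add_cmult[OF hol(3,4)]
        ee[symmetric]
      by (simp add: algebra_simps)
    ultimately show ?thesis using sums_unique2 by simp
  qed
  have "Re ((deriv H z - cis (- 2 * \<mu>) * deriv G z) * Q z) > 0" if z: "z \<in> unit_disc" for z
  proof -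
    have nz: "deriv (\<phi>\<^sub>1 \<star> \<phi>\<^sub>2) z \<noteq> 0" "deriv (\<phi>\<^sub>2 \<star> \<phi>\<^sub>1) z \<noteq> 0"
      using d\<Phi>[OF z] Qnz[OF z] convolution_commute[of \<phi>\<^sub>2 \<phi>\<^sub>1] by (simp_all add: \<Phi>_def)
    have "Re (deriv A z / deriv \<Phi> z) > 0"
      unfolding A_def \<Phi>_def
      by (rule convolution_deriv_ratio_positive[OF \<phi>(2,1) hol\<phi>(3) pos(1) z nz(1)])
    moreover have "Re (deriv B z / deriv \<Phi> z) > 0"
      unfolding B_def \<Phi>_def convolution_commute[of \<phi>\<^sub>1 \<phi>\<^sub>2]
      by (rule convolution_deriv_ratio_positive[OF \<phi> hol\<phi>(4) pos(2) z nz(2)])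
    moreover have "2 * (deriv H z - cis (- 2 * \<mu>) * deriv G z) = deriv A z + deriv B z"
    proof -
      have "((\<lambda>z. A z + B z) has_field_derivative deriv A z + deriv B z) (at z)"
        by (intro DERIV_add holomorphic_derivI[OF AB(1) open_ball z] holomorphic_derivI[OF AB(2) open_ball z])
      moreover have "((\<lambda>z. A z + B z) has_field_derivative 2 * (deriv H z + (- cis (- 2 * \<mu>)) * deriv G z)) (at z)"
      proof (rule has_field_derivative_transform_within_open[OF _ open_ball z])
        show "((\<lambda>z. 2 * (H z + (- cis (- 2 * \<mu>)) * G z)) has_field_derivative
            2 * (deriv H z + (- cis (- 2 * \<mu>)) * deriv G z)) (at z)"
          by (intro DERIV_add DERIV_cmult holomorphic_derivI[OF HG(1) open_ball z] holomorphic_derivI[OF HG(2) open_ball z])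
      qed (rule avg)
      ultimately show ?thesis using DERIV_unique by fastforce
    qed
    then have "2 * Re ((deriv H z - cis (- 2 * \<mu>) * deriv G z) * Q z) = Re (deriv A z * Q z) + Re (deriv B z * Q z)"
      by (metis (no_types, lifting) Re_complex_of_real distrib_right mult.assoc mult_2 plus_complex.sel(1))
    ultimately show ?thesis by (simp add: d\<Phi>[OF z] del: times_complex.sel)
  qed
  then show ?thesis
    using shear_criterion[OF HG, of \<mu> \<nu>] assms(10)
    unfolding harmonic_convolution_def H_def[symmetric] G_def[symmetric] Q_def \<mu>_def[symmetric] by blast
qed

end
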